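(* Let $a,b>0$ be arbitrary real numbers and let $s_n(a,b)=\Gamma(an+b)/\Gamma(b)$, $n\in\mathbb{N}_0$. Then: (i) $(s_n(a,b))_{n\ge 0}$ is an infinitely divisible Stieltjes moment sequence. (ii) There exists a uniquely determined convolution semigroup $(\tau_c(a,b))_{c>0}$ of probability measures on the multiplicative group $(0,\infty)$ such that for all $c>0$ $$\int_0^\infty t^z\,d\tau_c(a,b)(t)=[\Gamma(az+b)/\Gamma(b)]^c,\quad z\in\mathbb{C},\ \operatorname{Re} z>-b/a,$$ and in particular $(s_n(a,b)^c)_{n\ge 0}$ is the moment sequence of $\tau_c(a,b)$. (iii) For every $c>0$, $\tau_c(a,b)=e_c(a,b)(t)\,dt$ on $(0,\infty)$, where $$e_c(a,b)(t)=\frac{1}{2\pi}\int_{-\infty}^\infty t^{ix-1}[\Gamma(b-iax)/\Gamma(b)]^c\,dx,\quad t>0,$$ is a probability density belonging to $C^\infty(0,\infty)$. (iv) For every $c>0$, the sequence $(s_n(a,b)^c)_{n\ge 0}$ is S-determinate if and only if $ac\le 2$, hence independently of $b>0$.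
   Context: $\mathbb{N}_0=\{0,1,2,\ldots\}$. A Stieltjes moment sequence is a sequence of the form $s_n=\int_0^\infty t^n\,d\mu(t)$, $n\in\mathbb{N}_0$, where $\mu$ is a positive measure on $[0,\infty)$ with $t^n\in L^1(\mu)$ for all $n\in\mathbb{N}_0$. It is S-determinate if there is exactly one such positive measure $\mu$ on $[0,\infty)$, and S-indeterminate if there are several. A Stieltjes moment sequence $(s_n)$ is infinitely divisible if $(s_n^c)$ is a Stieltjes moment sequence for every $c>0$. Powers of Gamma: $\Gamma$ is holomorphic and non-vanishing on $\mathcal{A}=\mathbb{C}\setminus(-\infty,0]$; $\log\Gamma$ denotes the holomorphic branch on $\mathcal{A}$ of the logarithm of $\Gamma$ that is $0$ at $z=1$ (it is real on $(0,\infty)$), $\Gamma(z)^c:=\exp(c\log\Gamma(z))$ for $z\in\mathcal{A}$, and $[\Gamma(z)/\Gamma(b)]^c:=\Gamma(z)^c/\Gamma(b)^c$. Product convolution $\mu\diamond\sigma$ of measures on $(0,\infty)$ is defined by $\int_0^\infty f\,d(\mu\diamond\sigma)=\int_0^\infty\int_0^\infty f(ts)\,d\mu(t)\,d\sigma(s)$ for continuous $f$ with compact support in $(0,\infty)$. A family $(\mu_c)_{c>0}$ of probability measures on the multiplicative group $(0,\infty)$ is a convolution semigroup if $\mu_c\diamond\mu_d=\mu_{c+d}$ for all $c,d>0$ and $\lim_{c\to0}\mu_c=\varepsilon_1$ vaguely, where $\varepsilon_1$ is the Dirac measure of mass $1$ at $1$. *)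

theory Defs
  imports "HOL-Probability.Probability"
begin

definition borel_measure_on :: "real set \<Rightarrow> real measure \<Rightarrow> bool" where
  "borel_measure_on S \<mu> \<longleftrightarrow> sets \<mu> = sets (restrict_space borel S)"

definition has_moments :: "real measure \<Rightarrow> (nat \<Rightarrow> real) \<Rightarrow> bool" where
  "has_moments \<mu> s \<longleftrightarrow> (\<forall>n. has_bochner_integral \<mu> (\<lambda>t. t ^ n) (s n))"

definition Stieltjes_moment_sequence :: "(nat \<Rightarrow> real) \<Rightarrow> bool" where
  "Stieltjes_moment_sequence s \<longleftrightarrow> (\<exists>\<mu>. borel_measure_on {0..} \<mu> \<and> has_moments \<mu> s)"

definition S_determinate :: "(nat \<Rightarrow> real) \<Rightarrow> bool" where
  "S_determinate s \<longleftrightarrow> (\<exists>!\<mu>. borel_measure_on {0..} \<mu> \<and> has_moments \<mu> s)"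

text \<open>Stieltjes moments are non-negative, and \<^term>\<open>0 powr c = (0::real)\<close> agrees with the usual
  convention for \<open>c > 0\<close>.\<close>

definition infinitely_divisible_Stieltjes :: "(nat \<Rightarrow> real) \<Rightarrow> bool" where
  "infinitely_divisible_Stieltjes s \<longleftrightarrow>
     Stieltjes_moment_sequence s \<and> (\<forall>c>0. Stieltjes_moment_sequence (\<lambda>n. s n powr c))"

text \<open>Only the values on \<open>(0,\<infinity>)\<close> of a test function matter.\<close>

definition Cc_pos :: "(real \<Rightarrow> real) \<Rightarrow> bool" where
  "Cc_pos f \<longleftrightarrow> continuous_on {0<..} f \<and>
     (\<exists>K. compact K \<and> K \<subseteq> {0<..} \<and> (\<forall>t\<in>{0<..} - K. f t = 0))"

definition is_product_convolution :: "real measure \<Rightarrow> real measure \<Rightarrow> real measure \<Rightarrow> bool" where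
  "is_product_convolution \<mu> \<sigma> \<rho> \<longleftrightarrow>
     (\<forall>f. Cc_pos f \<longrightarrow> (LINT x|\<rho>. f x) = (LINT s|\<sigma>. LINT t|\<mu>. f (t * s)))"

definition vaguely_tends_to :: "('i \<Rightarrow> real measure) \<Rightarrow> real measure \<Rightarrow> 'i filter \<Rightarrow> bool" where
  "vaguely_tends_to \<mu> \<nu> F \<longleftrightarrow>
     (\<forall>f. Cc_pos f \<longrightarrow> ((\<lambda>i. LINT t|\<mu> i. f t) \<longlongrightarrow> (LINT t|\<nu>. f t)) F)"

text \<open>A family \<open>(\<mu>\<^sub>c)\<close>, \<open>c > 0\<close>, is encoded as a function on the reals whose values at \<open>c \<le> 0\<close>
  are irrelevant.\<close>

definition convolution_semigroup :: "(real \<Rightarrow> real measure) \<Rightarrow> bool" where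
  "convolution_semigroup \<mu> \<longleftrightarrow>
     (\<forall>c>0. borel_measure_on {0<..} (\<mu> c) \<and> prob_space (\<mu> c)) \<and>
     (\<forall>c>0. \<forall>d>0. is_product_convolution (\<mu> c) (\<mu> d) (\<mu> (c + d))) \<and>
     vaguely_tends_to \<mu> (return (restrict_space borel {0<..}) 1) (at_right 0)"

text \<open>The library function \<^const>\<open>ln_Gamma\<close> is the holomorphic branch of \<open>log \<Gamma>\<close> on the plane slit
  along \<open>(-\<infinity>, 0]\<close> that vanishes at 1.\<close>

lemma ln_Gamma_branch:
  shows "ln_Gamma holomorphic_on (- \<real>\<^sub>\<le>\<^sub>0 :: complex set)"
    and "z \<notin> \<real>\<^sub>\<le>\<^sub>0 \<Longrightarrow> exp (ln_Gamma z) = Gamma (z :: complex)"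
    and "ln_Gamma (1 :: complex) = 0"
proof -
  show "ln_Gamma holomorphic_on (- \<real>\<^sub>\<le>\<^sub>0 :: complex set)"
    by (rule holomorphic_ln_Gamma) auto
  show "exp (ln_Gamma z) = Gamma z" if "z \<notin> \<real>\<^sub>\<le>\<^sub>0"
    using that nonpos_Ints_subset_nonpos_Reals by (auto simp: Gamma_complex_altdef)
  show "ln_Gamma (1 :: complex) = 0"
    using ln_Gamma_complex_conv_fact[of 1] by simp
qed

lemma ln_Gamma_branch_unique:
  fixes L :: "complex \<Rightarrow> complex"
  assumes L: "L holomorphic_on - \<real>\<^sub>\<le>\<^sub>0" "\<And>z. z \<notin> \<real>\<^sub>\<le>\<^sub>0 \<Longrightarrow> exp (L z) = Gamma z" "L 1 = 0"
    and z: "z \<notin> \<real>\<^sub>\<le>\<^sub>0"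
  shows "L z = ln_Gamma z"
proof -
  define A where "A = (- \<real>\<^sub>\<le>\<^sub>0 :: complex set)"
  define h where "h = (\<lambda>z. L z - ln_Gamma z)"
  have hol: "h holomorphic_on A"
    unfolding h_def A_def by (intro holomorphic_intros L) auto
  have "open A"
    unfolding A_def using closed_nonpos_Reals_complex by auto
  have "(\<real>\<^sub>\<le>\<^sub>0 :: complex set) = complex_of_real ` {..0}"
    by (auto simp: nonpos_Reals_def)
  hence "connected A"
    unfolding A_def by (metis starlike_imp_connected starlike_slotted_complex_plane_left)
  have exp_h: "exp (h w) = 1" if "w \<in> A" for w
    using that L(2) ln_Gamma_branch(2)[of w] by (auto simp: h_def A_def exp_diff)
  have deriv_0: "(h has_field_derivative 0) (at w)" if w: "w \<in> A" for w
  proof -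
    have d: "(h has_field_derivative deriv h w) (at w)"
      using hol \<open>open A\<close> w by (rule holomorphic_derivI)
    have "((\<lambda>w. exp (h w)) has_field_derivative exp (h w) * deriv h w) (at w)"
      using d by (auto intro!: derivative_eq_intros)
    moreover have "((\<lambda>w. exp (h w)) has_field_derivative 0) (at w)"
      by (rule has_field_derivative_transform_within_open[OF DERIV_const[of 1] \<open>open A\<close> w])
         (simp add: exp_h)
    ultimately have "deriv h w = 0"
      by (metis DERIV_unique exp_not_eq_zero mult_eq_0_iff)
    with d show ?thesis by simp
  qed
  have one: "1 \<in> A" by (auto simp: A_def complex_nonpos_Reals_iff)
  obtain k where k: "\<And>w. w \<in> A \<Longrightarrow> h w = k"
    using DERIV_zero_connected_constant[OF \<open>connected A\<close> \<open>open A\<close> finite.emptyI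
        holomorphic_on_imp_continuous_on[OF hol]] deriv_0 by auto
  have "h 1 = 0"
    using L(3) ln_Gamma_branch(3) by (simp add: h_def)
  hence "h z = 0"
    using k one z by (simp add: A_def)
  thus ?thesis by (simp add: h_def)
qed

definition Gamma_power :: "complex \<Rightarrow> real \<Rightarrow> complex" where
  "Gamma_power z c = exp (of_real c * ln_Gamma z)"

definition Gamma_ratio_power :: "complex \<Rightarrow> real \<Rightarrow> real \<Rightarrow> complex" where
  "Gamma_ratio_power z b c = Gamma_power z c / Gamma_power (of_real b) c"

definition gamma_moment :: "real \<Rightarrow> real \<Rightarrow> nat \<Rightarrow> real" where
  "gamma_moment a b n = Gamma (a * real n + b) / Gamma b"

definition Mellin_formula :: "real \<Rightarrow> real \<Rightarrow> (real \<Rightarrow> real measure) \<Rightarrow> bool" where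
  "Mellin_formula a b \<tau> \<longleftrightarrow>
     (\<forall>c>0. \<forall>z. Re z > - b / a \<longrightarrow>
        has_bochner_integral (\<tau> c) (\<lambda>t. complex_of_real t powr z)
          (Gamma_ratio_power (of_real a * z + of_real b) b c))"

definition e_integrand :: "real \<Rightarrow> real \<Rightarrow> real \<Rightarrow> real \<Rightarrow> real \<Rightarrow> complex" where
  "e_integrand a b c t x =
     complex_of_real t powr (\<i> * of_real x - 1) *
     Gamma_ratio_power (of_real b - \<i> * of_real a * of_real x) b c"

text \<open>The integral is complex-valued a priori; that it is real and non-negative is part of the
  assertion that it is a probability density.\<close>

definition e_density :: "real \<Rightarrow> real \<Rightarrow> real \<Rightarrow> real \<Rightarrow> complex" where
  "e_density a b c t = 1 / (2 * of_real pi) * (LINT x|lborel. e_integrand a b c t x)"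

definition probability_density_pos :: "(real \<Rightarrow> complex) \<Rightarrow> bool" where
  "probability_density_pos f \<longleftrightarrow>
     (\<forall>t>0. f t \<in> \<real>\<^sub>\<ge>\<^sub>0) \<and> has_bochner_integral (restrict_space lborel {0<..}) f 1"

text \<open>Derivatives of all orders on the set \<open>S\<close>, which is meant to be open, so that the iterated
  two-sided derivatives depend only on the values of \<open>f\<close> on \<open>S\<close>.\<close>

definition C_infinity_on :: "real set \<Rightarrow> (real \<Rightarrow> 'a::real_normed_vector) \<Rightarrow> bool" where
  "C_infinity_on S f \<longleftrightarrow>
     (\<forall>k. \<forall>t\<in>S. ((\<lambda>g t. vector_derivative g (at t)) ^^ k) f differentiable at t)"

end

theory Submission
  imports Defs "HOL-Complex_Analysis.Complex_Analysis" "HOL-Real_Asymp.Real_Asymp"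
begin

text \<open>By Euler's limit formula, \<open>(\<Gamma>(a r + b) / \<Gamma>(b)) powr c\<close> is a pointwise limit of products of
  exponentials \<open>exp (r x)\<close> and factors \<open>(q / (q + r)) powr c\<close>, which are moment generating functions of
  point masses and of reflected gamma laws. A pointwise limit of moment generating functions on a
  half-line around 0 is again one, which yields a law on the real line whose image under \<open>exp\<close> is
  \<open>\<tau>\<^sub>c\<close>. Analytic continuation extends the formula to complex arguments, and Fourier inversion gives the
  density because \<open>\<Gamma>(b + i y)\<close> decays faster than any power of \<open>y\<close>.

  If \<open>a c \<le> 2\<close>, the moments are \<open>O(K^n (2 n)!)\<close>, so the symmetrised square root of any solution has an
  exponential moment and is determined by its moments. If \<open>a c > 2\<close>, put \<open>\<alpha> = a c\<close> and \<open>\<beta> = b c + 1\<close>. The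
  quotient of \<open>(\<Gamma>(a r + b) / \<Gamma>(b)) powr c\<close> by \<open>\<Gamma>(\<alpha> r + \<beta>) / \<Gamma>(\<beta>)\<close> is still a moment generating
  function, and Stieltjes' oscillating perturbation of the gamma density changes the law of the
  \<open>\<alpha>\<close>-th power of a gamma variable but not its integer moments.\<close>

section \<open>Moment generating functions on a half-line\<close>

text \<open>On the logarithmic scale product convolution becomes ordinary convolution, and weak
  convergence, characteristic functions and Levy's theorems apply; \<open>exp\<close> carries the
  results over. The half-line \<open>r > -b / a\<close> ends at the first pole of the Gamma
  quotient, and no Euler approximant has a pole to the right of it. Convergence of the transforms
  says more than weak convergence: exponentially weighted mass must not escape to infinity, which
  shapes the limit lemma. For general \<open>c\<close> the density is only known as an oscillating
  integral, so a gamma law, whose density can be perturbed by hand, is split off. With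
  \<open>\<alpha> = a c\<close> this factor accounts for the growth of the moments up to geometric
  and polynomial factors, and \<open>\<beta> = b c + 1\<close> leaves every zero of the quotient
  enough poles to its right. The threshold 2 arises from two sides: the angle
  \<open>pi / \<alpha>\<close>, which makes the perturbation invisible to integer moments, must stay
  below \<open>pi / 2\<close>, and the square root turns moments of size \<open>(2 n)!\<close> into
  even moments that an exponential moment controls.\<close>

definition has_mgf :: "real measure \<Rightarrow> real \<Rightarrow> (real \<Rightarrow> real) \<Rightarrow> bool" where
  "has_mgf M \<rho> \<Phi> \<longleftrightarrow> real_distribution M \<and>
     (\<forall>r>-\<rho>. has_bochner_integral M (\<lambda>x. exp (r * x)) (\<Phi> r))"

text \<open>The laws below come as densities, images and mixtures, whose extended integrals are
  computed without prior integrability; the value at \<open>r = 0\<close> supplies total mass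
  one.\<close>

lemma has_mgfI_nn_integral:
  assumes "\<rho> > 0" "sets M = sets borel" "\<Phi> 0 = 1" "\<And>r. r > -\<rho> \<Longrightarrow> \<Phi> r \<ge> 0"
    and int: "\<And>r. r > -\<rho> \<Longrightarrow> (\<integral>\<^sup>+x. ennreal (exp (r * x)) \<partial>M) = ennreal (\<Phi> r)"
  shows "has_mgf M \<rho> \<Phi>"
proof -
  have "emeasure M (space M) = 1"
    using int[of 0] assms(1,3) by simp
  then interpret prob_space M
    by (rule prob_spaceI)
  have "real_distribution M"
    using assms(2) by unfold_locales
  moreover have "has_bochner_integral M (\<lambda>x. exp (r * x)) (\<Phi> r)" if "r > -\<rho>" for r
    using assms(4)[of r] int[of r] that by (intro has_bochner_integral_nn_integral) (auto simp: measurable_cong_sets[OF assms(2) refl])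
  ultimately show ?thesis
    by (simp add: has_mgf_def)
qed

lemma has_mgfD:
  assumes "has_mgf M \<rho> \<Phi>"
  shows "real_distribution M"
    and "r > -\<rho> \<Longrightarrow> integrable M (\<lambda>x. exp (r * x))"
    and "r > -\<rho> \<Longrightarrow> (\<integral>x. exp (r * x) \<partial>M) = \<Phi> r"
    and "r > -\<rho> \<Longrightarrow> \<Phi> r > 0"
    and "r > -\<rho> \<Longrightarrow> (\<integral>\<^sup>+x. ennreal (exp (r * x)) \<partial>M) = ennreal (\<Phi> r)"
    and "\<rho> > 0 \<Longrightarrow> \<Phi> 0 = 1"
proof -
  show M: "real_distribution M" using assms by (simp add: has_mgf_def)
  interpret real_distribution M by fact
  have *: "has_bochner_integral M (\<lambda>x. exp (r * x)) (\<Phi> r)" if "r > -\<rho>" for r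
    using assms that by (simp add: has_mgf_def)
  show i: "r > -\<rho> \<Longrightarrow> integrable M (\<lambda>x. exp (r * x))"
    and e: "r > -\<rho> \<Longrightarrow> (\<integral>x. exp (r * x) \<partial>M) = \<Phi> r"
    using *[of r] by (simp_all add: has_bochner_integral_iff)
  show n: "r > -\<rho> \<Longrightarrow> (\<integral>\<^sup>+x. ennreal (exp (r * x)) \<partial>M) = ennreal (\<Phi> r)"
    using i e by (subst nn_integral_eq_integral) auto
  show "r > -\<rho> \<Longrightarrow> \<Phi> r > 0"
  proof -
    assume r: "r > -\<rho>"
    have "\<not> (AE x in M. exp (r * x) = 0)"
      using AE_False by auto
    with r i have "(\<integral>x. exp (r * x) \<partial>M) \<noteq> 0"
      by (subst integral_nonneg_eq_0_iff_AE) auto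
    moreover have "(\<integral>x. exp (r * x) \<partial>M) \<ge> 0" by simp
    ultimately show "\<Phi> r > 0" using e[OF r] by linarith
  qed
  show "\<rho> > 0 \<Longrightarrow> \<Phi> 0 = 1"
    using *[of 0] prob_space by (auto simp: has_bochner_integral_iff)
qed

lemma has_mgf_cong:
  assumes "has_mgf M \<rho> \<Phi>" "\<rho>' \<le> \<rho>" "\<And>r. r > -\<rho>' \<Longrightarrow> \<Phi> r = \<Psi> r"
  shows "has_mgf M \<rho>' \<Psi>"
  unfolding has_mgf_def
proof (intro conjI allI impI)
  fix r assume r: "r > -\<rho>'"
  then have "has_bochner_integral M (\<lambda>x. exp (r * x)) (\<Phi> r)"
    using assms(1,2) by (simp add: has_mgf_def)
  then show "has_bochner_integral M (\<lambda>x. exp (r * x)) (\<Psi> r)"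
    using assms(3)[OF r] by simp
qed (use has_mgfD(1)[OF assms(1)] in simp)

lemma has_mgf_return: "\<rho> > 0 \<Longrightarrow> has_mgf (return borel x) \<rho> (\<lambda>r. exp (r * x))"
  by (rule has_mgfI_nn_integral) (auto simp: nn_integral_return)

lemma has_mgf_convolution:
  assumes "\<rho> > 0" "has_mgf M \<rho> \<Phi>" "has_mgf N \<rho> \<Psi>"
  shows "has_mgf (M \<star> N) \<rho> (\<lambda>r. \<Phi> r * \<Psi> r)"
proof (rule has_mgfI_nn_integral)
  interpret M: real_distribution M using assms(2) by (rule has_mgfD)
  interpret N: real_distribution N using assms(3) by (rule has_mgfD)
  fix r assume r: "r > -\<rho>"
  show "\<Phi> r * \<Psi> r \<ge> 0"
    using has_mgfD(4)[OF assms(2) r] has_mgfD(4)[OF assms(3) r] by simp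
  have "(\<integral>\<^sup>+x. ennreal (exp (r * x)) \<partial>(M \<star> N)) = (\<integral>\<^sup>+x. \<integral>\<^sup>+y. ennreal (exp (r * x)) * ennreal (exp (r * y)) \<partial>N \<partial>M)"
    by (subst nn_integral_convolution)
       (auto simp: M.finite_measure_axioms N.finite_measure_axioms exp_add algebra_simps ennreal_mult' )
  also have "\<dots> = ennreal (\<Phi> r * \<Psi> r)"
    using has_mgfD(4,5)[OF assms(2) r] has_mgfD(4,5)[OF assms(3) r]
    by (simp add: nn_integral_cmult nn_integral_multc ennreal_mult')
  finally show "(\<integral>\<^sup>+x. ennreal (exp (r * x)) \<partial>(M \<star> N)) = ennreal (\<Phi> r * \<Psi> r)" .
qed (use assms has_mgfD(6)[OF assms(2,1)] has_mgfD(6)[OF assms(3,1)] in auto)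

text \<open>Only existence is recorded, since a limit law is obtained along a subsequence.
  Uniqueness, which the semigroup property needs, follows later from the characteristic
  function.\<close>

definition is_mgf :: "real \<Rightarrow> (real \<Rightarrow> real) \<Rightarrow> bool" where
  "is_mgf \<rho> \<Phi> \<longleftrightarrow> (\<exists>M. has_mgf M \<rho> \<Phi>)"

lemma is_mgf_cong:
  "is_mgf \<rho> \<Phi> \<Longrightarrow> \<rho>' \<le> \<rho> \<Longrightarrow> (\<And>r. r > -\<rho>' \<Longrightarrow> \<Phi> r = \<Psi> r) \<Longrightarrow> is_mgf \<rho>' \<Psi>"
  unfolding is_mgf_def using has_mgf_cong by blast

lemma is_mgf_exp: "\<rho> > 0 \<Longrightarrow> is_mgf \<rho> (\<lambda>r. exp (r * x))"
  unfolding is_mgf_def using has_mgf_return by blast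

lemma is_mgf_mult: "\<rho> > 0 \<Longrightarrow> is_mgf \<rho> \<Phi> \<Longrightarrow> is_mgf \<rho> \<Psi> \<Longrightarrow> is_mgf \<rho> (\<lambda>r. \<Phi> r * \<Psi> r)"
  unfolding is_mgf_def using has_mgf_convolution by blast

lemma is_mgf_prod:
  assumes "\<rho> > 0" "finite I" "\<And>i. i \<in> I \<Longrightarrow> is_mgf \<rho> (\<Phi> i)"
  shows "is_mgf \<rho> (\<lambda>r. \<Prod>i\<in>I. \<Phi> i r)"
  using assms(2,3)
proof (induction I rule: finite_induct)
  case empty
  show ?case using is_mgf_exp[OF assms(1), of 0] by simp
next
  case (insert i I)
  then show ?case by (simp add: is_mgf_mult[OF assms(1)])
qed

text \<open>A Fatou lemma for weak convergence. After adding \<open>B\<close> the integrand is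
  nonnegative; its truncations at height \<open>K\<close> are bounded and continuous, so their
  integrals pass to the limit, and letting \<open>K\<close> grow gives the bound.\<close>

lemma weak_conv_integral_le:
  fixes h :: "real \<Rightarrow> real"
  assumes "\<And>n. real_distribution (\<mu> n)" "real_distribution M" "weak_conv_m \<mu> M"
    and h: "continuous_on UNIV h" "\<And>x. h x \<ge> - B"
    and int: "\<And>n. integrable (\<mu> n) h" and lim: "(\<lambda>n. \<integral>x. h x \<partial>\<mu> n) \<longlonglongrightarrow> L"
  shows "integrable M h" and "(\<integral>x. h x \<partial>M) \<le> L"
proof -
  interpret \<mu>: real_distribution "\<mu> n" for n by fact
  interpret M: real_distribution M by fact
  define g where "g x = h x + B" for x
  have "continuous_on UNIV g"
    unfolding g_def by (intro continuous_intros h(1))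
  moreover have "g x \<ge> 0" for x
    using h(2)[of x] unfolding g_def by linarith
  ultimately have g: "continuous_on UNIV g" "\<And>x. g x \<ge> 0"
    by blast+
  have [measurable]: "g \<in> borel_measurable borel" "h \<in> borel_measurable borel"
    using g(1) h(1) borel_measurable_continuous_onI by auto
  have gint: "integrable (\<mu> n) g" for n
    using int[of n] by (simp add: g_def[abs_def])
  have glim: "(\<lambda>n. \<integral>x. g x \<partial>\<mu> n) \<longlonglongrightarrow> L + B"
    unfolding g_def using int \<mu>.prob_space by (auto intro!: tendsto_intros lim)
  have trunc: "(\<integral>\<^sup>+x. ennreal (min (g x) (real K)) \<partial>M) \<le> ennreal (L + B)" for K :: nat
  proof -
    have b: "\<bar>min (g x) (real K)\<bar> \<le> real K" for x
      using g(2)[of x] by auto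
    have c: "isCont (\<lambda>x. min (g x) (real K)) x" for x
      using g(1) by (auto simp: continuous_on_eq_continuous_at intro!: continuous_intros)
    have l: "(\<lambda>n. \<integral>x. min (g x) (real K) \<partial>\<mu> n) \<longlonglongrightarrow> (\<integral>x. min (g x) (real K) \<partial>M)"
      by (rule weak_conv_imp_integral_bdd_continuous_conv[OF assms(1-3), of _ "real K"]) (use b c in auto)
    have "(\<integral>x. min (g x) (real K) \<partial>M) \<le> L + B"
      by (rule LIMSEQ_le[OF l glim]) (auto intro!: exI[of _ 0] integral_mono Bochner_Integration.integrable_min gint)
    moreover have "integrable M (\<lambda>x. min (g x) (real K))"
      by (rule M.integrable_const_bound[of _ "real K"]) (use b in auto)
    ultimately show ?thesis
      using g(2) by (subst nn_integral_eq_integral) (auto simp: ennreal_leI)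
  qed
  have "(\<integral>\<^sup>+x. ennreal (g x) \<partial>M) = (\<integral>\<^sup>+x. liminf (\<lambda>K. ennreal (min (g x) (real K))) \<partial>M)"
  proof (rule nn_integral_cong)
    fix x
    have "eventually (\<lambda>K. min (g x) (real K) = g x) sequentially"
      using eventually_ge_at_top[of "nat \<lceil>g x\<rceil>"]
    proof eventually_elim
      case (elim K)
      then have "g x \<le> real K" by linarith
      then show ?case by (rule min.absorb1)
    qed
    then have "(\<lambda>K. ennreal (min (g x) (real K))) \<longlonglongrightarrow> ennreal (g x)"
      by (intro tendsto_eventually) (auto elim: eventually_mono)
    then show "ennreal (g x) = liminf (\<lambda>K. ennreal (min (g x) (real K)))"
      by (simp add: lim_imp_Liminf)
  qed
  also have "\<dots> \<le> liminf (\<lambda>K. \<integral>\<^sup>+x. ennreal (min (g x) (real K)) \<partial>M)"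
    by (rule nn_integral_liminf) simp
  also have "\<dots> \<le> ennreal (L + B)"
    using Liminf_mono[of "\<lambda>K. \<integral>\<^sup>+x. ennreal (min (g x) (real K)) \<partial>M" "\<lambda>_. ennreal (L + B)" sequentially] trunc
    by (simp add: Liminf_const)
  finally have le: "(\<integral>\<^sup>+x. ennreal (g x) \<partial>M) \<le> ennreal (L + B)" .
  have gM: "integrable M g"
    using le g(2) by (intro integrableI_nonneg) (auto simp: less_top[symmetric] top_unique)
  have "L + B \<ge> 0"
    by (rule LIMSEQ_le_const[OF glim]) (use g(2) in \<open>auto intro!: integral_nonneg\<close>)
  then have gle: "(\<integral>x. g x \<partial>M) \<le> L + B"
    using le nn_integral_eq_integral[OF gM] g(2) by (simp add: ennreal_le_iff)
  have "integrable M (\<lambda>x. g x - B)"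
    using gM by simp
  then show "integrable M h" by (simp add: g_def)
  then show "(\<integral>x. h x \<partial>M) \<le> L"
    using gle M.prob_space by (simp add: g_def)
qed

text \<open>Away from 0 one of the outer exponentials dominates: for
  \<open>\<bar>x\<bar> > K\<close> the gap \<open>d\<close> between the exponents outweighs
  \<open>ln \<epsilon>\<close>, and for \<open>\<bar>x\<bar> \<le> K\<close> the middle exponential
  is bounded.\<close>

lemma exp_interpolation_bound:
  fixes r r1 r2 \<epsilon> :: real
  assumes "r1 < r" "r < r2" "\<epsilon> > 0"
  obtains B where "\<And>x. \<epsilon> * (exp (r1 * x) + exp (r2 * x)) - exp (r * x) \<ge> - B"
proof -
  define d where "d = min (r2 - r) (r - r1)"
  define K where "K = \<bar>ln \<epsilon>\<bar> / d"
  have d: "d > 0" using assms by (simp add: d_def)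
  have "\<epsilon> * (exp (r1 * x) + exp (r2 * x)) - exp (r * x) \<ge> - exp (\<bar>r\<bar> * K)" for x
  proof (cases "\<bar>x\<bar> \<le> K")
    case True
    have "r * x \<le> \<bar>r\<bar> * K"
    proof -
      have "r * x \<le> \<bar>r\<bar> * \<bar>x\<bar>" using abs_ge_self[of "r * x"] by (simp only: abs_mult)
      also have "\<dots> \<le> \<bar>r\<bar> * K" using True by (intro mult_left_mono) auto
      finally show ?thesis .
    qed
    then have "exp (r * x) \<le> exp (\<bar>r\<bar> * K)" by simp
    moreover have "0 \<le> \<epsilon> * (exp (r1 * x) + exp (r2 * x))"
      using assms(3) by (simp add: add_nonneg_nonneg)
    ultimately show ?thesis by linarith
  next
    case False
    then have x: "\<bar>ln \<epsilon>\<bar> \<le> d * \<bar>x\<bar>"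
      using d by (simp add: K_def field_simps)
    have "exp (r * x) \<le> \<epsilon> * (exp (r1 * x) + exp (r2 * x))"
    proof (cases "x \<ge> 0")
      case True
      have "d * x \<le> (r2 - r) * x" using True by (intro mult_right_mono) (auto simp: d_def)
      then have "r * x \<le> ln \<epsilon> + r2 * x" using x True by (auto simp: algebra_simps)
      then have "exp (r * x) \<le> exp (ln \<epsilon> + r2 * x)" by simp
      also have "\<dots> = \<epsilon> * exp (r2 * x)" using assms(3) by (simp add: exp_add)
      also have "\<dots> \<le> \<epsilon> * (exp (r1 * x) + exp (r2 * x))"
        using assms(3) by (intro mult_left_mono) auto
      finally show ?thesis .
    next
      case False
      have "d * (-x) \<le> (r - r1) * (-x)" using False by (intro mult_right_mono) (auto simp: d_def)
      then have "r * x \<le> ln \<epsilon> + r1 * x" using x False by (auto simp: algebra_simps)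
      then have "exp (r * x) \<le> exp (ln \<epsilon> + r1 * x)" by simp
      also have "\<dots> = \<epsilon> * exp (r1 * x)" using assms(3) by (simp add: exp_add)
      also have "\<dots> \<le> \<epsilon> * (exp (r1 * x) + exp (r2 * x))"
        using assms(3) by (intro mult_left_mono) auto
      finally show ?thesis .
    qed
    then show ?thesis using exp_gt_zero[of "\<bar>r\<bar> * K"] by linarith
  qed
  then show ?thesis using that by blast
qed

text \<open>Markov's inequality for \<open>exp (\<delta> * x) + exp (-\<delta> * x)\<close>, which
  is at least \<open>exp (\<delta> * K)\<close> outside \<open>{-K<..K}\<close>.\<close>

lemma tight_of_mgf_bound:
  assumes "\<rho> > 0" "\<And>n. has_mgf (M n) \<rho> (\<Phi> n)" "\<delta> > 0" "\<delta> < \<rho>"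
    and bound: "\<And>n. \<Phi> n \<delta> + \<Phi> n (-\<delta>) \<le> B"
  shows "tight M"
  unfolding tight_def
proof (intro conjI allI impI)
  show "real_distribution (M n)" for n using assms(2) by (rule has_mgfD)
  then interpret M: real_distribution "M n" for n .
  fix \<epsilon> :: real assume \<epsilon>: "\<epsilon> > 0"
  \<comment> \<open>This gives \<open>exp (\<delta> * K) \<ge> 2 * (\<bar>B\<bar> + 1) /
    \<epsilon>\<close>, so that less than \<open>\<epsilon>\<close> lies outside; the maximum with 1
    keeps the interval nonempty.\<close>
  define K where "K = max 1 (ln (2 * (\<bar>B\<bar> + 1) / \<epsilon>) / \<delta>)"
  have "ln (2 * (\<bar>B\<bar> + 1) / \<epsilon>) / \<delta> \<le> K"
    by (simp add: K_def)
  then have "ln (2 * (\<bar>B\<bar> + 1) / \<epsilon>) \<le> \<delta> * K"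
    using assms(3) by (simp add: field_simps)
  then have K: "K > 0" "(\<bar>B\<bar> + 1) * 2 / \<epsilon> \<le> exp (\<delta> * K)"
    using \<epsilon> by (auto simp: K_def ln_le_cancel_iff[symmetric] mult_ac ln_ge_iff)
  have "measure (M n) {-K<..K} > 1 - \<epsilon>" for n
  proof -
    have i: "integrable (M n) (\<lambda>x. exp (\<delta> * x))" "integrable (M n) (\<lambda>x. exp (-\<delta> * x))"
      using has_mgfD(2)[OF assms(2), of \<delta> n] has_mgfD(2)[OF assms(2), of "-\<delta>" n] assms by auto
    have "exp (\<delta> * K) * measure (M n) (UNIV - {-K<..K}) = (\<integral>x. exp (\<delta> * K) * indicator (UNIV - {-K<..K}) x \<partial>M n)"
      by simp
    also have "\<dots> \<le> (\<integral>x. exp (\<delta> * x) + exp (-\<delta> * x) \<partial>M n)"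
    proof (rule integral_mono)
      show "integrable (M n) (\<lambda>x. exp (\<delta> * K) * indicator (UNIV - {-K<..K}) x)"
        by (intro integrable_mult_right integrable_real_indicator) (simp_all add: less_top[symmetric])
      show "integrable (M n) (\<lambda>x. exp (\<delta> * x) + exp (-\<delta> * x))"
        using i by simp
      fix x :: real
      have "exp (\<delta> * K) \<le> exp (\<delta> * x) + exp (-\<delta> * x)" if "x \<le> -K \<or> x > K"
        using that
      proof
        assume "x \<le> -K"
        then have "\<delta> * K \<le> -\<delta> * x" using assms(3) by (simp add: mult_left_mono[of K "-x" \<delta>, simplified])
        then have "exp (\<delta> * K) \<le> exp (-\<delta> * x)" by (simp only: exp_le_cancel_iff)
        then show ?thesis using exp_gt_zero[of "\<delta> * x"] by linarith
      next
        assume "x > K"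
        then have "\<delta> * K \<le> \<delta> * x" using assms(3) by simp
        then have "exp (\<delta> * K) \<le> exp (\<delta> * x)" by (simp only: exp_le_cancel_iff)
        then show ?thesis using exp_gt_zero[of "\<delta> * x"] exp_gt_zero[of "-\<delta> * x"] by linarith
      qed
      moreover have "0 \<le> exp (\<delta> * x) + exp (-\<delta> * x)" by (simp add: add_nonneg_nonneg)
      ultimately show "exp (\<delta> * K) * indicator (UNIV - {-K<..K}) x \<le> exp (\<delta> * x) + exp (-\<delta> * x)"
        by (auto simp: indicator_def not_less)
    qed
    also have "\<dots> \<le> B"
      using i has_mgfD(3)[OF assms(2), of \<delta> n] has_mgfD(3)[OF assms(2), of "-\<delta>" n] assms(1,3,4) bound[of n] by simp
    finally have *: "exp (\<delta> * K) * measure (M n) (UNIV - {-K<..K}) \<le> B" .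
    have "(\<bar>B\<bar> + 1) * 2 / \<epsilon> * measure (M n) (UNIV - {-K<..K}) \<le> B"
      using mult_right_mono[OF K(2), of "measure (M n) (UNIV - {-K<..K})"] * by simp
    then have "measure (M n) (UNIV - {-K<..K}) \<le> B * \<epsilon> / ((\<bar>B\<bar> + 1) * 2)"
      using \<epsilon> by (simp add: field_simps)
    also have "\<dots> < \<epsilon>"
    proof -
      have "B * \<epsilon> < (\<bar>B\<bar> + 1) * 2 * \<epsilon>"
        using \<epsilon> by (intro mult_strict_right_mono) auto
      moreover have "(\<bar>B\<bar> + 1) * 2 > 0" by (simp add: add_nonneg_pos)
      ultimately have "B * \<epsilon> / ((\<bar>B\<bar> + 1) * 2) < \<epsilon>"
        by (simp only: pos_divide_less_eq mult.commute)
      then show ?thesis .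
    qed
    finally show ?thesis
      using M.prob_compl[of "{-K<..K}" n] by simp
  qed
  then show "\<exists>a b. a < b \<and> (\<forall>n. measure (M n) {a<..b} > 1 - \<epsilon>)"
    using K(1) by (intro exI[of _ "-K"] exI[of _ K]) auto
qed

text \<open>Tightness gives a weak limit point, and Fatou gives one inequality between the moment generating
  functions. The other one is Fatou applied to \<open>\<epsilon> (exp (r1 x) + exp (r2 x)) - exp (r x)\<close> with
  \<open>r1 < r < r2\<close>, which is bounded below.\<close>

lemma is_mgf_limit:
  assumes \<rho>: "\<rho> > 0" and mgf: "\<And>n. is_mgf \<rho> (\<Phi> n)"
    and lim: "\<And>r. r > -\<rho> \<Longrightarrow> (\<lambda>n. \<Phi> n r) \<longlonglongrightarrow> \<Psi> r"
  shows "is_mgf \<rho> \<Psi>"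
proof -
  obtain M where M: "\<And>n. has_mgf (M n) \<rho> (\<Phi> n)"
    using mgf unfolding is_mgf_def by metis
  have "(\<lambda>n. \<Phi> n (\<rho>/2) + \<Phi> n (-(\<rho>/2))) \<longlonglongrightarrow> \<Psi> (\<rho>/2) + \<Psi> (-(\<rho>/2))"
    using \<rho> by (intro tendsto_add lim) auto
  then have "Bseq (\<lambda>n. \<Phi> n (\<rho>/2) + \<Phi> n (-(\<rho>/2)))"
    by (intro convergent_imp_Bseq convergentI)
  then obtain B where "\<And>n. norm (\<Phi> n (\<rho>/2) + \<Phi> n (-(\<rho>/2))) \<le> B"
    by (auto simp: Bseq_def)
  then have "\<And>n. \<Phi> n (\<rho>/2) + \<Phi> n (-(\<rho>/2)) \<le> B"
    unfolding real_norm_def by (rule abs_le_D1)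
  then have "tight M"
    using \<rho> by (intro tight_of_mgf_bound[OF \<rho> M, of "\<rho>/2"]) auto
  from tight_imp_convergent_subsubsequence[OF this strict_mono_id]
  obtain s N where s: "strict_mono s" and N: "real_distribution N" and w: "weak_conv_m (M \<circ> s) N"
    by auto
  interpret N: real_distribution N by fact
  have dist: "real_distribution ((M \<circ> s) n)" for n
    using has_mgfD(1)[OF M] by simp
  have lim': "(\<lambda>n. \<integral>x. exp (r * x) \<partial>(M \<circ> s) n) \<longlonglongrightarrow> \<Psi> r" if "r > -\<rho>" for r
    using LIMSEQ_subseq_LIMSEQ[OF lim[OF that] s] has_mgfD(3)[OF M that] by (simp add: comp_def)
  have int: "integrable ((M \<circ> s) n) (\<lambda>x. exp (r * x))" if "r > -\<rho>" for r n
    using has_mgfD(2)[OF M that] by simp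
  have intN: "integrable N (\<lambda>x. exp (r * x))" if "r > -\<rho>" for r
    by (rule weak_conv_integral_le(1)[OF dist N w _ _ int lim', of r 0])
       (use that in \<open>auto intro!: continuous_intros\<close>)
  have leN: "(\<integral>x. exp (r * x) \<partial>N) \<le> \<Psi> r" if "r > -\<rho>" for r
    by (rule weak_conv_integral_le(2)[OF dist N w _ _ int lim', of r 0])
       (use that in \<open>auto intro!: continuous_intros\<close>)
  have geN: "\<Psi> r \<le> (\<integral>x. exp (r * x) \<partial>N)" if r: "r > -\<rho>" for r
  proof (rule field_le_epsilon)
    \<comment> \<open>\<open>r1\<close> is the midpoint of \<open>-\<rho>\<close> and
      \<open>r\<close> and so stays inside the half-line. Below, \<open>\<epsilon> = e / C\<close>
      keeps the cost \<open>\<epsilon> * (\<Psi> r1 + \<Psi> r2)\<close> at most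
      \<open>e\<close>.\<close>
    define r1 r2 where "r1 = (r - \<rho>) / 2" and "r2 = r + 1"
    have r12: "r1 < r" "r < r2" "r1 > -\<rho>" "r2 > -\<rho>"
      using r \<rho> by (auto simp: r1_def r2_def field_simps)
    fix e :: real assume e: "e > 0"
    define C where "C = \<bar>\<Psi> r1 + \<Psi> r2\<bar> + 1"
    define \<epsilon> where "\<epsilon> = e / C"
    have C: "C > 0" by (simp add: C_def add_nonneg_pos)
    then have \<epsilon>: "\<epsilon> > 0" using e by (simp add: \<epsilon>_def)
    obtain B where B: "\<And>x. \<epsilon> * (exp (r1 * x) + exp (r2 * x)) - exp (r * x) \<ge> - B"
      using exp_interpolation_bound[OF r12(1,2) \<epsilon>] by blast
    have "(\<lambda>n. \<integral>x. \<epsilon> * (exp (r1 * x) + exp (r2 * x)) - exp (r * x) \<partial>(M \<circ> s) n)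
        \<longlonglongrightarrow> \<epsilon> * (\<Psi> r1 + \<Psi> r2) - \<Psi> r"
      using int r r12 lim' by (auto intro!: tendsto_intros simp del: o_apply)
    then have "(\<integral>x. \<epsilon> * (exp (r1 * x) + exp (r2 * x)) - exp (r * x) \<partial>N) \<le> \<epsilon> * (\<Psi> r1 + \<Psi> r2) - \<Psi> r"
      by (intro weak_conv_integral_le(2)[OF dist N w _ B])
         (use r r12 int in \<open>auto intro!: continuous_intros simp del: o_apply\<close>)
    then have "\<epsilon> * ((\<integral>x. exp (r1 * x) \<partial>N) + (\<integral>x. exp (r2 * x) \<partial>N)) - (\<integral>x. exp (r * x) \<partial>N) \<le> \<epsilon> * (\<Psi> r1 + \<Psi> r2) - \<Psi> r"
      using intN r r12 by simp
    moreover have "\<epsilon> * ((\<integral>x. exp (r1 * x) \<partial>N) + (\<integral>x. exp (r2 * x) \<partial>N)) \<ge> 0"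
      using \<epsilon> by (simp add: add_nonneg_nonneg)
    moreover have "\<epsilon> * (\<Psi> r1 + \<Psi> r2) \<le> \<epsilon> * C"
      using \<epsilon> by (intro mult_left_mono) (auto simp: C_def)
    moreover have "\<epsilon> * C = e" using C by (simp add: \<epsilon>_def)
    ultimately show "\<Psi> r \<le> (\<integral>x. exp (r * x) \<partial>N) + e" by linarith
  qed
  have "has_mgf N \<rho> \<Psi>"
    unfolding has_mgf_def has_bochner_integral_iff
    using N intN leN geN by (auto intro!: antisym)
  then show ?thesis by (auto simp: is_mgf_def)
qed

section \<open>Moment generating functions built from the Gamma function\<close>

text \<open>Meant for \<open>s > 0\<close>: the gamma law of shape \<open>s\<close> and rate 1.
  Since \<open>0 powr x = 0\<close>, the density vanishes at 0 for every \<open>s\<close>, also for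
  \<open>s = 1\<close>.\<close>

definition gamma_distribution :: "real \<Rightarrow> real measure" where
  "gamma_distribution s = density lborel (\<lambda>t. ennreal (indicator {0..} t * t powr (s - 1) * exp (- t) / Gamma s))"

lemma sets_gamma_distribution [simp, measurable_cong]: "sets (gamma_distribution s) = sets borel"
  by (simp add: gamma_distribution_def)

text \<open>Euler's integral under the substitution that scales \<open>t\<close> by
  \<open>w\<close>.\<close>

lemma nn_integral_Gamma_scaled:
  fixes s w :: real
  assumes s: "s > 0" and w: "w > 0"
  shows "(\<integral>\<^sup>+t. ennreal (indicator {0..} t * t powr (s - 1) * exp (- (w * t))) \<partial>lborel) = ennreal (Gamma s * w powr (-s))"
proof -
  let ?I = "\<integral>\<^sup>+t. ennreal (indicator {0..} t * t powr (s - 1) * exp (- (w * t))) \<partial>lborel"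
  have "ennreal (Gamma s) = (\<integral>\<^sup>+t. ennreal (indicator {0..} t * t powr (s - 1) / exp t) \<partial>lborel)"
    by (rule Gamma_conv_nn_integral_real) fact
  also have "\<dots> = ennreal w * (\<integral>\<^sup>+t. ennreal (indicator {0..} (w * t) * (w * t) powr (s - 1) / exp (w * t)) \<partial>lborel)"
    using w by (subst nn_integral_real_affine[of _ w 0]) auto
  also have "(\<integral>\<^sup>+t. ennreal (indicator {0..} (w * t) * (w * t) powr (s - 1) / exp (w * t)) \<partial>lborel) =
      (\<integral>\<^sup>+t. ennreal (w powr (s - 1)) * ennreal (indicator {0..} t * t powr (s - 1) * exp (- (w * t))) \<partial>lborel)"
  proof (rule nn_integral_cong)
    fix t
    show "ennreal (indicator {0..} (w * t) * (w * t) powr (s - 1) / exp (w * t)) =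
       ennreal (w powr (s - 1)) * ennreal (indicator {0..} t * t powr (s - 1) * exp (- (w * t)))"
    proof (cases "t \<ge> 0")
      case True
      then have "(w * t) powr (s - 1) = w powr (s - 1) * t powr (s - 1)" using w by (simp add: powr_mult)
      then show ?thesis using True w
        by (subst ennreal_mult'[symmetric]) (simp_all add: exp_minus divide_inverse mult.assoc)
    next
      case False
      then have "\<not> 0 \<le> w * t" using w by (simp add: zero_le_mult_iff)
      then show ?thesis using False by simp
    qed
  qed
  also have "\<dots> = ennreal (w powr (s - 1)) * ?I"
    by (rule nn_integral_cmult) simp
  finally have "ennreal (Gamma s) = ennreal (w * w powr (s - 1)) * ?I"
    using w by (simp add: ennreal_mult' mult.assoc)
  also have "w * w powr (s - 1) = w powr s"
    using w by (simp add: powr_diff)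
  finally have "ennreal (w powr (-s)) * ennreal (Gamma s) = ennreal (w powr (-s) * w powr s) * ?I"
    by (simp add: ennreal_mult' mult.assoc)
  also have "w powr (-s) * w powr s = 1"
    using w by (simp add: powr_minus)
  finally show ?thesis
    by (subst mult.commute) (simp add: ennreal_mult')
qed

lemma nn_integral_gamma_distribution_powr_exp:
  assumes s: "s > 0" and w: "w > -1" and u: "s + u > 0"
  shows "(\<integral>\<^sup>+t. ennreal (t powr u * exp (- (w * t))) \<partial>gamma_distribution s) = ennreal (Gamma (s + u) / Gamma s * (1 + w) powr (- (s + u)))"
proof -
  have G: "Gamma s > 0" using s by simp
  have "(\<integral>\<^sup>+t. ennreal (t powr u * exp (- (w * t))) \<partial>gamma_distribution s) =
    (\<integral>\<^sup>+t. ennreal (1 / Gamma s) * ennreal (indicator {0..} t * t powr (s + u - 1) * exp (- ((1 + w) * t))) \<partial>lborel)"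
    unfolding gamma_distribution_def
  proof (subst nn_integral_density, simp, simp, rule nn_integral_cong)
    fix t :: real
    show "ennreal (indicator {0..} t * t powr (s - 1) * exp (- t) / Gamma s) * ennreal (t powr u * exp (- (w * t))) =
      ennreal (1 / Gamma s) * ennreal (indicator {0..} t * t powr (s + u - 1) * exp (- ((1 + w) * t)))"
    proof (cases "t \<ge> 0")
      case True
      have "t powr (s - 1) * t powr u = t powr (s + u - 1)"
        by (simp add: powr_add[symmetric] algebra_simps)
      moreover have "exp (- t) * exp (- (w * t)) = exp (- ((1 + w) * t))"
        by (simp add: exp_add[symmetric] algebra_simps)
      moreover have "t powr (s - 1) * exp (- t) / Gamma s * (t powr u * exp (- (w * t))) =
          1 / Gamma s * ((t powr (s - 1) * t powr u) * (exp (- t) * exp (- (w * t))))"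
        by (simp only: divide_inverse mult_ac mult_1_left)
      ultimately have "t powr (s - 1) * exp (- t) / Gamma s * (t powr u * exp (- (w * t))) =
          1 / Gamma s * (t powr (s + u - 1) * exp (- ((1 + w) * t)))"
        by simp
      then show ?thesis using True G
        by (subst (1 2) ennreal_mult'[symmetric]) simp_all
    qed simp
  qed
  also have "\<dots> = ennreal (1 / Gamma s) * ennreal (Gamma (s + u) * (1 + w) powr (-(s + u)))"
    using w u by (subst nn_integral_cmult) (simp_all add: nn_integral_Gamma_scaled[of "s + u" "1 + w"])
  also have "\<dots> = ennreal (Gamma (s + u) / Gamma s * (1 + w) powr (- (s + u)))"
    using G by (simp add: ennreal_mult'[symmetric])
  finally show ?thesis .
qed

text \<open>The reflection places the pole at \<open>-q\<close>, the left end of the half-line;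
  without it the transform would exist for \<open>r < q\<close> only.\<close>

lemma has_mgf_gamma:
  assumes c: "c > 0" and q: "q > 0"
  shows "has_mgf (distr (gamma_distribution c) borel (\<lambda>t. - t / q)) q (\<lambda>r. (q / (q + r)) powr c)"
proof (rule has_mgfI_nn_integral)
  have G: "Gamma c \<noteq> 0" using Gamma_real_pos[OF c] by linarith
  fix r assume r: "r > -q"
  have "(\<integral>\<^sup>+x. ennreal (exp (r * x)) \<partial>distr (gamma_distribution c) borel (\<lambda>t. - t / q)) =
     (\<integral>\<^sup>+t. ennreal (exp (- (r / q * t))) \<partial>gamma_distribution c)"
    by (subst nn_integral_distr) auto
  \<comment> \<open>The integrands differ at \<open>t = 0\<close>, where
    \<open>t powr 0 = 0\<close>; the density vanishes there because
    \<open>0 powr (c - 1) = 0\<close>.\<close>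
  also have "\<dots> = (\<integral>\<^sup>+t. ennreal (t powr 0 * exp (- (r / q * t))) \<partial>gamma_distribution c)"
    unfolding gamma_distribution_def
    by (subst (1 2) nn_integral_density) (auto intro!: nn_integral_cong simp: indicator_def)
  also have "\<dots> = ennreal ((1 + r / q) powr (-c))"
    using c q r G by (subst nn_integral_gamma_distribution_powr_exp) (auto simp: field_simps)
  also have "(1 + r / q) powr (-c) = (q / (q + r)) powr c"
  proof -
    have "1 + r / q = inverse (q / (q + r))" using q r by (simp add: field_simps)
    then show ?thesis using q r by (simp add: powr_minus inverse_powr del: inverse_divide)
  qed
  finally show "(\<integral>\<^sup>+x. ennreal (exp (r * x)) \<partial>distr (gamma_distribution c) borel (\<lambda>t. - t / q)) = ennreal ((q / (q + r)) powr c)" .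
qed (use c q in auto)

lemma is_mgf_gamma:
  assumes "c \<ge> 0" "q > 0"
  shows "is_mgf q (\<lambda>r. (q / (q + r)) powr c)"
proof (cases "c = 0")
  case True
  show ?thesis
    by (rule is_mgf_cong[OF is_mgf_exp[OF assms(2), of 0]]) (use assms True in auto)
next
  case False
  then show ?thesis
    unfolding is_mgf_def using has_mgf_gamma[of c q] assms by auto
qed

text \<open>With \<open>\<theta> = 1 - p / q\<close> the function is \<open>((1 - \<theta>) / (1 - \<theta> q / (q + r))) powr w\<close>, whose binomial series is
  a negative binomial mixture of the powers of \<open>q / (q + r)\<close>.\<close>

lemma is_mgf_neg_binomial_mixture:
  assumes w: "w > 0" and p: "p > 0" and pq: "p < q"
  shows "is_mgf p (\<lambda>r. ((p / (p + r)) * ((q + r) / q)) powr w)"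
proof -
  define \<theta> where "\<theta> = 1 - p / q"
  \<comment> \<open>Negative binomial probabilities: \<open>pochhammer w k / fact k\<close> is the
    coefficient of the \<open>k\<close>-th power in the binomial series of
    \<open>(1 - \<theta>) powr (-w)\<close>, and \<open>p / q = 1 - \<theta>\<close> normalises. As
    \<open>gamma_distribution 0\<close> is not a probability measure, the component of index 0 is
    the point mass by definition.\<close>
  define v where "v k = (p / q) powr w * (pochhammer w k / fact k) * \<theta> ^ k" for k :: nat
  define E where "E k = (if k = 0 then return borel 0 else distr (gamma_distribution (real k)) borel (\<lambda>t. - t / q))" for k :: nat
  define M where "M = density (count_space UNIV) (\<lambda>k. ennreal (v k)) \<bind> E"
  have \<theta>: "0 < \<theta>" using p pq by (simp add: \<theta>_def)
  have v: "v k \<ge> 0" for k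
    using \<theta> w pochhammer_pos[of w k] by (simp add: v_def)
  have E: "has_mgf (E k) q (\<lambda>r. (q / (q + r)) ^ k)" for k
  proof (cases "k = 0")
    case True
    have "has_mgf (return borel 0) q (\<lambda>r. exp (r * 0))"
      by (rule has_mgf_return) (use p pq in simp)
    then show ?thesis using True by (simp add: E_def)
  next
    case False
    have "has_mgf (distr (gamma_distribution (real k)) borel (\<lambda>t. - t / q)) q (\<lambda>r. (q / (q + r)) powr real k)"
      by (rule has_mgf_gamma) (use False p pq in auto)
    then show ?thesis
      using False p pq unfolding E_def by (auto elim!: has_mgf_cong simp: powr_realpow)
  qed
  have Eprob: "E k \<in> space (prob_algebra borel)" for k
    using has_mgfD(1)[OF E[of k]] by (auto simp: space_prob_algebra real_distribution_def real_distribution_axioms_def)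
  have Emeas: "E \<in> density (count_space UNIV) (\<lambda>k. ennreal (v k)) \<rightarrow>\<^sub>M subprob_algebra borel"
    using Eprob by (auto simp: measurable_def space_prob_algebra space_subprob_algebra prob_space_imp_subprob_space)
  have "has_mgf M p (\<lambda>r. ((p / (p + r)) * ((q + r) / q)) powr w)"
  proof (rule has_mgfI_nn_integral)
    show "sets M = sets borel"
      unfolding M_def by (rule sets_bind_measurable[OF Emeas]) simp
    fix r assume r: "r > -p"
    \<comment> \<open>Given \<open>q + r > 0\<close>, the condition \<open>\<bar>z\<bar> < 1\<close>
      amounts to \<open>r > -p\<close>. So the mixture lives on the half-line of \<open>p\<close>,
      although its components exist on the larger one of \<open>q\<close>.\<close>
    define z where "z = - (\<theta> * (q / (q + r)))"
    have qr: "q + r > 0" using r pq by linarith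
    have "\<theta> * q = q - p" using p pq by (simp add: \<theta>_def field_simps)
    then have z': "z = - ((q - p) / (q + r))" by (simp add: z_def)
    have z: "\<bar>z\<bar> < 1" "1 + z = (p + r) / (q + r)"
      using r pq qr unfolding z' by (auto simp: field_simps)
    have "(\<lambda>k. (p / q) powr w * ((-w gchoose k) * z ^ k)) sums ((p / q) powr w * (1 + z) powr (-w))"
      by (intro sums_mult gen_binomial_real z)
    also have "(\<lambda>k. (p / q) powr w * ((-w gchoose k) * z ^ k)) = (\<lambda>k. v k * (q / (q + r)) ^ k)"
    proof
      fix k
      have sgn: "(-1) ^ k * (-1) ^ k = (1 :: real)" by (simp flip: power_mult_distrib)
      have "z ^ k = (-1) ^ k * (\<theta> ^ k * (q / (q + r)) ^ k)"
        unfolding z_def by (subst power_minus) (simp only: power_mult_distrib)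
      then have "(p / q) powr w * ((-w gchoose k) * z ^ k) =
          ((-1) ^ k * (-1) ^ k) * ((p / q) powr w * (pochhammer w k / fact k) * \<theta> ^ k * (q / (q + r)) ^ k)"
        by (simp only: gbinomial_pochhammer minus_minus divide_inverse mult_ac)
      then show "(p / q) powr w * ((-w gchoose k) * z ^ k) = v k * (q / (q + r)) ^ k"
        by (simp only: sgn v_def mult_1_left)
    qed
    also have "(p / q) powr w * (1 + z) powr (-w) = ((p / (p + r)) * ((q + r) / q)) powr w"
    proof -
      have "((p + r) / (q + r)) powr (-w) = ((q + r) / (p + r)) powr w"
        using r p qr by (simp add: powr_minus powr_divide)
      then have "(p / q) powr w * (1 + z) powr (-w) = (p / q * ((q + r) / (p + r))) powr w"
        unfolding z(2) using r p pq qr by (simp only: powr_mult)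
      also have "p / q * ((q + r) / (p + r)) = p / (p + r) * ((q + r) / q)"
        by (simp only: times_divide_times_eq mult.commute)
      finally show ?thesis .
    qed
    finally have sums: "(\<lambda>k. v k * (q / (q + r)) ^ k) sums (((p / (p + r)) * ((q + r) / q)) powr w)" .
    have "(\<integral>\<^sup>+x. ennreal (exp (r * x)) \<partial>M) = (\<integral>\<^sup>+k. ennreal (v k) * (\<integral>\<^sup>+x. ennreal (exp (r * x)) \<partial>E k) \<partial>count_space UNIV)"
      unfolding M_def by (subst nn_integral_bind[OF _ Emeas]) (auto simp: nn_integral_density)
    also have "\<dots> = (\<integral>\<^sup>+k. ennreal (v k * (q / (q + r)) ^ k) \<partial>count_space UNIV)"
      using has_mgfD(5)[OF E] r pq v by (auto intro!: nn_integral_cong simp: ennreal_mult')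
    also have "\<dots> = (\<Sum>k. ennreal (v k * (q / (q + r)) ^ k))"
      by (rule nn_integral_count_space_nat)
    also have "\<dots> = ennreal (((p / (p + r)) * ((q + r) / q)) powr w)"
      using v qr p pq by (intro suminf_ennreal_eq sums) auto
    finally show "(\<integral>\<^sup>+x. ennreal (exp (r * x)) \<partial>M) = ennreal (((p / (p + r)) * ((q + r) / q)) powr w)" .
  qed (use p pq in auto)
  then show ?thesis by (auto simp: is_mgf_def)
qed

section \<open>Euler's product for quotients of Gamma values\<close>

lemma Gamma_real_nonzero: "x > 0 \<Longrightarrow> Gamma x \<noteq> (0 :: real)"
  using Gamma_real_pos[of x] by linarith

text \<open>In the quotient of the two Euler approximants \<open>Gamma_series'\<close> the
  factorials cancel, the powers of \<open>K\<close> combine into one exponential, and one factor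
  remains for each pole.\<close>

lemma Gamma_ratio_LIMSEQ:
  fixes a b r :: real
  assumes a: "a > 0" and b: "b > 0" and r: "r > - b / a"
  shows "(\<lambda>K. exp (r * (a * ln (real K))) * (\<Prod>k<K. ((b + real k) / a) / ((b + real k) / a + r))) \<longlonglongrightarrow> Gamma (a * r + b) / Gamma b"
proof -
  have pos: "a * r + b > 0" using a r by (simp add: field_simps)
  have "Gamma_series' (a * r + b) K / Gamma_series' b K = exp (r * (a * ln (real K))) * (\<Prod>k<K. ((b + real k) / a) / ((b + real k) / a + r))" for K
  proof -
    have "(\<Prod>k<K. ((b + real k) / a) / ((b + real k) / a + r)) = (\<Prod>k<K. (b + real k) / (a * r + b + real k))"
    proof (rule prod.cong)
      fix k assume "k \<in> {..<K}"
      have "a * r + b + real k \<noteq> 0" using pos by linarith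
      moreover have "(b + real k) / a + r = (a * r + b + real k) / a" using a by (simp add: field_simps)
      ultimately show "(b + real k) / a / ((b + real k) / a + r) = (b + real k) / (a * r + b + real k)"
        using a by simp
    qed simp
    also have "\<dots> = pochhammer b K / pochhammer (a * r + b) K"
      by (simp add: pochhammer_prod prod_dividef atLeast0LessThan)
    finally have eq: "(\<Prod>k<K. ((b + real k) / a) / ((b + real k) / a + r)) = pochhammer b K / pochhammer (a * r + b) K" .
    have "pochhammer b K > 0" "pochhammer (a * r + b) K > 0"
      using b pos by (auto intro: pochhammer_pos)
    then show ?thesis
      unfolding eq Gamma_series'_def by (simp add: field_simps exp_add)
  qed
  moreover have "(\<lambda>K. Gamma_series' (a * r + b) K / Gamma_series' b K) \<longlonglongrightarrow> Gamma (a * r + b) / Gamma b"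
    using b Gamma_real_nonzero[OF b] by (intro tendsto_divide Gamma_series'_LIMSEQ) auto
  ultimately show ?thesis by simp
qed

lemma is_mgf_Gamma_ratio_powr:
  fixes a b c :: real
  assumes a: "a > 0" and b: "b > 0" and c: "c > 0"
  shows "is_mgf (b / a) (\<lambda>r. (Gamma (a * r + b) / Gamma b) powr c)"
proof (rule is_mgf_limit)
  show \<rho>: "b / a > 0" using a b by simp
  let ?p = "\<lambda>k. (b + real k) / a"
  show "is_mgf (b / a) (\<lambda>r. exp (r * (c * (a * ln (real K)))) * (\<Prod>k<K. (?p k / (?p k + r)) powr c))" for K
  proof (intro is_mgf_mult is_mgf_exp is_mgf_prod \<rho>)
    fix k
    show "is_mgf (b / a) (\<lambda>r. (?p k / (?p k + r)) powr c)"
      by (rule is_mgf_cong[OF is_mgf_gamma[of c "?p k"]]) (use a b c in \<open>auto simp: field_simps add_nonneg_pos add_pos_nonneg\<close>)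
  qed simp
  fix r assume r: "r > - (b / a)"
  have pos: "a * r + b > 0" using a r by (simp add: field_simps)
  have "(\<lambda>K. (exp (r * (a * ln (real K))) * (\<Prod>k<K. ?p k / (?p k + r))) powr c) \<longlonglongrightarrow> (Gamma (a * r + b) / Gamma b) powr c"
    using a b r pos Gamma_real_nonzero[OF b] Gamma_real_nonzero[OF pos] by (intro tendsto_powr tendsto_const Gamma_ratio_LIMSEQ) auto
  moreover have "?p k + r > 0" "?p k > 0" for k
    using a b r by (auto simp: field_simps add_pos_nonneg)
  then have "(exp (r * (a * ln (real K))) * (\<Prod>k<K. ?p k / (?p k + r))) powr c =
      exp (r * (c * (a * ln (real K)))) * (\<Prod>k<K. (?p k / (?p k + r)) powr c)" for K
    by (subst powr_mult) (auto simp: prod_powr_distrib less_imp_le prod_nonneg exp_powr_real mult_ac)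
  ultimately show "(\<lambda>K. exp (r * (c * (a * ln (real K)))) * (\<Prod>k<K. (?p k / (?p k + r)) powr c))
      \<longlonglongrightarrow> (Gamma (a * r + b) / Gamma b) powr c"
    by simp
qed

text \<open>The weight \<open>w k j\<close> is the length of the overlap of \<open>[c k, c (k + 1))\<close> and \<open>[j, j + 1)\<close>, written as a
  mixed second difference of \<open>min (c k) j\<close> so that the sums telescope.\<close>

lemma interval_overlaps:
  fixes c :: real
  assumes c: "c > 0"
  obtains w :: "nat \<Rightarrow> nat \<Rightarrow> real" where
    "\<And>k j. w k j \<ge> 0"
    "\<And>k j. w k j > 0 \<Longrightarrow> c * real k < real j + 1"
    "\<And>K j. real j + 1 \<le> c * real K \<Longrightarrow> (\<Sum>k<K. w k j) = 1"
    "\<And>k M. (\<Sum>j<M. w k j) \<le> c"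
proof -
  define m where "m k j = min (c * real k) (real j)" for k j :: nat
  define w where "w k j = m (Suc k) (Suc j) - m k (Suc j) - (m (Suc k) j - m k j)" for k j
  have mono: "c * real k \<le> c * real (Suc k)" for k using c by simp
  show ?thesis
  proof
    show "w k j \<ge> 0" for k j
      using mono[of k] by (auto simp: w_def m_def min_def)
    show "c * real k < real j + 1" if "w k j > 0" for k j
      using that mono[of k] by (rule_tac ccontr) (auto simp: w_def m_def min_def not_less split: if_splits)
    \<comment> \<open>Once \<open>[0, c K)\<close> covers \<open>[j, j + 1)\<close>, the overlaps
      with the first \<open>K\<close> blocks exhaust its length.\<close>
    show "(\<Sum>k<K. w k j) = 1" if "real j + 1 \<le> c * real K" for K j
    proof -
      have "(\<Sum>k<K. w k j) = (\<Sum>k<K. (m (Suc k) (Suc j) - m (Suc k) j) - (m k (Suc j) - m k j))"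
        by (simp add: w_def algebra_simps)
      also have "\<dots> = (m K (Suc j) - m K j) - (m 0 (Suc j) - m 0 j)"
        by (rule sum_lessThan_telescope)
      also have "\<dots> = 1" using that by (simp add: m_def)
      finally show ?thesis .
    qed
    show "(\<Sum>j<M. w k j) \<le> c" for k M
    proof -
      have "(\<Sum>j<M. w k j) = (\<Sum>j<M. (m (Suc k) (Suc j) - m k (Suc j)) - (m (Suc k) j - m k j))"
        by (simp add: w_def)
      also have "\<dots> = (m (Suc k) M - m k M) - (m (Suc k) 0 - m k 0)"
        by (rule sum_lessThan_telescope)
      also have "\<dots> \<le> c" using c by (auto simp: m_def min_def algebra_simps)
      finally show ?thesis .
    qed
  qed
qed

text \<open>In Euler's products the numerator has poles \<open>-(b + k) / a\<close> of multiplicity \<open>c\<close>, and the denominator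
  contributes simple zeros \<open>-(\<beta> + j) / \<alpha>\<close>. The overlaps pair each zero with poles to the right of it,
  and every pair contributes a negative binomial mixture.\<close>

lemma is_mgf_Gamma_quotient:
  fixes a b c \<alpha> \<beta> :: real
  assumes a: "a > 0" and b: "b > 0" and c: "c > 0" and \<alpha>: "0 < \<alpha>" "\<alpha> \<le> a * c"
    and \<beta>: "\<beta> / \<alpha> \<ge> b / a + 1 / (a * c)"
  shows "is_mgf (b / a) (\<lambda>r. (Gamma (a * r + b) / Gamma b) powr c / (Gamma (\<alpha> * r + \<beta>) / Gamma \<beta>))"
proof -
  have \<rho>: "b / a > 0" using a b by simp
  let ?p = "\<lambda>k. (b + real k) / a" and ?q = "\<lambda>j. (\<beta> + real j) / \<alpha>"
  obtain w :: "nat \<Rightarrow> nat \<Rightarrow> real" where w: "\<And>k j. w k j \<ge> 0"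
    "\<And>k j. w k j > 0 \<Longrightarrow> c * real k < real j + 1"
    "\<And>K j. real j + 1 \<le> c * real K \<Longrightarrow> (\<Sum>k<K. w k j) = 1"
    "\<And>k M. (\<Sum>j<M. w k j) \<le> c"
    using interval_overlaps[OF c] by metis
  \<comment> \<open>Only zeros whose unit interval lies inside \<open>[0, c K)\<close> are used, so
    that each of them is completely matched by the poles with index below \<open>K\<close>.\<close>
  define M where "M K = nat \<lfloor>c * real K\<rfloor>" for K
  have M: "real j + 1 \<le> c * real K" if "j < M K" for j K
    using that unfolding M_def by linarith
  have \<beta>0: "\<beta> > 0"
  proof -
    have "0 < b / a + 1 / (a * c)" using a b c by (simp add: add_pos_pos)
    then have "0 < \<beta> / \<alpha>" using \<beta> by linarith
    then show ?thesis using \<alpha> by (simp add: zero_less_divide_iff)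
  qed
  \<comment> \<open>An overlap only yields \<open>c * real k < real j + 1\<close>. The extra unit is
    the reason why \<open>\<beta> / \<alpha>\<close> has to exceed \<open>b / a\<close> by at least
    \<open>1 / (a * c)\<close>.\<close>
  have pq: "?p k < ?q j" if "c * real k < real j + 1" for k j
  proof -
    have "real k / a < (real j + 1) / (a * c)"
      using that a c by (simp add: field_simps)
    then have "?p k < b / a + 1 / (a * c) + real j / (a * c)"
      by (simp add: add_divide_distrib)
    also have "\<dots> \<le> \<beta> / \<alpha> + real j / \<alpha>"
      using \<beta> \<alpha> by (intro add_mono divide_left_mono) auto
    finally show ?thesis by (simp add: add_divide_distrib)
  qed
  \<comment> \<open>Every pole has multiplicity \<open>c\<close>: the share matched with zeros
    enters the mixtures, the rest becomes a plain gamma factor. The exponential collects the scaling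
    factors of both Euler products.\<close>
  let ?\<Phi> = "\<lambda>K r. exp (r * (c * (a * ln (real K)) - \<alpha> * ln (real (M K)))) *
       ((\<Prod>k<K. \<Prod>j<M K. ((?p k / (?p k + r)) * ((?q j + r) / ?q j)) powr w k j) *
        (\<Prod>k<K. (?p k / (?p k + r)) powr (c - (\<Sum>j<M K. w k j))))"
  have p0: "?p k > 0" "b / a \<le> ?p k" for k using a b by (auto simp: field_simps add_pos_nonneg)
  have mgf: "is_mgf (b / a) (?\<Phi> K)" for K
  proof (intro is_mgf_mult is_mgf_exp is_mgf_prod \<rho>)
    fix k j
    show "is_mgf (b / a) (\<lambda>r. ((?p k / (?p k + r)) * ((?q j + r) / ?q j)) powr w k j)"
    proof (cases "w k j > 0")
      case True
      show ?thesis
        by (rule is_mgf_cong[OF is_mgf_neg_binomial_mixture[OF True p0(1) pq[OF w(2)[OF True]]] p0(2)]) simp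
    next
      case False
      then have "w k j = 0" using w(1)[of k j] by simp
      moreover have "?p k / (?p k + r) * ((?q j + r) / ?q j) \<noteq> 0" if "r > -(b/a)" for r
      proof -
        have "b / a \<le> \<beta> / \<alpha>" using \<beta> zero_less_divide_1_iff[of "a * c"] mult_pos_pos[OF a c] by linarith
        also have "\<dots> \<le> ?q j" using \<alpha> by (simp add: divide_right_mono)
        finally have q: "?q j + r > 0" "?q j > 0" using that \<rho> by linarith+
        have "?p k + r > 0" using p0[of k] that by linarith
        from mult_pos_pos[OF divide_pos_pos[OF p0(1) this] divide_pos_pos[OF q]]
        have "0 < ?p k / (?p k + r) * ((?q j + r) / ?q j)" .
        then show ?thesis by (rule less_imp_neq[THEN not_sym])
      qed
      ultimately show ?thesis
        by (intro is_mgf_cong[OF is_mgf_exp[OF \<rho>, of 0]]) auto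
    qed
  next
    fix k
    show "is_mgf (b / a) (\<lambda>r. (?p k / (?p k + r)) powr (c - (\<Sum>j<M K. w k j)))"
      by (rule is_mgf_cong[OF is_mgf_gamma[OF _ p0(1)] p0(2)]) (use w(4) in auto)
  qed auto
  have lim: "(\<lambda>K. ?\<Phi> K r) \<longlonglongrightarrow> (Gamma (a * r + b) / Gamma b) powr c / (Gamma (\<alpha> * r + \<beta>) / Gamma \<beta>)"
    if r: "r > - (b / a)" for r
  proof -
  have posa: "a * r + b > 0" using a r by (simp add: field_simps)
  have "b / a \<le> \<beta> / \<alpha>" using \<beta> zero_less_divide_1_iff[of "a * c"] mult_pos_pos[OF a c] by linarith
  then have r': "r > - \<beta> / \<alpha>" using r by (simp add: field_simps)
  then have pos\<alpha>: "\<alpha> * r + \<beta> > 0" using \<alpha> by (simp add: field_simps)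
  have filt: "filterlim M at_top sequentially"
    unfolding M_def using c by real_asymp
  let ?A = "\<lambda>k. ?p k / (?p k + r)" and ?B = "\<lambda>j. ?q j / (?q j + r)"
  have pr: "?p k + r > 0" "?A k > 0" for k
  proof -
    show "?p k + r > 0" using p0(2)[of k] r by linarith
    with p0(1)[of k] show "?A k > 0" by (rule divide_pos_pos)
  qed
  have qr: "?q j > 0" "?q j + r > 0" "?B j > 0" for j
  proof -
    show "?q j > 0" using \<alpha> \<beta>0 by (simp add: add_pos_nonneg)
    moreover have "\<beta> / \<alpha> \<le> ?q j" using \<alpha> by (simp add: divide_right_mono)
    then show "?q j + r > 0" using r' by linarith
    ultimately show "?B j > 0" by (rule divide_pos_pos)
  qed
  have "(\<lambda>K. (exp (r * (a * ln (real K))) * (\<Prod>k<K. ?A k)) powr c /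
      (exp (r * (\<alpha> * ln (real (M K)))) * (\<Prod>j<M K. ?B j)))
      \<longlonglongrightarrow> (Gamma (a * r + b) / Gamma b) powr c / (Gamma (\<alpha> * r + \<beta>) / Gamma \<beta>)"
    using a b r posa Gamma_real_nonzero[OF b] Gamma_real_nonzero[OF posa]
      Gamma_real_nonzero[OF \<beta>0] Gamma_real_nonzero[OF pos\<alpha>] \<beta>0 \<alpha> r'
    by (intro tendsto_divide tendsto_powr tendsto_const Gamma_ratio_LIMSEQ
        filterlim_compose[OF Gamma_ratio_LIMSEQ filt]) auto
  moreover have "(exp (r * (a * ln (real K))) * (\<Prod>k<K. ?A k)) powr c /
      (exp (r * (\<alpha> * ln (real (M K)))) * (\<Prod>j<M K. ?B j)) = ?\<Phi> K r" for K
  proof -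
    have 1: "(exp (r * (a * ln (real K))) * (\<Prod>k<K. ?A k)) powr c =
        exp (r * (c * (a * ln (real K)))) * (\<Prod>k<K. ?A k powr c)"
      using pr by (subst powr_mult) (auto simp: prod_powr_distrib less_imp_le prod_nonneg exp_powr_real mult_ac)
    \<comment> \<open>Interchanging the products lets every zero collect total weight 1, while a
      pole collects \<open>\<Sum>j<M K. w k j\<close>, which the leftover exponent completes to
      \<open>c\<close>.\<close>
    have "(\<Prod>k<K. \<Prod>j<M K. (?A k * ((?q j + r) / ?q j)) powr w k j) =
        (\<Prod>k<K. \<Prod>j<M K. ?A k powr w k j * inverse (?B j) powr w k j)"
    proof (intro prod.cong refl)
      fix k j
      show "(?A k * ((?q j + r) / ?q j)) powr w k j = ?A k powr w k j * inverse (?B j) powr w k j"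
        unfolding inverse_divide by (rule powr_mult)
    qed
    also have "\<dots> = (\<Prod>k<K. \<Prod>j<M K. ?A k powr w k j) * (\<Prod>j<M K. \<Prod>k<K. inverse (?B j) powr w k j)"
      by (subst (2) prod.swap) (simp add: prod.distrib)
    also have "(\<Prod>j<M K. \<Prod>k<K. inverse (?B j) powr w k j) = (\<Prod>j<M K. inverse (?B j))"
    proof (rule prod.cong)
      fix j assume "j \<in> {..<M K}"
      then have s: "(\<Sum>k<K. w k j) = 1" using w(3) M by simp
      have "inverse (?B j) > 0" using qr(3)[of j] by (rule positive_imp_inverse_positive)
      then have "(\<Prod>k<K. inverse (?B j) powr w k j) = inverse (?B j) powr (\<Sum>k<K. w k j)"
        by (subst powr_sum) auto
      then have "(\<Prod>k<K. inverse (?B j) powr w k j) = inverse (?B j) powr 1"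
        by (simp only: s)
      also have "inverse (?B j) powr 1 = inverse (?B j)"
        using \<open>inverse (?B j) > 0\<close> by (simp only: powr_one_gt_zero_iff less_imp_le)
      finally show "(\<Prod>k<K. inverse (?B j) powr w k j) = inverse (?B j)" .
    qed simp
    also have "(\<Prod>k<K. \<Prod>j<M K. ?A k powr w k j) = (\<Prod>k<K. ?A k powr (\<Sum>j<M K. w k j))"
    proof (rule prod.cong)
      fix k
      show "(\<Prod>j<M K. ?A k powr w k j) = ?A k powr (\<Sum>j<M K. w k j)"
        using pr(2)[of k] by (subst powr_sum) auto
    qed simp
    also have "(\<Prod>j<M K. inverse (?B j)) = inverse (\<Prod>j<M K. ?B j)"
      using prod_inversef[of ?B "{..<M K}"] by (simp only: o_def)
    finally have "(\<Prod>k<K. \<Prod>j<M K. (?A k * ((?q j + r) / ?q j)) powr w k j) * (\<Prod>k<K. ?A k powr (c - (\<Sum>j<M K. w k j)))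
       = ((\<Prod>k<K. ?A k powr (c - (\<Sum>j<M K. w k j))) * (\<Prod>k<K. ?A k powr (\<Sum>j<M K. w k j))) * inverse (\<Prod>j<M K. ?B j)"
      by (simp only: mult_ac)
    then have 2: "(\<Prod>k<K. \<Prod>j<M K. (?A k * ((?q j + r) / ?q j)) powr w k j) * (\<Prod>k<K. ?A k powr (c - (\<Sum>j<M K. w k j)))
       = (\<Prod>k<K. ?A k powr c) * inverse (\<Prod>j<M K. ?B j)"
      by (simp only: prod.distrib[symmetric] powr_add[symmetric] diff_add_cancel)
    have 3: "exp (r * (c * (a * ln (real K)) - \<alpha> * ln (real (M K)))) =
        exp (r * (c * (a * ln (real K)))) * inverse (exp (r * (\<alpha> * ln (real (M K)))))"
      by (simp add: right_diff_distrib exp_diff divide_inverse)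
    show ?thesis unfolding 1 2 3 divide_inverse[of _ "exp _ * _"] inverse_mult_distrib by (simp only: mult_ac)
  qed
  ultimately show ?thesis
    by simp
  qed
  show ?thesis
    by (rule is_mgf_limit[OF \<rho> mgf lim])
qed

section \<open>Complex arguments\<close>

lemma has_mgf_integrable_exp_complex:
  assumes "has_mgf M \<rho> \<Phi>" "Re z > -\<rho>"
  shows "integrable M (\<lambda>x. exp (z * of_real x))"
proof -
  interpret real_distribution M using assms(1) by (rule has_mgfD)
  show ?thesis
    by (rule Bochner_Integration.integrable_bound[OF has_mgfD(2)[OF assms]]) auto
qed

lemma exp_abs_le: "exp (\<delta> * \<bar>x\<bar>) \<le> exp (\<delta> * x) + exp (- \<delta> * (x :: real))"
  by (cases "x \<ge> 0") (auto simp: add_increasing add_increasing2)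

text \<open>Differentiation under the integral sign: the Taylor remainder of \<open>exp\<close> is
  at most \<open>(norm h)\<^sup>2\<close> times an integrable function, because the real part of
  \<open>z\<close> can be moved by \<open>\<delta>\<close> both ways inside the half-plane.\<close>

lemma has_mgf_complex_holomorphic:
  assumes \<rho>: "\<rho> > 0" and M: "has_mgf M \<rho> \<Phi>"
  shows "(\<lambda>z. \<integral>x. exp (z * of_real x) \<partial>M) holomorphic_on {z. Re z > -\<rho>}"
proof -
  interpret real_distribution M using M by (rule has_mgfD)
  define G where "G z = (\<integral>x. exp (z * of_real x) \<partial>M)" for z :: complex
  have "\<exists>D. (G has_field_derivative D) (at z)" if z: "Re z > -\<rho>" for z
  proof -
    define \<delta> where "\<delta> = (Re z + \<rho>) / 2"
    have \<delta>: "\<delta> > 0" "Re z - \<delta> > -\<rho>" "Re z + \<delta> > -\<rho>" using z \<rho> by (auto simp: \<delta>_def field_simps)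
    define g where "g x = exp ((Re z + \<delta>) * x) + exp ((Re z - \<delta>) * x)" for x
    have g: "integrable M g"
      unfolding g_def by (intro Bochner_Integration.integrable_add has_mgfD(2)[OF M] \<delta>)
    have gb: "exp (Re z * x) * exp (\<delta> * \<bar>x\<bar>) \<le> g x" for x
      using mult_left_mono[OF exp_abs_le[of \<delta> x], of "exp (Re z * x)"]
      by (simp add: g_def exp_add[symmetric] algebra_simps)
    have i1: "integrable M (\<lambda>x. of_real x * exp (z * of_real x))"
    proof (rule Bochner_Integration.integrable_bound[OF integrable_mult_right[OF g, of "1 / \<delta>"]])
      have "norm (of_real x * exp (z * of_real x)) \<le> norm (1 / \<delta> * g x)" for x
      proof -
        have "\<delta> * \<bar>x\<bar> \<le> exp (\<delta> * \<bar>x\<bar>)" using exp_ge_add_one_self[of "\<delta> * \<bar>x\<bar>"] by linarith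
        then have "\<bar>x\<bar> * exp (Re z * x) \<le> 1 / \<delta> * (exp (Re z * x) * exp (\<delta> * \<bar>x\<bar>))"
          using \<delta> by (simp add: field_simps)
        also have "\<dots> \<le> 1 / \<delta> * g x" using gb[of x] \<delta> by (intro mult_left_mono) auto
        finally have "\<bar>x\<bar> * exp (Re z * x) \<le> 1 / \<delta> * g x" .
        moreover have "0 \<le> 1 / \<delta> * g x" using \<delta> by (simp add: g_def add_nonneg_nonneg)
        ultimately show ?thesis by (simp only: norm_mult norm_of_real norm_exp_eq_Re real_norm_def abs_of_nonneg) simp
      qed
      then show "AE x in M. norm (of_real x * exp (z * of_real x)) \<le> norm (1 / \<delta> * g x)" by simp
    qed auto
    define D where "D = (\<integral>x. of_real x * exp (z * of_real x) \<partial>M)"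
    \<comment> \<open>The factor \<open>8 / \<delta>\<^sup>2\<close> comes from
      \<open>y\<^sup>2 / 2 \<le> exp y\<close> at \<open>y = \<delta> / 2 * \<bar>x\<bar>\<close>:
      one half of \<open>\<delta>\<close> pays for \<open>x\<^sup>2\<close>, the other for the shift
      by \<open>h\<close>.\<close>
    define C where "C = 8 / \<delta>\<^sup>2 * (\<integral>x. g x \<partial>M)"
    have "norm ((G (z + h) - G z) / h - D) \<le> C * norm h" if h: "norm h \<le> \<delta> / 2" "h \<noteq> 0" for h
    proof -
      have "Re h \<ge> - norm h" using abs_Re_le_cmod[of h] by linarith
      then have "Re (z + h) > -\<rho>" using h \<delta> by simp
      then have ih: "integrable M (\<lambda>x. exp ((z + h) * of_real x))"
        by (rule has_mgf_integrable_exp_complex[OF M])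
      have iz: "integrable M (\<lambda>x. exp (z * of_real x))"
        by (rule has_mgf_integrable_exp_complex[OF M z])
      let ?R = "\<lambda>x. exp ((z + h) * of_real x) - exp (z * of_real x) - h * (of_real x * exp (z * of_real x))"
      have b: "norm (?R x) \<le> 8 / \<delta>\<^sup>2 * (norm h)\<^sup>2 * g x" for x
      proof -
        have "?R x = exp (z * of_real x) * (exp (h * of_real x) - (\<Sum>i\<le>1. (h * of_real x) ^ i / fact i))"
          by (simp add: algebra_simps exp_add)
        then have "norm (?R x) = exp (Re z * x) * norm (exp (h * of_real x) - (\<Sum>i\<le>1. (h * of_real x) ^ i / fact i))"
          by (simp add: norm_mult)
        also have "\<dots> \<le> exp (Re z * x) * (exp \<bar>Re (h * of_real x)\<bar> * (norm (h * of_real x) ^ Suc 1) / fact 1)"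
          by (intro mult_left_mono Taylor_exp) simp
        also have "\<dots> = exp (Re z * x) * (exp \<bar>Re h * x\<bar> * ((norm h)\<^sup>2 * x\<^sup>2))"
          by (simp add: norm_mult power2_eq_square mult_ac)
        also have "\<dots> \<le> exp (Re z * x) * (exp (\<delta> / 2 * \<bar>x\<bar>) * ((norm h)\<^sup>2 * (8 / \<delta>\<^sup>2 * exp (\<delta> / 2 * \<bar>x\<bar>))))"
        proof (intro mult_left_mono mult_mono)
          have "\<bar>Re h\<bar> \<le> \<delta> / 2" using abs_Re_le_cmod[of h] h by linarith
          then show "exp \<bar>Re h * x\<bar> \<le> exp (\<delta> / 2 * \<bar>x\<bar>)"
            by (simp add: abs_mult mult_right_mono del: times_divide_eq_left)
          have "(\<delta> / 2 * \<bar>x\<bar>)\<^sup>2 / 2 \<le> exp (\<delta> / 2 * \<bar>x\<bar>)"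
          proof -
            have "0 \<le> \<delta> / 2 * \<bar>x\<bar>" using \<delta> by simp
            then show ?thesis using exp_lower_Taylor_quadratic[of "\<delta> / 2 * \<bar>x\<bar>"] by linarith
          qed
          then show "x\<^sup>2 \<le> 8 / \<delta>\<^sup>2 * exp (\<delta> / 2 * \<bar>x\<bar>)"
            using \<delta> by (simp add: field_simps power2_eq_square)
        qed auto
        also have "\<dots> = 8 / \<delta>\<^sup>2 * (norm h)\<^sup>2 * (exp (Re z * x) * exp (\<delta> * \<bar>x\<bar>))"
        proof -
          have "exp (\<delta> * \<bar>x\<bar>) = exp (\<delta> / 2 * \<bar>x\<bar>) * exp (\<delta> / 2 * \<bar>x\<bar>)"
            by (simp add: exp_add[symmetric])
          then show ?thesis by (simp only: mult_ac)
        qed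
        also have "\<dots> \<le> 8 / \<delta>\<^sup>2 * (norm h)\<^sup>2 * g x"
          by (intro mult_left_mono gb) auto
        finally show ?thesis .
      qed
      have "(G (z + h) - G z) / h - D = (\<integral>x. ?R x \<partial>M) / h"
        using ih iz i1 h(2) by (simp add: G_def D_def field_simps)
      then have "norm ((G (z + h) - G z) / h - D) = norm (\<integral>x. ?R x \<partial>M) / norm h"
        by (simp add: norm_divide)
      also have "norm (\<integral>x. ?R x \<partial>M) \<le> (\<integral>x. 8 / \<delta>\<^sup>2 * (norm h)\<^sup>2 * g x \<partial>M)"
        by (rule Bochner_Integration.integral_norm_bound_integral) (use b ih iz i1 g in auto)
      also have "\<dots> / norm h = C * norm h"
        using h(2) by (simp add: C_def power2_eq_square)
      finally show ?thesis using h(2) by (simp add: divide_right_mono)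
    qed
    then have "eventually (\<lambda>h. norm ((G (z + h) - G z) / h - D) \<le> C * norm h) (at 0)"
      using \<delta> unfolding eventually_at by (intro exI[of _ "\<delta> / 2"]) (auto simp: dist_norm)
    moreover have "((\<lambda>h. C * norm h) \<longlongrightarrow> 0) (at (0::complex))"
      by (auto intro!: tendsto_eq_intros)
    ultimately have "((\<lambda>h. (G (z + h) - G z) / h - D) \<longlongrightarrow> 0) (at 0)"
      by (rule Lim_null_comparison)
    then have "(G has_field_derivative D) (at z)"
      unfolding DERIV_def by (rule LIM_zero_cancel)
    then show ?thesis by blast
  qed
  then show ?thesis
    unfolding G_def[abs_def, symmetric]
    by (subst holomorphic_on_open) (auto simp: open_halfspace_Re_gt)
qed

text \<open>Identity theorem: both sides are holomorphic on the half-plane and agree on the positive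
  reals, which accumulate at 0.\<close>

lemma has_mgf_complex:
  assumes \<rho>: "\<rho> > 0" and M: "has_mgf M \<rho> \<Phi>" and F: "F holomorphic_on {z. Re z > -\<rho>}"
    and eq: "\<And>r. r > -\<rho> \<Longrightarrow> F (of_real r) = of_real (\<Phi> r)" and z: "Re z > -\<rho>"
  shows "has_bochner_integral M (\<lambda>x. exp (z * of_real x)) (F z)"
proof -
  interpret real_distribution M using M by (rule has_mgfD)
  let ?S = "{z. Re z > -\<rho>}"
  let ?G = "\<lambda>z::complex. \<integral>x. exp (z * of_real x) \<partial>M"
  let ?U = "complex_of_real ` {0<..}"
  have real: "?G (of_real r) = F (of_real r)" if "r > -\<rho>" for r
  proof -
    have "?G (of_real r) = (\<integral>x. complex_of_real (exp (r * x)) \<partial>M)"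
      by (simp add: exp_of_real[symmetric] del: exp_of_real)
    also have "\<dots> = of_real (\<Phi> r)"
      using has_mgfD(3)[OF M that] by (simp del: of_real_exp)
    finally show ?thesis using eq[OF that] by simp
  qed
  have "?G z - F z = 0"
  proof (rule analytic_continuation[where f = "\<lambda>z. ?G z - F z" and S = ?S and U = ?U and \<xi> = 0])
    show "(\<lambda>z. ?G z - F z) holomorphic_on ?S"
      by (intro holomorphic_on_diff has_mgf_complex_holomorphic[OF \<rho> M] F)
    show "open ?S" by (rule open_halfspace_Re_gt)
    show "connected ?S" by (intro convex_connected convex_halfspace_Re_gt)
    show "?U \<subseteq> ?S" "0 \<in> ?S" "z \<in> ?S" using \<rho> z by auto
    show "0 islimpt ?U"
      unfolding islimpt_approachable
    proof (intro allI impI)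
      fix e :: real assume "e > 0"
      then have "complex_of_real (e / 2) \<in> ?U" "complex_of_real (e / 2) \<noteq> 0 \<and> dist (complex_of_real (e / 2)) 0 < e"
        by (auto simp del: of_real_divide)
      then show "\<exists>x'\<in>?U. x' \<noteq> 0 \<and> dist x' 0 < e" by blast
    qed
    show "?G x - F x = 0" if "x \<in> ?U" for x
      using that real \<rho> by auto
  qed
  then show ?thesis
    using has_mgf_integrable_exp_complex[OF M z] by (simp add: has_bochner_integral_iff)
qed

section \<open>Smoothness of Mellin inversion integrals\<close>

text \<open>The weights \<open>\<psi>\<close> will be reflected characteristic functions.
  Integrability against every power of \<open>x\<close> is what permits unlimited differentiation
  under the integral.\<close>

definition all_moments :: "(real \<Rightarrow> complex) \<Rightarrow> bool" where
  "all_moments \<psi> \<longleftrightarrow> \<psi> \<in> borel_measurable borel \<and> (\<forall>k. integrable lborel (\<lambda>x. \<bar>x\<bar> ^ k * norm (\<psi> x)))"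

lemma all_moments_integrable_bound:
  fixes f :: "real \<Rightarrow> complex"
  assumes "all_moments \<psi>" "f \<in> borel_measurable borel" "\<And>x. norm (f x) \<le> \<bar>x\<bar> ^ k * norm (\<psi> x)"
  shows "integrable lborel f"
  by (rule Bochner_Integration.integrable_bound[of _ "\<lambda>x. \<bar>x\<bar> ^ k * norm (\<psi> x)"])
     (use assms in \<open>auto simp: all_moments_def\<close>)

text \<open>This is the factor that differentiation of the power
  \<open>t powr (\<i> * x - s)\<close> brings down, so the class is closed under it.\<close>

lemma all_moments_linear_mult:
  assumes "all_moments \<psi>"
  shows "all_moments (\<lambda>x. (\<i> * of_real x - of_real s) * \<psi> x)"
  unfolding all_moments_def
proof (intro conjI allI)
  have [measurable]: "\<psi> \<in> borel_measurable borel" using assms by (simp add: all_moments_def)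
  show "(\<lambda>x. (\<i> * of_real x - of_real s) * \<psi> x) \<in> borel_measurable borel" by measurable
  fix k
  have "integrable lborel (\<lambda>x. \<bar>x\<bar> ^ Suc k * norm (\<psi> x) + \<bar>s\<bar> * (\<bar>x\<bar> ^ k * norm (\<psi> x)))"
    by (intro Bochner_Integration.integrable_add integrable_mult_right) (use assms in \<open>unfold all_moments_def, blast+\<close>)
  then show "integrable lborel (\<lambda>x. \<bar>x\<bar> ^ k * norm ((\<i> * of_real x - of_real s) * \<psi> x))"
  proof (rule Bochner_Integration.integrable_bound)
    have "\<bar>x\<bar> ^ k * norm ((\<i> * of_real x - of_real s) * \<psi> x) \<le> \<bar>x\<bar> ^ Suc k * norm (\<psi> x) + \<bar>s\<bar> * (\<bar>x\<bar> ^ k * norm (\<psi> x))" for x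
    proof -
      have "norm (\<i> * of_real x - complex_of_real s) \<le> \<bar>x\<bar> + \<bar>s\<bar>"
        by (rule order_trans[OF norm_triangle_ineq4]) (simp add: norm_mult)
      then have "\<bar>x\<bar> ^ k * (norm (\<i> * of_real x - complex_of_real s) * norm (\<psi> x)) \<le> \<bar>x\<bar> ^ k * ((\<bar>x\<bar> + \<bar>s\<bar>) * norm (\<psi> x))"
        by (intro mult_left_mono mult_right_mono) auto
      then show ?thesis
        unfolding norm_mult power_Suc by (simp only: distrib_left distrib_right mult_ac)
    qed
    then show "AE x in lborel. norm (\<bar>x\<bar> ^ k * norm ((\<i> * of_real x - of_real s) * \<psi> x)) \<le>
        norm (\<bar>x\<bar> ^ Suc k * norm (\<psi> x) + \<bar>s\<bar> * (\<bar>x\<bar> ^ k * norm (\<psi> x)))"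
      by (simp add: abs_of_nonneg add_nonneg_nonneg)
  qed measurable
qed

text \<open>The first-order Taylor error of \<open>iexp\<close> is at most
  \<open>h\<^sup>2 * x\<^sup>2\<close>, hence the second absolute moment of \<open>\<psi>\<close>
  bounds the error of the integral by \<open>C * h\<^sup>2\<close>.\<close>

lemma Fourier_integral_derivative:
  assumes "all_moments \<psi>"
  shows "((\<lambda>y. \<integral>x. \<psi> x * iexp (x * y) \<partial>lborel) has_vector_derivative
            (\<integral>x. \<i> * of_real x * \<psi> x * iexp (x * y) \<partial>lborel)) (at y)"
proof -
  have [measurable]: "\<psi> \<in> borel_measurable borel" using assms by (simp add: all_moments_def)
  define F where "F y = (\<integral>x. \<psi> x * iexp (x * y) \<partial>lborel)" for y
  define D where "D = (\<integral>x. \<i> * of_real x * \<psi> x * iexp (x * y) \<partial>lborel)"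
  define C where "C = (\<integral>x. \<bar>x\<bar> ^ 2 * norm (\<psi> x) \<partial>lborel)"
  have i0: "integrable lborel (\<lambda>x. \<psi> x * iexp (x * y))" for y
    by (rule all_moments_integrable_bound[OF assms, of _ 0]) (auto simp: norm_mult)
  have i1: "integrable lborel (\<lambda>x. \<i> * of_real x * \<psi> x * iexp (x * y))"
    by (rule all_moments_integrable_bound[OF assms, of _ 1]) (auto simp: norm_mult)
  have bound: "norm (F (y + h) - F y - of_real h * D) \<le> C * h\<^sup>2" for h
  proof -
    let ?R = "\<lambda>x. \<psi> x * iexp (x * (y + h)) - \<psi> x * iexp (x * y) - of_real h * (\<i> * of_real x * \<psi> x * iexp (x * y))"
    have "norm (?R x) \<le> h\<^sup>2 * (\<bar>x\<bar> ^ 2 * norm (\<psi> x))" for x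
    proof -
      have "?R x = \<psi> x * iexp (x * y) * (iexp (h * x) - (\<Sum>k\<le>1. (\<i> * of_real (h * x)) ^ k / fact k))"
        by (simp add: algebra_simps exp_add)
      then have "norm (?R x) = norm (\<psi> x) * norm (iexp (h * x) - (\<Sum>k\<le>1. (\<i> * of_real (h * x)) ^ k / fact k))"
        by (simp add: norm_mult)
      also have "\<dots> \<le> norm (\<psi> x) * (\<bar>h * x\<bar> ^ Suc 1 / fact (Suc 1))"
        by (intro mult_left_mono iexp_approx1) auto
      also have "\<dots> \<le> norm (\<psi> x) * \<bar>h * x\<bar> ^ 2"
      proof (rule mult_left_mono)
        have half: "y ^ Suc 1 / fact (Suc 1) \<le> y ^ 2" if "y \<ge> 0" for y :: real
          using that by (simp add: power2_eq_square)
        show "\<bar>h * x\<bar> ^ Suc 1 / fact (Suc 1) \<le> \<bar>h * x\<bar> ^ 2" by (rule half) simp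
      qed simp
      finally show ?thesis by (simp add: power_mult_distrib mult_ac)
    qed
    then have "norm (\<integral>x. ?R x \<partial>lborel) \<le> (\<integral>x. h\<^sup>2 * (\<bar>x\<bar> ^ 2 * norm (\<psi> x)) \<partial>lborel)"
    proof (intro Bochner_Integration.integral_norm_bound_integral)
      show "integrable lborel ?R"
        by (rule Bochner_Integration.integrable_diff, rule Bochner_Integration.integrable_diff, rule i0, rule i0,
            rule integrable_mult_right, rule i1)
      show "integrable lborel (\<lambda>x. h\<^sup>2 * (\<bar>x\<bar> ^ 2 * norm (\<psi> x)))"
        by (rule integrable_mult_right) (use assms in \<open>unfold all_moments_def, blast\<close>)
    qed
    moreover have "(\<integral>x. ?R x \<partial>lborel) = F (y + h) - F y - of_real h * D"
      using i0[of "y + h"] i0[of y] i1 by (simp add: F_def D_def)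
    ultimately show ?thesis by (simp add: C_def mult.commute)
  qed
  have "((\<lambda>h. norm (F (y + h) - F y - h *\<^sub>R D) / norm h) \<longlongrightarrow> 0) (at 0)"
  proof (rule Lim_null_comparison)
    have "norm (norm (F (y + h) - F y - h *\<^sub>R D) / norm h) \<le> C * \<bar>h\<bar>" if "h \<noteq> 0" for h
    proof -
      have "h\<^sup>2 = \<bar>h\<bar> * \<bar>h\<bar>" by (simp add: power2_eq_square)
      then show ?thesis
        using bound[of h] that by (simp add: scaleR_conv_of_real divide_le_eq mult_ac)
    qed
    then show "\<forall>\<^sub>F h in at 0. norm (norm (F (y + h) - F y - h *\<^sub>R D) / norm h) \<le> C * \<bar>h\<bar>"
      by (auto simp: eventually_at_filter)
    show "((\<lambda>h. C * \<bar>h\<bar>) \<longlongrightarrow> 0) (at 0)"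
      by (auto intro!: tendsto_eq_intros)
  qed
  then have "(F has_derivative (\<lambda>h. h *\<^sub>R D)) (at y)"
    unfolding has_derivative_at by (auto intro: bounded_linear_scaleR_left)
  then show ?thesis
    unfolding F_def[abs_def] D_def by (simp add: has_vector_derivative_def)
qed

text \<open>For \<open>t > 0\<close> this integrates
  \<open>\<psi> x * t powr (\<i> * x - s)\<close>, a Mellin inversion integral. The free exponent
  \<open>s\<close> lets derivatives stay in the same family.\<close>

definition power_integral :: "(real \<Rightarrow> complex) \<Rightarrow> real \<Rightarrow> real \<Rightarrow> complex" where
  "power_integral \<psi> s t = (\<integral>x. \<psi> x * exp ((\<i> * of_real x - of_real s) * of_real (ln t)) \<partial>lborel)"

lemma power_integral_eq:
  "power_integral \<psi> s t = exp (- of_real (s * ln t)) * (\<integral>x. \<psi> x * iexp (x * ln t) \<partial>lborel)"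
proof -
  have "\<psi> x * exp ((\<i> * of_real x - of_real s) * of_real (ln t)) =
      exp (- of_real (s * ln t)) * (\<psi> x * iexp (x * ln t))" for x
  proof -
    have "(\<i> * of_real x - of_real s) * of_real (ln t) = - complex_of_real (s * ln t) + \<i> * of_real (x * ln t)"
      by (simp add: algebra_simps)
    then show ?thesis by (simp only: exp_add mult_ac)
  qed
  then show ?thesis
    unfolding power_integral_def by (simp only: integral_mult_right_zero)
qed

lemma power_integral_derivative:
  assumes \<psi>: "all_moments \<psi>" and t: "t > 0"
  shows "(power_integral \<psi> s has_vector_derivative
     power_integral (\<lambda>x. (\<i> * of_real x - of_real s) * \<psi> x) (s + 1) t) (at t)"
proof -
  have [measurable]: "\<psi> \<in> borel_measurable borel" using \<psi> by (simp add: all_moments_def)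
  define F where "F y = (\<integral>x. \<psi> x * iexp (x * y) \<partial>lborel)" for y
  define D where "D = (\<integral>x. \<i> * of_real x * \<psi> x * iexp (x * ln t) \<partial>lborel)"
  have i0: "integrable lborel (\<lambda>x. \<psi> x * iexp (x * ln t))"
    by (rule all_moments_integrable_bound[OF \<psi>, of _ 0]) (auto simp: norm_mult)
  have i1: "integrable lborel (\<lambda>x. \<i> * of_real x * \<psi> x * iexp (x * ln t))"
    by (rule all_moments_integrable_bound[OF \<psi>, of _ 1]) (auto simp: norm_mult)
  have ln: "(ln has_vector_derivative 1 / t) (at t)"
    using t by (auto intro!: derivative_eq_intros simp: has_real_derivative_iff_has_vector_derivative[symmetric])
  have "((F \<circ> ln) has_vector_derivative (1 / t) *\<^sub>R D) (at t)"
    unfolding F_def[abs_def] D_def by (rule vector_diff_chain_at[OF ln Fourier_integral_derivative[OF \<psi>]])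
  moreover have "((\<lambda>t. complex_of_real (exp (- (s * ln t)))) has_vector_derivative of_real (- (s / t) * exp (- (s * ln t)))) (at t)"
    using t by (intro has_vector_derivative_of_real)
      (auto intro!: derivative_eq_intros simp: has_real_derivative_iff_has_vector_derivative[symmetric] field_simps)
  ultimately have "((\<lambda>t. complex_of_real (exp (- (s * ln t))) * (F \<circ> ln) t) has_vector_derivative
      of_real (exp (- (s * ln t))) * ((1 / t) *\<^sub>R D) + of_real (- (s / t) * exp (- (s * ln t))) * (F \<circ> ln) t) (at t)"
    by (intro has_vector_derivative_mult)
  moreover have "(\<lambda>t. complex_of_real (exp (- (s * ln t))) * (F \<circ> ln) t) = power_integral \<psi> s"
    by (auto simp: power_integral_eq F_def exp_of_real[symmetric])
  moreover have "of_real (exp (- (s * ln t))) * ((1 / t) *\<^sub>R D) + of_real (- (s / t) * exp (- (s * ln t))) * (F \<circ> ln) t =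
      power_integral (\<lambda>x. (\<i> * of_real x - of_real s) * \<psi> x) (s + 1) t"
  proof -
    have "- ((s + 1) * ln t) = - (s * ln t) - ln t" by (simp add: algebra_simps)
    then have "exp (- ((s + 1) * ln t)) = exp (- (s * ln t)) / t"
      using t by (simp only: exp_diff exp_ln)
    then have e: "exp (- complex_of_real ((s + 1) * ln t)) = of_real (exp (- (s * ln t)) / t)"
      by (metis exp_of_real of_real_minus)
    have "(\<integral>x. (\<i> * of_real x - of_real s) * \<psi> x * iexp (x * ln t) \<partial>lborel) =
        (\<integral>x. \<i> * of_real x * \<psi> x * iexp (x * ln t) - of_real s * (\<psi> x * iexp (x * ln t)) \<partial>lborel)"
      by (intro Bochner_Integration.integral_cong refl) (simp add: algebra_simps)
    also have "\<dots> = D - of_real s * F (ln t)"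
      using i0 i1 by (simp add: D_def F_def)
    finally have I: "(\<integral>x. (\<i> * of_real x - of_real s) * \<psi> x * iexp (x * ln t) \<partial>lborel) = D - of_real s * F (ln t)" .
    show ?thesis
      unfolding power_integral_eq e I o_apply by (simp add: scaleR_conv_of_real divide_inverse algebra_simps)
  qed
  ultimately show ?thesis by simp
qed

text \<open>Each derivative changes the weight and raises the exponent by one. Equality on the open
  half-line suffices for the next derivative, which is local.\<close>

lemma iterated_derivative_power_integral:
  assumes "all_moments \<psi>"
  shows "\<exists>\<psi>' s'. all_moments \<psi>' \<and>
    (\<forall>t>0. ((\<lambda>g t. vector_derivative g (at t)) ^^ k) (power_integral \<psi> s) t = power_integral \<psi>' s' t)"
proof (induction k)
  case 0
  show ?case using assms by auto
next
  case (Suc k)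
  let ?D = "\<lambda>g t. vector_derivative g (at t)"
  obtain \<psi>' s' where *: "all_moments \<psi>'" "\<And>t. t > 0 \<Longrightarrow> (?D ^^ k) (power_integral \<psi> s) t = power_integral \<psi>' s' t"
    using Suc.IH by blast
  have "(?D ^^ Suc k) (power_integral \<psi> s) t = power_integral (\<lambda>x. (\<i> * of_real x - of_real s') * \<psi>' x) (s' + 1) t"
    if t: "t > 0" for t
  proof -
    have "((?D ^^ k) (power_integral \<psi> s) has_vector_derivative power_integral (\<lambda>x. (\<i> * of_real x - of_real s') * \<psi>' x) (s' + 1) t) (at t)"
      by (rule has_vector_derivative_transform_within_open[OF power_integral_derivative[OF *(1) t], of "{0<..}"])
         (use * t in auto)
    then show ?thesis by (simp add: vector_derivative_at)
  qed
  then show ?case using all_moments_linear_mult[OF *(1)] by blast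
qed

lemma C_infinity_on_power_integral:
  assumes "all_moments \<psi>"
  shows "C_infinity_on {0<..} (power_integral \<psi> s)"
  unfolding C_infinity_on_def
proof (intro allI ballI)
  let ?D = "\<lambda>g t. vector_derivative g (at t)"
  fix k and t :: real assume t: "t \<in> {0<..}"
  obtain \<psi>' s' where *: "all_moments \<psi>'" "\<And>t. t > 0 \<Longrightarrow> (?D ^^ k) (power_integral \<psi> s) t = power_integral \<psi>' s' t"
    using iterated_derivative_power_integral[OF assms] by blast
  have "((?D ^^ k) (power_integral \<psi> s) has_vector_derivative power_integral (\<lambda>x. (\<i> * of_real x - of_real s') * \<psi>' x) (s' + 1) t) (at t)"
    by (rule has_vector_derivative_transform_within_open[OF power_integral_derivative[OF *(1)], of _ "{0<..}"])
       (use * t in auto)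
  then show "(?D ^^ k) (power_integral \<psi> s) differentiable at t"
    by (rule differentiableI_vector)
qed

text \<open>Needed because the density is a power integral only for \<open>t > 0\<close>; on an open
  set, equality passes to all iterated derivatives.\<close>

lemma C_infinity_on_cong:
  assumes S: "open S" and eq: "\<And>t. t \<in> S \<Longrightarrow> f t = g t" and g: "C_infinity_on S g"
  shows "C_infinity_on S f"
proof -
  let ?D = "\<lambda>g t. vector_derivative g (at t)"
  have it: "(?D ^^ k) f t = (?D ^^ k) g t" if "t \<in> S" for k t
    using that
  proof (induction k arbitrary: t)
    case (Suc k)
    have "eventually (\<lambda>x. (?D ^^ k) f x = (?D ^^ k) g x) (nhds t)"
      using Suc S eventually_nhds by blast
    then have "vector_derivative ((?D ^^ k) f) (at t) = vector_derivative ((?D ^^ k) g) (at t)"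
      by (intro vector_derivative_cong_eq) auto
    then show ?case by simp
  qed (use eq in simp)
  show ?thesis
    unfolding C_infinity_on_def
  proof (intro allI ballI)
    fix k t assume t: "t \<in> S"
    then have "(?D ^^ k) g differentiable at t" using g by (simp add: C_infinity_on_def)
    then obtain D where "((?D ^^ k) g has_derivative D) (at t)" by (auto simp: differentiable_def)
    then have "((?D ^^ k) f has_derivative D) (at t)"
      by (rule has_derivative_transform_within_open[OF _ S t]) (simp add: it)
    then show "(?D ^^ k) f differentiable at t" by (auto simp: differentiable_def)
  qed
qed

section \<open>Fourier inversion\<close>

text \<open>Levy's inversion formula needs end points without mass. A law has countably many atoms,
  so such points lie in every interval.\<close>

lemma (in real_distribution) ex_null_singleton:
  assumes "u < v"
  shows "\<exists>x\<in>{u<..<v}. measure M {x} = 0"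
proof (rule ccontr)
  assume "\<not> ?thesis"
  then have "{u<..<v} \<subseteq> {x. measure M {x} > 0}"
    by (force simp: less_le)
  then have "countable {u<..<v}"
    using finite_borel_measure.countable_atoms[OF finite_borel_measure_M] countable_subset by blast
  then show False using uncountable_open_interval assms by blast
qed

text \<open>For \<open>t \<noteq> 0\<close> the kernel is the integral of
  \<open>iexp (-(t * x))\<close> over \<open>x\<close> from \<open>u\<close> to \<open>v\<close>,
  hence bounded by the length; at \<open>t = 0\<close> the quotient is 0 by convention.\<close>

lemma inversion_kernel_bound:
  "norm ((iexp (-(t * u)) - iexp (-(t * v))) / (\<i> * of_real t)) \<le> \<bar>v - u\<bar>"
proof (cases "t = 0")
  case False
  have "norm ((iexp (t * (-u)) - iexp (t * (-v))) / (\<i> * t)) \<le> v - u" if "u \<le> v" for u v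
    using Levy_Inversion_aux2[of "-v" "-u" t] that False by simp
  from this[of u v] this[of v u] show ?thesis
    by (cases "u \<le> v") (auto simp: norm_divide norm_minus_commute)
qed simp

lemma (in real_distribution) integrable_inversion_kernel:
  assumes "integrable lborel (char M)"
  shows "integrable lborel (\<lambda>t. (iexp (-(t * u)) - iexp (-(t * v))) / (\<i> * of_real t) * char M t)"
proof (rule Bochner_Integration.integrable_bound[OF integrable_mult_right[OF integrable_norm[OF assms], of "\<bar>v - u\<bar>"]])
  show "AE t in lborel. norm ((iexp (-(t * u)) - iexp (-(t * v))) / (\<i> * of_real t) * char M t) \<le> norm (\<bar>v - u\<bar> * norm (char M t))"
    unfolding norm_mult abs_mult real_norm_def abs_norm_cancel abs_idempotent
    by (intro AE_I2 mult_right_mono inversion_kernel_bound norm_ge_zero)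
qed measurable

text \<open>For an integrable characteristic function, the truncated integrals of Levy's formula
  converge to the full one by dominated convergence.\<close>

lemma (in real_distribution) measure_Ioc_inversion:
  assumes int: "integrable lborel (char M)" and ab: "a \<le> b" "measure M {a} = 0" "measure M {b} = 0"
  shows "complex_of_real (measure M {a<..b}) =
    1 / (2 * pi) * (\<integral>t. (iexp (-(t * a)) - iexp (-(t * b))) / (\<i> * of_real t) * char M t \<partial>lborel)"
proof -
  let ?g = "\<lambda>t. (iexp (-(t * a)) - iexp (-(t * b))) / (\<i> * of_real t) * char M t"
  have "(\<lambda>T::nat. \<integral>t. indicator {-real T<..<real T} t *\<^sub>R ?g t \<partial>lborel) \<longlonglongrightarrow> (\<integral>t. ?g t \<partial>lborel)"
  proof (rule integral_dominated_convergence[where w = "\<lambda>t. norm (?g t)"])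
    show "AE t in lborel. (\<lambda>T. indicator {-real T<..<real T} t *\<^sub>R ?g t) \<longlonglongrightarrow> ?g t"
    proof (rule AE_I2, rule tendsto_eventually)
      fix t
      show "\<forall>\<^sub>F T in sequentially. indicator {-real T<..<real T} t *\<^sub>R ?g t = ?g t"
        using eventually_gt_at_top[of "nat \<lceil>\<bar>t\<bar>\<rceil>"]
      proof eventually_elim
        case (elim T)
        then have "\<bar>t\<bar> < real T" by linarith
        then have "t \<in> {-real T<..<real T}" by auto
        then show ?case by (simp only: indicator_simps scaleR_one)
      qed
    qed
    show "integrable lborel (\<lambda>t. norm (?g t))"
      by (rule integrable_norm[OF integrable_inversion_kernel[OF int]])
  qed (auto simp: indicator_def)
  then have "(\<lambda>T::nat. 1 / (2 * pi) * (\<integral>t. indicator {-real T<..<real T} t *\<^sub>R ?g t \<partial>lborel)) \<longlonglongrightarrow> 1 / (2 * pi) * (\<integral>t. ?g t \<partial>lborel)"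
    by (intro tendsto_intros)
  moreover have "(\<lambda>T::nat. 1 / (2 * pi) * (\<integral>t. indicator {-real T<..<real T} t *\<^sub>R ?g t \<partial>lborel)) \<longlonglongrightarrow> measure M {a<..b}"
    using Levy_Inversion[OF ab] by (simp add: interval_lebesgue_integral_def set_lebesgue_integral_def)
  ultimately show ?thesis
    by (rule LIMSEQ_unique[symmetric])
qed

text \<open>The inversion formula bounds the mass of \<open>{a<..b}\<close> by
  \<open>K * (b - a)\<close>, so an atom would violate it on a short interval around the
  point.\<close>

lemma (in real_distribution) measure_singleton_eq_0:
  assumes int: "integrable lborel (char M)"
  shows "measure M {y} = 0"
proof (rule ccontr)
  define m where "m = measure M {y}"
  define K where "K = 1 / (2 * pi) * (\<integral>t. norm (char M t) \<partial>lborel)"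
  \<comment> \<open>The interval has length at most \<open>2 * \<epsilon>\<close>, and
    \<open>K * (2 * \<epsilon>) < m\<close>; the summand 1 keeps the denominator positive when
    \<open>K = 0\<close>.\<close>
  define \<epsilon> where "\<epsilon> = m / (4 * (K + 1))"
  assume "measure M {y} \<noteq> 0"
  then have m: "m > 0" by (simp add: m_def zero_less_measure_iff)
  have K: "K \<ge> 0" by (simp add: K_def)
  have \<epsilon>: "\<epsilon> > 0" using m K by (simp add: \<epsilon>_def)
  obtain a b where a: "a \<in> {y - \<epsilon><..<y}" "measure M {a} = 0" and b: "b \<in> {y<..<y + \<epsilon>}" "measure M {b} = 0"
    using ex_null_singleton[of "y - \<epsilon>" y] ex_null_singleton[of y "y + \<epsilon>"] \<epsilon> by auto
  have "m \<le> measure M {a<..b}"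
    unfolding m_def by (rule finite_measure_mono) (use a b in auto)
  also have "\<dots> = norm (complex_of_real (measure M {a<..b}))" by simp
  also have "\<dots> = 1 / (2 * pi) * norm (\<integral>t. (iexp (-(t * a)) - iexp (-(t * b))) / (\<i> * of_real t) * char M t \<partial>lborel)"
    by (subst measure_Ioc_inversion[OF int]) (use a b in \<open>auto simp: norm_mult norm_divide\<close>)
  also have "\<dots> \<le> 1 / (2 * pi) * (\<integral>t. (b - a) * norm (char M t) \<partial>lborel)"
  proof (intro mult_left_mono Bochner_Integration.integral_norm_bound_integral)
    fix t
    show "norm ((iexp (-(t * a)) - iexp (-(t * b))) / (\<i> * of_real t) * char M t) \<le> (b - a) * norm (char M t)"
      unfolding norm_mult using inversion_kernel_bound[of t a b] a b by (intro mult_right_mono) auto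
  qed (use int integrable_inversion_kernel[OF int] in auto)
  also have "\<dots> = K * (b - a)" by (simp add: K_def)
  also have "\<dots> \<le> K * (2 * \<epsilon>)" using a b K by (intro mult_left_mono) auto
  also have "\<dots> < m"
  proof -
    have "K * (2 * \<epsilon>) = m * (K / (2 * (K + 1)))" using K by (simp add: \<epsilon>_def field_simps)
    moreover have "K / (2 * (K + 1)) < 1" using K by simp
    then have "m * (K / (2 * (K + 1))) < m * 1" using m by (rule mult_strict_left_mono)
    ultimately show ?thesis by (simp only: mult_1_right)
  qed
  finally show False by simp
qed

text \<open>Without atoms the formula holds for all end points, and by antisymmetry in either order,
  as two-sided difference quotients require.\<close>

lemma (in real_distribution) cdf_diff_inversion:
  assumes int: "integrable lborel (char M)"
  shows "complex_of_real (cdf M v - cdf M u) =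
    1 / (2 * pi) * (\<integral>t. (iexp (-(t * u)) - iexp (-(t * v))) / (\<i> * of_real t) * char M t \<partial>lborel)"
proof -
  have *: "complex_of_real (cdf M v - cdf M u) =
    1 / (2 * pi) * (\<integral>t. (iexp (-(t * u)) - iexp (-(t * v))) / (\<i> * of_real t) * char M t \<partial>lborel)"
    if "u \<le> v" for u v
  proof -
    have "cdf M v - cdf M u = measure M {u<..v}"
      using finite_borel_measure.cdf_diff_eq[OF finite_borel_measure_M] that by (cases "u = v") auto
    then show ?thesis
      using measure_Ioc_inversion[OF int that] measure_singleton_eq_0[OF int] by simp
  qed
  show ?thesis
  proof (cases "u \<le> v")
    case False
    have "(\<integral>t. (iexp (-(t * u)) - iexp (-(t * v))) / (\<i> * of_real t) * char M t \<partial>lborel) =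
       (\<integral>t. - ((iexp (-(t * v)) - iexp (-(t * u))) / (\<i> * of_real t) * char M t) \<partial>lborel)"
      by (intro Bochner_Integration.integral_cong refl) (simp add: diff_divide_distrib left_diff_distrib)
    then show ?thesis
      using *[of v u] False by (simp only: integral_minus) (simp add: algebra_simps)
  qed (rule *)
qed

text \<open>The kernel between \<open>y\<close> and \<open>y + h\<close> differs from
  \<open>h * iexp (-(t * y))\<close> by at most \<open>h\<^sup>2 * \<bar>t\<bar>\<close>, so a
  finite first moment of \<open>char M\<close> gives the derivative. Being a limit of nonnegative
  quotients, it is real and nonnegative.\<close>

lemma (in real_distribution) cdf_derivative:
  assumes int: "integrable lborel (char M)" and int1: "integrable lborel (\<lambda>t. \<bar>t\<bar> * norm (char M t))"
  defines "f \<equiv> \<lambda>y. 1 / (2 * pi) * (\<integral>t. iexp (-(t * y)) * char M t \<partial>lborel)"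
  shows "(cdf M has_real_derivative Re (f y)) (at y)" and "f y \<in> \<real>\<^sub>\<ge>\<^sub>0"
proof -
  define C where "C = 1 / (2 * pi) * (\<integral>t. \<bar>t\<bar> * norm (char M t) \<partial>lborel)"
  have i0: "integrable lborel (\<lambda>t. iexp (-(t * y)) * char M t)"
    by (rule Bochner_Integration.integrable_bound[OF int]) (auto simp: norm_mult)
  have bound: "norm (complex_of_real ((cdf M (y + h) - cdf M y) / h) - f y) \<le> C * \<bar>h\<bar>" if h: "h \<noteq> 0" for h
  proof -
    let ?k = "\<lambda>t. (iexp (-(t * y)) - iexp (-(t * (y + h)))) / (\<i> * of_real t)"
    let ?R = "\<lambda>t. ?k t * char M t - of_real h * (iexp (-(t * y)) * char M t)"
    have R: "norm (?R t) \<le> h\<^sup>2 * (\<bar>t\<bar> * norm (char M t))" if "t \<noteq> 0" for t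
    proof -
      have e: "iexp (-(t * (y + h))) = iexp (-(t * y)) * iexp (-(t * h))"
        by (simp add: exp_add[symmetric] algebra_simps)
      have "?k t - of_real h * iexp (-(t * y)) =
          - (iexp (-(t * y)) * (iexp (-(t * h)) - (\<Sum>k\<le>1. (\<i> * of_real (-(t * h))) ^ k / fact k)) / (\<i> * of_real t))"
        unfolding e using that by (simp add: field_simps)
      then have "norm (?k t - of_real h * iexp (-(t * y))) =
          norm (iexp (-(t * h)) - (\<Sum>k\<le>1. (\<i> * of_real (-(t * h))) ^ k / fact k)) / \<bar>t\<bar>"
        by (simp only: norm_minus_cancel norm_divide norm_mult) simp
      also have "\<dots> \<le> (\<bar>-(t * h)\<bar> ^ Suc 1 / fact (Suc 1)) / \<bar>t\<bar>"
        by (intro divide_right_mono iexp_approx1) auto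
      also have "\<dots> = h\<^sup>2 * \<bar>t\<bar> / 2"
        using that by (simp add: power2_eq_square abs_mult)
      also have "\<dots> \<le> h\<^sup>2 * \<bar>t\<bar>" by simp
      finally have "norm ((?k t - of_real h * iexp (-(t * y))) * char M t) \<le> h\<^sup>2 * \<bar>t\<bar> * norm (char M t)"
        unfolding norm_mult by (intro mult_right_mono) auto
      then show ?thesis by (simp add: left_diff_distrib mult.assoc)
    qed
    define R where "R t = ?R t" for t
    have iR: "integrable lborel R"
      unfolding R_def
      using integrable_inversion_kernel[OF int, of y "y + h"] integrable_mult_right[OF i0, of "of_real h"]
      by (rule Bochner_Integration.integrable_diff)
    \<comment> \<open>At \<open>t = 0\<close> the kernel is 0 by convention and the bound fails for
      \<open>h \<noteq> 0\<close>, hence only an almost everywhere statement.\<close>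
    have AE: "AE t in lborel. norm (R t) \<le> h\<^sup>2 * (\<bar>t\<bar> * norm (char M t))"
      unfolding R_def using AE_lborel_singleton[of 0] by eventually_elim (rule R)
    have "norm (\<integral>t. R t \<partial>lborel) \<le> (\<integral>t. norm (R t) \<partial>lborel)"
      by (rule integral_norm_bound)
    also have "\<dots> \<le> (\<integral>t. h\<^sup>2 * (\<bar>t\<bar> * norm (char M t)) \<partial>lborel)"
      by (rule integral_mono_AE[OF integrable_norm[OF iR] integrable_mult_right[OF int1] AE])
    finally have le: "norm (\<integral>t. R t \<partial>lborel) \<le> (\<integral>t. h\<^sup>2 * (\<bar>t\<bar> * norm (char M t)) \<partial>lborel)" .
    have "of_real (cdf M (y + h) - cdf M y) - of_real h * f y = 1 / (2 * pi) * (\<integral>t. R t \<partial>lborel)"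
      unfolding cdf_diff_inversion[OF int] f_def R_def
      using i0 integrable_inversion_kernel[OF int, of y "y + h"] by (simp add: right_diff_distrib)
    also have "norm \<dots> = 1 / (2 * pi) * norm (\<integral>t. R t \<partial>lborel)"
      by (simp add: norm_mult norm_divide)
    also have "\<dots> \<le> 1 / (2 * pi) * (\<integral>t. h\<^sup>2 * (\<bar>t\<bar> * norm (char M t)) \<partial>lborel)"
      by (rule mult_left_mono[OF le]) simp
    also have "\<dots> = C * h\<^sup>2" by (simp add: C_def)
    finally have b: "norm (of_real (cdf M (y + h) - cdf M y) - of_real h * f y) \<le> C * h\<^sup>2" .
    have "complex_of_real ((cdf M (y + h) - cdf M y) / h) - f y = (of_real (cdf M (y + h) - cdf M y) - of_real h * f y) / of_real h"
      using h by (simp add: diff_divide_distrib)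
    then have "norm (complex_of_real ((cdf M (y + h) - cdf M y) / h) - f y) = norm (of_real (cdf M (y + h) - cdf M y) - of_real h * f y) / \<bar>h\<bar>"
      by (simp only: norm_divide norm_of_real)
    also have "\<dots> \<le> C * h\<^sup>2 / \<bar>h\<bar>" by (intro divide_right_mono b) auto
    also have "\<dots> = C * \<bar>h\<bar>" using h by (simp add: power2_eq_square field_simps)
    finally show ?thesis .
  qed
  have "((\<lambda>h. complex_of_real ((cdf M (y + h) - cdf M y) / h) - f y) \<longlongrightarrow> 0) (at 0)"
  proof (rule Lim_null_comparison)
    show "\<forall>\<^sub>F h in at 0. norm (complex_of_real ((cdf M (y + h) - cdf M y) / h) - f y) \<le> C * \<bar>h\<bar>"
      using bound by (auto simp: eventually_at_filter)
    show "((\<lambda>h. C * \<bar>h\<bar>) \<longlongrightarrow> 0) (at 0)"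
      by (auto intro!: tendsto_eq_intros)
  qed
  then have lim: "((\<lambda>h. complex_of_real ((cdf M (y + h) - cdf M y) / h)) \<longlongrightarrow> f y) (at 0)"
    by (rule LIM_zero_cancel)
  then have "((\<lambda>h. (cdf M (y + h) - cdf M y) / h) \<longlongrightarrow> Re (f y)) (at 0)"
    using tendsto_Re by fastforce
  then show "(cdf M has_real_derivative Re (f y)) (at y)"
    by (simp add: DERIV_def)
  have "(cdf M (y + h) - cdf M y) / h \<ge> 0" for h
    using finite_borel_measure.cdf_nondecreasing[OF finite_borel_measure_M, of y "y + h"]
      finite_borel_measure.cdf_nondecreasing[OF finite_borel_measure_M, of "y + h" y]
    by (cases "h \<ge> 0") (auto intro: divide_nonneg_nonneg divide_nonpos_nonpos)
  then have "\<forall>\<^sub>F h in at 0. complex_of_real ((cdf M (y + h) - cdf M y) / h) \<in> \<real>\<^sub>\<ge>\<^sub>0"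
    by (simp only: nonneg_Reals_of_real_iff eventually_True)
  then show "f y \<in> \<real>\<^sub>\<ge>\<^sub>0"
    by (rule Lim_in_closed_set[OF closed_nonneg_Reals_complex _ _ lim]) simp
qed

text \<open>Substituting \<open>ln t\<close> into the density of \<open>M\<close> produces the
  exponent 1 from \<open>1 / t\<close>; reflecting the integration variable turns
  \<open>iexp (-(x * ln t))\<close> into a positive imaginary power of \<open>t\<close>.\<close>

lemma (in real_distribution) exp_density:
  assumes \<psi>: "all_moments (\<lambda>x. char M (- x))"
  defines "E \<equiv> \<lambda>t. 1 / (2 * pi) * power_integral (\<lambda>x. char M (- x)) 1 t"
  shows "\<And>t. t > 0 \<Longrightarrow> E t \<in> \<real>\<^sub>\<ge>\<^sub>0"
    and "distr M (restrict_space borel {0<..}) exp = density (restrict_space lborel {0<..}) (\<lambda>t. ennreal (Re (E t)))"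
    and "has_bochner_integral (restrict_space lborel {0<..}) E 1"
proof -
  have int: "integrable lborel (char M)"
  proof -
    have "integrable lborel (\<lambda>x. char M (- x))"
      by (rule all_moments_integrable_bound[OF \<psi>, of _ 0]) auto
    from lborel_integrable_real_affine[OF this, of "-1" 0] show ?thesis by simp
  qed
  have int1: "integrable lborel (\<lambda>t. \<bar>t\<bar> * norm (char M t))"
  proof -
    have "integrable lborel (\<lambda>x. \<bar>x\<bar> ^ 1 * norm (char M (- x)))"
      using \<psi> unfolding all_moments_def by blast
    from lborel_integrable_real_affine[OF this, of "-1" 0] show ?thesis by simp
  qed
  define f where "f = (\<lambda>y. 1 / (2 * pi) * (\<integral>t. iexp (-(t * y)) * char M t \<partial>lborel))"
  have cdf: "(cdf M has_real_derivative Re (f y)) (at y)" "f y \<in> \<real>\<^sub>\<ge>\<^sub>0" for y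
    unfolding f_def by (rule cdf_derivative[OF int int1])+
  have E: "E t = f (ln t) / of_real t" if t: "t > 0" for t
  proof -
    have "(\<integral>x. char M (- x) * iexp (x * ln t) \<partial>lborel) = (\<integral>x. iexp (-(x * ln t)) * char M x \<partial>lborel)"
      by (subst lborel_integral_real_affine[where c = "-1" and t = 0]) (auto simp: mult.commute)
    moreover have "exp (- complex_of_real (1 * ln t)) = 1 / of_real t"
    proof -
      have "exp (- complex_of_real (1 * ln t)) = of_real (exp (- ln t))"
        by (metis exp_of_real mult_1 of_real_minus)
      also have "exp (- ln t) = 1 / t" using t by (simp add: exp_minus inverse_eq_divide)
      finally show ?thesis by simp
    qed
    ultimately show ?thesis
      unfolding E_def f_def power_integral_eq by simp
  qed
  show nonneg: "E t \<in> \<real>\<^sub>\<ge>\<^sub>0" if "t > 0" for t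
    using cdf(2)[of "ln t"] that unfolding E[OF that] by (intro nonneg_Reals_divide_I) auto
  have Emeas [measurable]: "E \<in> borel_measurable borel"
    unfolding E_def power_integral_eq by measurable
  have FTC: "(\<integral>\<^sup>+t. ennreal (Re (E t)) * indicator {exp u..exp v} t \<partial>lborel) = ennreal (cdf M v - cdf M u)" if "u \<le> v" for u v
  proof -
    have "((\<lambda>t. cdf M (ln t)) has_real_derivative Re (E t)) (at t)" if "t \<in> {exp u..exp v}" for t
    proof -
      have t: "t > 0" using that by (auto intro: less_le_trans[OF exp_gt_zero])
      have "((\<lambda>t. cdf M (ln t)) has_real_derivative Re (f (ln t)) * (1 / t)) (at t)"
        by (rule DERIV_chain2[OF cdf(1)]) (use t in \<open>auto intro!: derivative_eq_intros\<close>)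
      then show ?thesis by (simp add: E[OF t])
    qed
    moreover have "0 \<le> Re (E t)" if "t \<in> {exp u..exp v}" for t
    proof -
      have "t > 0" using that by (auto intro: less_le_trans[OF exp_gt_zero])
      then show ?thesis using nonneg[of t] by (auto simp: complex_nonneg_Reals_iff)
    qed
    ultimately show ?thesis
      using nn_integral_FTC_Icc[of "\<lambda>t. Re (E t)" "exp u" "exp v" "\<lambda>t. cdf M (ln t)"] that by simp
  qed
  define D where "D = density (restrict_space lborel {0<..}) (\<lambda>t. ennreal (Re (E t)))"
  have setsD: "sets D = sets (restrict_space borel {0<..})" and spaceD: "space D = {0<..}"
    unfolding D_def by (auto simp: sets_restrict_space space_restrict_space)
  have lnD: "ln \<in> borel_measurable D"
    unfolding measurable_cong_sets[OF setsD refl] by (rule measurable_restrict_space1) measurable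
  \<comment> \<open>Half-open intervals determine the law. The fundamental theorem of calculus
    yields closed ones, which differ from their preimages by the null set
    \<open>{exp u}\<close>.\<close>
  have "M = distr D borel ln"
  proof (rule measure_eqI_generator_eq[where \<Omega> = UNIV and E = "range (\<lambda>(a, b). {a<..b::real})" and A = "\<lambda>i. {- real i<..real i}"])
    fix X assume "X \<in> range (\<lambda>(a, b). {a<..b::real})"
    then obtain u v where X: "X = {u<..v}" by auto
    show "emeasure M X = emeasure (distr D borel ln) X"
    proof (cases "u \<le> v")
      case True
      have "emeasure (distr D borel ln) X = emeasure D {exp u<..exp v}"
        using lnD unfolding X
      proof (subst emeasure_distr)
        have "ln -` {u<..v} \<inter> space D = {exp u<..exp v}"
        proof -
          have "(u < ln t \<longleftrightarrow> exp u < t) \<and> (ln t \<le> v \<longleftrightarrow> t \<le> exp v)" if "t > 0" for t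
            using that by (metis exp_less_cancel_iff exp_le_cancel_iff exp_ln)
          then have "t \<in> ln -` {u<..v} \<inter> {0<..} \<longleftrightarrow> t \<in> {exp u<..exp v}" for t
            using less_trans[OF exp_gt_zero, of u t] by (cases "t > 0") auto
          then show ?thesis unfolding spaceD by blast
        qed
        then show "emeasure D (ln -` {u<..v} \<inter> space D) = emeasure D {exp u<..exp v}" by simp
      qed auto
      also have "\<dots> = (\<integral>\<^sup>+t. ennreal (Re (E t)) * indicator {exp u<..exp v} t \<partial>restrict_space lborel {0<..})"
        unfolding D_def by (rule emeasure_density) (auto intro!: measurable_restrict_space1 sets_restrict_space_iff[THEN iffD2] intro: less_trans[OF exp_gt_zero])
      also have "\<dots> = (\<integral>\<^sup>+t. ennreal (Re (E t)) * indicator {exp u<..exp v} t * indicator {0<..} t \<partial>lborel)"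
        by (rule nn_integral_restrict_space) simp
      also have "\<dots> = (\<integral>\<^sup>+t. ennreal (Re (E t)) * indicator {exp u..exp v} t \<partial>lborel)"
      proof (rule nn_integral_cong_AE, use AE_lborel_singleton[of "exp u"] in eventually_elim)
        case (elim t)
        have "0 < t" if "exp u \<le> t" using exp_gt_zero[of u] that by (rule less_le_trans)
        then show ?case using elim by (auto simp: indicator_def)
      qed
      also have "\<dots> = ennreal (cdf M v - cdf M u)"
        by (rule FTC[OF True])
      also have "\<dots> = emeasure M X"
        unfolding X using finite_borel_measure.emeasure_Ioc[OF finite_borel_measure_M True] by simp
      finally show ?thesis by simp
    qed (simp add: X)
  next
    show "(\<Union>i. {- real (i::nat)<..real i}) = UNIV" by (rule UN_Ioc_eq_UNIV)
  qed (auto simp: borel_sigma_sets_Ioc Int_stable_def)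
  then have "distr M (restrict_space borel {0<..}) exp = distr (distr D borel ln) (restrict_space borel {0<..}) exp"
    by simp
  also have "\<dots> = distr D (restrict_space borel {0<..}) (exp \<circ> ln)"
    by (rule distr_distr[OF _ lnD]) (auto intro!: measurable_restrict_space2)
  also have "\<dots> = distr D D (\<lambda>t. t)"
    by (rule distr_cong) (auto simp: setsD spaceD)
  also have "\<dots> = D"
    by (rule distr_id)
  finally show D: "distr M (restrict_space borel {0<..}) exp = density (restrict_space lborel {0<..}) (\<lambda>t. ennreal (Re (E t)))"
    unfolding D_def .
  have "has_bochner_integral (restrict_space lborel {0<..}) (\<lambda>t. Re (E t)) 1"
  proof (rule has_bochner_integral_nn_integral)
    show "(\<lambda>t. Re (E t)) \<in> borel_measurable (restrict_space lborel {0<..})"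
      by (rule measurable_restrict_space1) auto
    show "AE t in restrict_space lborel {0<..}. 0 \<le> Re (E t)"
      using nonneg by (intro AE_I2) (auto simp: space_restrict_space complex_nonneg_Reals_iff)
    have "prob_space D"
      unfolding D_def D[symmetric] by (rule prob_space_distr) (auto intro!: measurable_restrict_space2)
    then have "emeasure D (space D) = 1" by (rule prob_space.emeasure_space_1)
    moreover have "emeasure D (space D) = (\<integral>\<^sup>+t. ennreal (Re (E t)) * indicator (space (restrict_space lborel {0<..})) t \<partial>restrict_space lborel {0<..})"
      unfolding D_def space_density
      by (rule emeasure_density[OF _ sets.top], rule measurable_restrict_space1) measurable
    moreover have "\<dots> = (\<integral>\<^sup>+t. ennreal (Re (E t)) \<partial>restrict_space lborel {0<..})"
      by (rule nn_integral_cong) (simp only: indicator_simps mult_1_right)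
    ultimately show "(\<integral>\<^sup>+t. ennreal (Re (E t)) \<partial>restrict_space lborel {0<..}) = ennreal 1" by simp
  qed simp
  then have "has_bochner_integral (restrict_space lborel {0<..}) (\<lambda>t. complex_of_real (Re (E t))) (complex_of_real 1)"
    by (rule has_bochner_integral_of_real)
  then show "has_bochner_integral (restrict_space lborel {0<..}) E 1"
  proof (rule has_bochner_integral_cong[THEN iffD1, rotated -1])
    fix t :: real assume "t \<in> space (restrict_space lborel {0<..})"
    then show "complex_of_real (Re (E t)) = E t"
      using nonneg[of t] by (auto simp: space_restrict_space complex_nonneg_Reals_iff complex_eq_iff)
  qed auto
qed

section \<open>Determinacy\<close>

lemma power_le_fact_exp:
  fixes y :: real
  assumes "y \<ge> 0"
  shows "y ^ k \<le> fact k * exp y"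
proof -
  have "(\<Sum>i\<in>{k}. y ^ i /\<^sub>R fact i) \<le> (\<Sum>i. y ^ i /\<^sub>R fact i)"
    using assms by (intro sum_le_suminf summable_exp_generic) auto
  then show ?thesis by (simp add: exp_def field_simps)
qed

text \<open>The rate is a parameter so that two laws can be expanded with a common radius.\<close>

locale exponential_moment = real_distribution M for M :: "real measure" +
  fixes \<delta> :: real
  assumes \<delta>: "\<delta> > 0" and integrable_exp_abs: "integrable M (\<lambda>x. exp (\<delta> * \<bar>x\<bar>))"
begin

text \<open>Half of the exponential rate is spent on the polynomial factor, the other half is
  kept.\<close>

lemma power_exp_bound: "\<bar>x\<bar> ^ k * exp (\<delta> / 2 * \<bar>x\<bar>) \<le> fact k * (2 / \<delta>) ^ k * exp (\<delta> * \<bar>x\<bar>)"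
proof -
  have "(\<delta> / 2 * \<bar>x\<bar>) ^ k * exp (\<delta> / 2 * \<bar>x\<bar>) \<le> fact k * exp (\<delta> / 2 * \<bar>x\<bar>) * exp (\<delta> / 2 * \<bar>x\<bar>)"
    using \<delta> by (intro mult_right_mono power_le_fact_exp) auto
  also have "\<dots> = fact k * exp (\<delta> * \<bar>x\<bar>)"
    by (simp add: exp_add[symmetric] mult.assoc)
  finally have "(2 / \<delta>) ^ k * ((\<delta> / 2 * \<bar>x\<bar>) ^ k * exp (\<delta> / 2 * \<bar>x\<bar>)) \<le> (2 / \<delta>) ^ k * (fact k * exp (\<delta> * \<bar>x\<bar>))"
    using \<delta> by (intro mult_left_mono) auto
  moreover have "(2 / \<delta>) ^ k * (\<delta> / 2 * \<bar>x\<bar>) ^ k = \<bar>x\<bar> ^ k"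
    using \<delta> by (simp add: power_mult_distrib[symmetric])
  then have "(2 / \<delta>) ^ k * ((\<delta> / 2 * \<bar>x\<bar>) ^ k * exp (\<delta> / 2 * \<bar>x\<bar>)) = \<bar>x\<bar> ^ k * exp (\<delta> / 2 * \<bar>x\<bar>)"
    by (simp only: mult.assoc[symmetric])
  ultimately show ?thesis by (simp only: mult_ac)
qed

lemma integrable_power_exp: "integrable M (\<lambda>x. \<bar>x\<bar> ^ k * exp (\<delta> / 2 * \<bar>x\<bar>))"
  by (rule Bochner_Integration.integrable_bound[OF integrable_mult_right[OF integrable_exp_abs, of "fact k * (2 / \<delta>) ^ k"]])
     (use power_exp_bound \<delta> in auto)

lemma integrable_power_iexp: "integrable M (\<lambda>x. of_real (x ^ k) * iexp (u * x))"
proof (rule Bochner_Integration.integrable_bound[OF integrable_power_exp[of k]])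
  have "\<bar>x\<bar> ^ k \<le> \<bar>x\<bar> ^ k * exp (\<delta> / 2 * \<bar>x\<bar>)" for x
    using \<delta> by (simp add: mult_le_cancel_left1)
  then show "AE x in M. norm (of_real (x ^ k) * iexp (u * x)) \<le> norm (\<bar>x\<bar> ^ k * exp (\<delta> / 2 * \<bar>x\<bar>))"
    by (simp add: norm_mult norm_power)
qed auto

lemma integrable_power: "integrable M (\<lambda>x. x ^ k)"
proof (rule Bochner_Integration.integrable_bound[OF integrable_power_exp[of k]])
  have "\<bar>x\<bar> ^ k \<le> \<bar>x\<bar> ^ k * exp (\<delta> / 2 * \<bar>x\<bar>)" for x
    using \<delta> by (simp add: mult_le_cancel_left1)
  then show "AE x in M. norm (x ^ k) \<le> norm (\<bar>x\<bar> ^ k * exp (\<delta> / 2 * \<bar>x\<bar>))"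
    by (simp add: power_abs)
qed auto

text \<open>Up to a power of \<open>\<i>\<close>, the Taylor series at \<open>u\<close> of the
  \<open>k\<close>-th derivative of the characteristic function. The partial sums are dominated
  through \<open>exp \<bar>h * x\<bar> \<le> exp (\<delta> / 2 * \<bar>x\<bar>)\<close>, uniformly
  in \<open>u\<close>.\<close>

lemma char_derivatives_expansion:
  assumes h: "\<bar>h\<bar> \<le> \<delta> / 2"
  shows "(\<lambda>j. (\<i> * of_real h) ^ j / fact j * (\<integral>x. of_real (x ^ (k + j)) * iexp (u * x) \<partial>M)) sums
           (\<integral>x. of_real (x ^ k) * iexp ((u + h) * x) \<partial>M)"
  unfolding sums_def
proof -
  let ?S = "\<lambda>n x. of_real (x ^ k) * iexp (u * x) * (\<Sum>j<n. (\<i> * of_real (h * x)) ^ j / fact j)"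
  have "(\<lambda>n. \<integral>x. ?S n x \<partial>M) \<longlonglongrightarrow> (\<integral>x. of_real (x ^ k) * iexp ((u + h) * x) \<partial>M)"
  proof (rule integral_dominated_convergence[where w = "\<lambda>x. \<bar>x\<bar> ^ k * exp (\<delta> / 2 * \<bar>x\<bar>)"])
    show "integrable M (\<lambda>x. \<bar>x\<bar> ^ k * exp (\<delta> / 2 * \<bar>x\<bar>))" by (rule integrable_power_exp)
    show "AE x in M. (\<lambda>n. ?S n x) \<longlonglongrightarrow> of_real (x ^ k) * iexp ((u + h) * x)"
    proof (rule AE_I2)
      fix x
      have "(\<lambda>n. \<Sum>j<n. (\<i> * of_real (h * x)) ^ j / fact j) \<longlonglongrightarrow> iexp (h * x)"
        using exp_converges[of "\<i> * complex_of_real (h * x)"]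
        by (simp add: sums_def scaleR_conv_of_real field_simps)
      then have "(\<lambda>n. ?S n x) \<longlonglongrightarrow> of_real (x ^ k) * iexp (u * x) * iexp (h * x)"
        by (intro tendsto_intros)
      also have "of_real (x ^ k) * iexp (u * x) * iexp (h * x) = of_real (x ^ k) * iexp ((u + h) * x)"
        by (simp add: exp_add[symmetric] algebra_simps)
      finally show "(\<lambda>n. ?S n x) \<longlonglongrightarrow> of_real (x ^ k) * iexp ((u + h) * x)" .
    qed
    fix n
    have "norm (?S n x) \<le> \<bar>x\<bar> ^ k * exp (\<delta> / 2 * \<bar>x\<bar>)" for x
    proof -
      have "norm (\<Sum>j<n. (\<i> * complex_of_real (h * x)) ^ j / fact j) \<le> (\<Sum>j<n. \<bar>h * x\<bar> ^ j /\<^sub>R fact j)"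
        by (rule sum_norm_le) (simp add: norm_divide norm_power norm_mult norm_inverse abs_mult divide_inverse mult_ac)
      also have "\<dots> \<le> exp \<bar>h * x\<bar>"
        unfolding exp_def by (intro sum_le_suminf summable_exp_generic) auto
      also have "\<dots> \<le> exp (\<delta> / 2 * \<bar>x\<bar>)"
        using h by (simp add: abs_mult mult_right_mono del: times_divide_eq_left)
      finally show ?thesis
        by (simp add: norm_mult norm_power mult_left_mono)
    qed
    then show "AE x in M. norm (?S n x) \<le> \<bar>x\<bar> ^ k * exp (\<delta> / 2 * \<bar>x\<bar>)" by simp
  qed auto
  moreover have "(\<integral>x. ?S n x \<partial>M) = (\<Sum>j<n. (\<i> * of_real h) ^ j / fact j * (\<integral>x. of_real (x ^ (k + j)) * iexp (u * x) \<partial>M))" for n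
  proof -
    have "(\<integral>x. ?S n x \<partial>M) = (\<integral>x. (\<Sum>j<n. (\<i> * of_real h) ^ j / fact j * (of_real (x ^ (k + j)) * iexp (u * x))) \<partial>M)"
      by (intro Bochner_Integration.integral_cong refl)
         (simp add: sum_distrib_left power_mult_distrib power_add mult_ac)
    also have "\<dots> = (\<Sum>j<n. (\<i> * of_real h) ^ j / fact j * (\<integral>x. of_real (x ^ (k + j)) * iexp (u * x) \<partial>M))"
      by (subst Bochner_Integration.integral_sum) (intro integrable_mult_right integrable_power_iexp, simp only: integral_mult_right_zero)
    finally show ?thesis .
  qed
  ultimately show "(\<lambda>n. \<Sum>j<n. (\<i> * of_real h) ^ j / fact j * (\<integral>x. of_real (x ^ (k + j)) * iexp (u * x) \<partial>M))
      \<longlonglongrightarrow> (\<integral>x. of_real (x ^ k) * iexp ((u + h) * x) \<partial>M)"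
    by simp
qed

end

text \<open>Equality of all derivatives of the two characteristic functions at \<open>u\<close> propagates through the power
  series, whose radius of convergence does not depend on \<open>u\<close>.\<close>

lemma moments_determine_distribution:
  assumes "exponential_moment M \<delta>" "exponential_moment N \<delta>"
    and eq: "\<And>k. (\<integral>x. x ^ k \<partial>M) = (\<integral>x. x ^ k \<partial>N)"
  shows "M = N"
proof -
  interpret M: exponential_moment M \<delta> by fact
  interpret N: exponential_moment N \<delta> by fact
  define P where "P u \<longleftrightarrow> (\<forall>k. (\<integral>x. of_real (x ^ k) * iexp (u * x) \<partial>M) = (\<integral>x. of_real (x ^ k) * iexp (u * x) \<partial>N))" for u
  have P0: "P 0"
    using eq by (simp add: P_def del: of_real_power)
  have step: "P (u + h)" if "P u" "\<bar>h\<bar> \<le> \<delta> / 2" for u h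
    unfolding P_def
  proof
    fix k
    show "(\<integral>x. of_real (x ^ k) * iexp ((u + h) * x) \<partial>M) = (\<integral>x. of_real (x ^ k) * iexp ((u + h) * x) \<partial>N)"
      using M.char_derivatives_expansion[OF that(2), of k u] N.char_derivatives_expansion[OF that(2), of k u] that(1)
      unfolding P_def by (simp add: sums_unique2)
  qed
  have steps: "P (real n * h)" if "\<bar>h\<bar> \<le> \<delta> / 2" for n h
  proof (induction n)
    case (Suc n)
    then have "P (real n * h + h)" by (intro step that)
    then show ?case by (simp add: algebra_simps)
  qed (use P0 in simp)
  have "P u" for u
  proof -
    \<comment> \<open>\<open>u\<close> is reached from 0 in \<open>n\<close> equal steps that do not
      exceed the radius \<open>\<delta> / 2\<close>.\<close>
    obtain n :: nat where n: "\<bar>u\<bar> / (\<delta> / 2) < real n" using reals_Archimedean2 by blast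
    moreover have "0 \<le> \<bar>u\<bar> / (\<delta> / 2)" using M.\<delta> by simp
    ultimately have "real n > 0" by linarith
    then have "\<bar>u / real n\<bar> \<le> \<delta> / 2" using n M.\<delta> by (simp add: field_simps)
    from steps[OF this, of n] show ?thesis using \<open>real n > 0\<close> by simp
  qed
  then have P: "(\<integral>x. of_real (x ^ k) * iexp (u * x) \<partial>M) = (\<integral>x. of_real (x ^ k) * iexp (u * x) \<partial>N)" for u k
    unfolding P_def by blast
  have "char M = char N"
  proof
    fix u
    show "char M u = char N u"
      using P[of 0 u] by (simp only: char_def power_0 of_real_1 mult_1_left)
  qed
  then show ?thesis
    by (intro Levy_uniqueness M.real_distribution_axioms N.real_distribution_axioms)
qed

text \<open>The law of a square root with an independent fair sign. Odd moments vanish, the moment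
  of order \<open>2 n\<close> is that of order \<open>n\<close> of \<open>\<mu>\<close>, and
  squaring recovers \<open>\<mu>\<close>.\<close>

definition symmetric_sqrt :: "real measure \<Rightarrow> real measure" where
  "symmetric_sqrt \<mu> = distr (\<mu> \<Otimes>\<^sub>M uniform_count_measure {-1, 1}) borel (\<lambda>(t, e). e * sqrt t)"

text \<open>The series is the integral of \<open>cosh (\<delta> * sqrt t)\<close> taken term by
  term. It involves only the moments, so all solutions of one moment problem share
  \<open>\<delta>\<close>; \<open>s 0 = 1\<close> makes them probability measures.\<close>

locale Stieltjes_exponential =
  fixes \<mu> :: "real measure" and s :: "nat \<Rightarrow> real" and \<delta> :: real
  assumes borel: "borel_measure_on {0..} \<mu>" and moments: "has_moments \<mu> s" and s0: "s 0 = 1"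
    and \<delta>: "\<delta> > 0" and summable: "summable (\<lambda>n. \<delta> ^ (2 * n) * s n / fact (2 * n))"
begin

lemma sets_eq: "sets \<mu> = sets (restrict_space borel {0..})"
  using borel by (simp add: borel_measure_on_def)

lemma space_eq: "space \<mu> = {0..}"
  using sets_eq_imp_space_eq[OF sets_eq] by (simp add: space_restrict_space)

lemma borel_measurable_mu: "f \<in> borel_measurable borel \<Longrightarrow> f \<in> borel_measurable \<mu>"
  by (simp add: measurable_cong_sets[OF sets_eq refl] measurable_restrict_space1)

lemma moment: "integrable \<mu> (\<lambda>t. t ^ n)" "(\<integral>t. t ^ n \<partial>\<mu>) = s n"
  using moments by (auto simp: has_moments_def has_bochner_integral_iff)

sublocale prob_space \<mu>
proof
  have "integrable \<mu> (\<lambda>_. 1 :: real)" "(\<integral>t. (1 :: real) \<partial>\<mu>) = 1"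
    using moment[of 0] s0 by auto
  then have "(\<integral>\<^sup>+t. ennreal 1 \<partial>\<mu>) = ennreal 1"
    by (subst nn_integral_eq_integral) auto
  then show "emeasure \<mu> (space \<mu>) = 1" by simp
qed

abbreviation signs :: "real measure" where "signs \<equiv> uniform_count_measure {-1, 1}"

sublocale signs: prob_space signs
  by (rule prob_space_uniform_count_measure) auto

sublocale pair_prob_space \<mu> signs ..

lemma measurable_signs: "f \<in> borel_measurable signs"
  by (simp add: measurable_cong_sets[OF sets_uniform_count_measure_count_space refl])

lemma space_signs [simp]: "space signs = {-1, 1}"
  by (rule space_uniform_count_measure)

lemma borel_measurable_fst: "f \<in> borel_measurable borel \<Longrightarrow> (\<lambda>x. f (fst x)) \<in> borel_measurable (\<mu> \<Otimes>\<^sub>M signs)"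
  by (rule measurable_compose[OF measurable_fst borel_measurable_mu])

lemma measurable_signed_sqrt: "(\<lambda>(t, e). e * sqrt t) \<in> borel_measurable (\<mu> \<Otimes>\<^sub>M signs)"
proof -
  have "(\<lambda>x. snd x) \<in> borel_measurable (\<mu> \<Otimes>\<^sub>M signs)"
    by (rule measurable_compose[OF measurable_snd measurable_signs])
  moreover have "(\<lambda>x. sqrt (fst x)) \<in> borel_measurable (\<mu> \<Otimes>\<^sub>M signs)"
    by (rule borel_measurable_fst) measurable
  ultimately show ?thesis by (simp add: case_prod_beta borel_measurable_times)
qed

text \<open>\<open>exp y \<le> 2 * cosh y\<close>, and the even powers in the series of
  \<open>cosh\<close> turn \<open>sqrt t\<close> into integer powers of \<open>t\<close>.\<close>

lemma exp_sqrt_finite: "(\<integral>\<^sup>+t. ennreal (exp (\<delta> * sqrt t)) \<partial>\<mu>) < \<infinity>"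
proof -
  have cosh: "(\<lambda>n. \<delta> ^ (2 * n) * t ^ n / fact (2 * n)) sums cosh (\<delta> * sqrt t)" if "t \<ge> 0" for t
  proof -
    have "(\<lambda>n. (\<lambda>n. if even n then (\<delta> * sqrt t) ^ n /\<^sub>R fact n else 0) (2 * n)) sums cosh (\<delta> * sqrt t)"
      by (subst sums_mono_reindex) (use cosh_converges[of "\<delta> * sqrt t"] in \<open>auto simp: strict_mono_def elim!: evenE\<close>)
    moreover have "(\<delta> * sqrt t) ^ (2 * n) /\<^sub>R fact (2 * n) = \<delta> ^ (2 * n) * t ^ n / fact (2 * n)" for n
    proof -
      have "sqrt t ^ (2 * n) = t ^ n" using that by (simp add: power_mult)
      then show ?thesis by (simp add: power_mult_distrib divide_inverse mult.commute)
    qed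
    ultimately show ?thesis
      by (simp only: dvd_triv_left if_True)
  qed
  have "(\<integral>\<^sup>+t. ennreal (exp (\<delta> * sqrt t)) \<partial>\<mu>) \<le> (\<integral>\<^sup>+t. 2 * (\<Sum>n. ennreal (\<delta> ^ (2 * n) * t ^ n / fact (2 * n))) \<partial>\<mu>)"
  proof (rule nn_integral_mono)
    fix t assume "t \<in> space \<mu>"
    then have t: "t \<ge> 0" by (simp add: space_eq)
    have "ennreal (exp (\<delta> * sqrt t)) \<le> ennreal (2 * cosh (\<delta> * sqrt t))"
      by (intro ennreal_leI) (simp add: cosh_def)
    also have "\<dots> = 2 * (\<Sum>n. ennreal (\<delta> ^ (2 * n) * t ^ n / fact (2 * n)))"
      using t \<delta> by (subst suminf_ennreal_eq[OF _ cosh[OF t]]) (auto simp: ennreal_mult')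
    finally show "ennreal (exp (\<delta> * sqrt t)) \<le> 2 * (\<Sum>n. ennreal (\<delta> ^ (2 * n) * t ^ n / fact (2 * n)))" .
  qed
  also have "\<dots> = 2 * (\<Sum>n. \<integral>\<^sup>+t. ennreal (\<delta> ^ (2 * n) * t ^ n / fact (2 * n)) \<partial>\<mu>)"
  proof -
    have m: "(\<lambda>t. ennreal (\<delta> ^ (2 * n) * t ^ n / fact (2 * n))) \<in> borel_measurable \<mu>" for n
      by (rule borel_measurable_mu) measurable
    show ?thesis
      by (subst nn_integral_cmult, intro borel_measurable_suminf_order m, subst nn_integral_suminf, rule m, rule refl)
  qed
  also have "(\<lambda>n. \<integral>\<^sup>+t. ennreal (\<delta> ^ (2 * n) * t ^ n / fact (2 * n)) \<partial>\<mu>) = (\<lambda>n. ennreal (\<delta> ^ (2 * n) * s n / fact (2 * n)))"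
  proof
    fix n
    show "(\<integral>\<^sup>+t. ennreal (\<delta> ^ (2 * n) * t ^ n / fact (2 * n)) \<partial>\<mu>) = ennreal (\<delta> ^ (2 * n) * s n / fact (2 * n))"
      using moment[of n] \<delta> by (subst nn_integral_eq_integral) (auto simp: space_eq)
  qed
  also have "2 * (\<Sum>n. ennreal (\<delta> ^ (2 * n) * s n / fact (2 * n))) < \<infinity>"
  proof -
    have "s n \<ge> 0" for n
      unfolding moment(2)[symmetric] by (rule integral_nonneg_AE) (auto simp: space_eq)
    then have "(\<Sum>n. ennreal (\<delta> ^ (2 * n) * s n / fact (2 * n))) = ennreal (\<Sum>n. \<delta> ^ (2 * n) * s n / fact (2 * n))"
      using summable \<delta> by (intro suminf_ennreal2) auto
    then show ?thesis by (simp add: ennreal_mult_less_top)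
  qed
  finally show ?thesis .
qed

lemma exponential_moment_symmetric_sqrt: "exponential_moment (symmetric_sqrt \<mu>) \<delta>"
proof -
  interpret D: prob_space "symmetric_sqrt \<mu>"
    unfolding symmetric_sqrt_def by (rule P.prob_space_distr) (rule measurable_signed_sqrt)
  have "(\<integral>\<^sup>+x. ennreal (exp (\<delta> * \<bar>x\<bar>)) \<partial>symmetric_sqrt \<mu>) =
      (\<integral>\<^sup>+x. ennreal (exp (\<delta> * \<bar>snd x * sqrt (fst x)\<bar>)) \<partial>(\<mu> \<Otimes>\<^sub>M signs))"
    unfolding symmetric_sqrt_def by (subst nn_integral_distr[OF measurable_signed_sqrt]) (auto simp: case_prod_beta)
  also have "\<dots> = (\<integral>\<^sup>+x. ennreal (exp (\<delta> * sqrt (fst x))) \<partial>(\<mu> \<Otimes>\<^sub>M signs))"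
    by (intro nn_integral_cong) (auto simp: space_pair_measure space_eq abs_mult)
  also have "\<dots> = (\<integral>\<^sup>+t. \<integral>\<^sup>+e. ennreal (exp (\<delta> * sqrt t)) \<partial>signs \<partial>\<mu>)"
    by (subst signs.nn_integral_fst[symmetric]) (auto intro!: borel_measurable_fst)
  also have "\<dots> = (\<integral>\<^sup>+t. ennreal (exp (\<delta> * sqrt t)) \<partial>\<mu>)"
    using signs.emeasure_space_1 by simp
  finally have "integrable (symmetric_sqrt \<mu>) (\<lambda>x. exp (\<delta> * \<bar>x\<bar>))"
    using exp_sqrt_finite by (intro integrableI_nonneg) (auto simp: symmetric_sqrt_def)
  then show ?thesis
    by unfold_locales (auto simp: symmetric_sqrt_def \<delta>)
qed

lemma moment_symmetric_sqrt:
  "(\<integral>x. x ^ k \<partial>symmetric_sqrt \<mu>) = (if even k then s (k div 2) else 0)"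
proof -
  interpret E: exponential_moment "symmetric_sqrt \<mu>" \<delta> by (rule exponential_moment_symmetric_sqrt)
  have "integrable (symmetric_sqrt \<mu>) (\<lambda>x. x ^ k)" by (rule E.integrable_power)
  then have int: "integrable (\<mu> \<Otimes>\<^sub>M signs) (\<lambda>(t, e). (e * sqrt t) ^ k)"
    unfolding symmetric_sqrt_def by (subst (asm) integrable_distr_eq[OF measurable_signed_sqrt]) (auto simp: case_prod_unfold)
  have "(\<integral>x. x ^ k \<partial>symmetric_sqrt \<mu>) = (\<integral>(t, e). (e * sqrt t) ^ k \<partial>(\<mu> \<Otimes>\<^sub>M signs))"
    unfolding symmetric_sqrt_def by (subst integral_distr[OF measurable_signed_sqrt]) (auto simp: case_prod_unfold)
  also have "\<dots> = (\<integral>t. \<integral>e. (e * sqrt t) ^ k \<partial>signs \<partial>\<mu>)"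
    using integral_fst'[OF int] by simp
  also have "\<dots> = (\<integral>t. (if even k then t ^ (k div 2) else 0) \<partial>\<mu>)"
  proof (intro Bochner_Integration.integral_cong refl)
    fix t assume "t \<in> space \<mu>"
    then have t: "t \<ge> 0" by (simp add: space_eq)
    have "(\<integral>e. (e * sqrt t) ^ k \<partial>signs) = ((- sqrt t) ^ k + sqrt t ^ k) / 2"
      by (subst integral_uniform_count_measure) auto
    also have "\<dots> = (if even k then t ^ (k div 2) else 0)"
      using t by (auto elim!: evenE simp: power_mult)
    finally show "(\<integral>e. (e * sqrt t) ^ k \<partial>signs) = (if even k then t ^ (k div 2) else 0)" .
  qed
  also have "\<dots> = (if even k then s (k div 2) else 0)"
    by (simp add: moment)
  finally show ?thesis .
qed

lemma distr_symmetric_sqrt: "distr (symmetric_sqrt \<mu>) (restrict_space borel {0..}) (\<lambda>x. x\<^sup>2) = \<mu>"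
proof -
  have "distr (symmetric_sqrt \<mu>) (restrict_space borel {0..}) (\<lambda>x. x\<^sup>2) =
      distr (\<mu> \<Otimes>\<^sub>M signs) (restrict_space borel {0..}) ((\<lambda>x. x\<^sup>2) \<circ> (\<lambda>(t, e). e * sqrt t))"
    unfolding symmetric_sqrt_def by (intro distr_distr measurable_restrict_space2 measurable_signed_sqrt) auto
  also have "\<dots> = distr (\<mu> \<Otimes>\<^sub>M signs) \<mu> fst"
    by (intro distr_cong) (auto simp: sets_eq space_pair_measure space_eq power_mult_distrib)
  also have "\<dots> = \<mu>"
    by (rule signs.distr_pair_fst)
  finally show ?thesis .
qed

end

lemma Stieltjes_moments_unique:
  assumes "Stieltjes_exponential \<mu> s \<delta>" "Stieltjes_exponential \<nu> s \<delta>"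
  shows "\<mu> = \<nu>"
proof -
  interpret \<mu>: Stieltjes_exponential \<mu> s \<delta> by fact
  interpret \<nu>: Stieltjes_exponential \<nu> s \<delta> by fact
  have "symmetric_sqrt \<mu> = symmetric_sqrt \<nu>"
    by (rule moments_determine_distribution[OF \<mu>.exponential_moment_symmetric_sqrt \<nu>.exponential_moment_symmetric_sqrt])
       (simp add: \<mu>.moment_symmetric_sqrt \<nu>.moment_symmetric_sqrt)
  then show ?thesis
    by (metis \<mu>.distr_symmetric_sqrt \<nu>.distr_symmetric_sqrt)
qed

section \<open>Indeterminacy\<close>

lemma prob_space_gamma_distribution: "s > 0 \<Longrightarrow> prob_space (gamma_distribution s)"
proof (rule prob_spaceI)
  assume s: "s > 0"
  have "(\<integral>\<^sup>+t. ennreal (t powr 0 * exp (- (0 * t))) \<partial>gamma_distribution s) = emeasure (gamma_distribution s) (space (gamma_distribution s))"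
    unfolding nn_integral_indicator[OF sets.top, symmetric] gamma_distribution_def
    by (subst (1 2) nn_integral_density) (auto intro!: nn_integral_cong simp: indicator_def)
  then show "emeasure (gamma_distribution s) (space (gamma_distribution s)) = 1"
    using nn_integral_gamma_distribution_powr_exp[of s 0 0] s Gamma_real_nonzero[OF s] by simp
qed

text \<open>Analytic continuation of the reflected law at rate 1; \<open>1 + z\<close> stays in the
  right half-plane, where \<open>Ln\<close> is holomorphic.\<close>

lemma gamma_distribution_Laplace:
  assumes s: "s > 0" and z: "Re z > -1"
  shows "has_bochner_integral (gamma_distribution s) (\<lambda>t. exp (- (z * of_real t))) (exp (- (of_real s * Ln (1 + z))))"
proof -
  have mgf: "has_mgf (distr (gamma_distribution s) borel (\<lambda>t. - t / 1)) 1 (\<lambda>r. (1 / (1 + r)) powr s)"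
    by (rule has_mgf_gamma) (use s in auto)
  have "has_bochner_integral (distr (gamma_distribution s) borel (\<lambda>t. - t / 1)) (\<lambda>x. exp (z * of_real x)) (exp (- (of_real s * Ln (1 + z))))"
  proof (rule has_mgf_complex[OF _ mgf])
    show "(\<lambda>z. exp (- (complex_of_real s * Ln (1 + z)))) holomorphic_on {z. - 1 < Re z}"
      by (intro holomorphic_intros) (auto simp: complex_nonpos_Reals_iff)
    fix r :: real assume r: "r > -1"
    have "Ln (1 + complex_of_real r) = of_real (ln (1 + r))"
      using Ln_of_real[of "1 + r"] r by simp
    then show "exp (- (complex_of_real s * Ln (1 + complex_of_real r))) = complex_of_real ((1 / (1 + r)) powr s)"
      using r by (simp add: powr_def ln_div exp_of_real[symmetric] del: exp_of_real)
  qed (use z in auto)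
  then show ?thesis
    by (subst (asm) has_bochner_integral_iff, subst has_bochner_integral_iff)
       (simp add: integrable_distr_eq integral_distr)
qed

text \<open>The Laplace transform at \<open>z = \<i> * tan \<theta>\<close>, where
  \<open>1 + z\<close> has modulus \<open>1 / cos \<theta>\<close> and argument
  \<open>\<theta>\<close>; multiplication by \<open>exp (\<i> * \<phi>)\<close> and the imaginary
  part give the sine.\<close>

lemma gamma_distribution_oscillating:
  assumes s: "s > 0" and \<theta>: "\<bar>\<theta>\<bar> < pi / 2"
  shows "has_bochner_integral (gamma_distribution s) (\<lambda>t. sin (\<phi> - t * tan \<theta>)) (cos \<theta> powr s * sin (\<phi> - \<theta> * s))"
proof -
  have cos: "cos \<theta> > 0" using \<theta> by (intro cos_gt_zero_pi) auto
  have "1 + \<i> * complex_of_real (tan \<theta>) = of_real (1 / cos \<theta>) * exp (\<i> * of_real \<theta>)"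
    using cos by (simp add: complex_eq_iff tan_def Re_exp Im_exp)
  also have "Ln \<dots> = of_real (- ln (cos \<theta>)) + \<i> * of_real \<theta>"
  proof (rule Ln_unique)
    show "exp (complex_of_real (- ln (cos \<theta>)) + \<i> * complex_of_real \<theta>) = of_real (1 / cos \<theta>) * exp (\<i> * of_real \<theta>)"
      using cos by (simp add: exp_add exp_of_real exp_minus inverse_eq_divide del: of_real_minus)
  qed (use \<theta> pi_gt_zero in auto)
  finally have Ln: "Ln (1 + \<i> * complex_of_real (tan \<theta>)) = of_real (- ln (cos \<theta>)) + \<i> * of_real \<theta>" .
  have "has_bochner_integral (gamma_distribution s) (\<lambda>t. exp (- (\<i> * of_real (tan \<theta>) * of_real t)))
      (exp (- (of_real s * Ln (1 + \<i> * of_real (tan \<theta>)))))"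
    by (rule gamma_distribution_Laplace[OF s]) simp
  then have "has_bochner_integral (gamma_distribution s) (\<lambda>t. exp (\<i> * of_real \<phi>) * exp (- (\<i> * of_real (tan \<theta>) * of_real t)))
      (exp (\<i> * of_real \<phi>) * exp (- (of_real s * Ln (1 + \<i> * of_real (tan \<theta>)))))"
    by (rule has_bochner_integral_mult_right[rotated])
  then have "has_bochner_integral (gamma_distribution s) (\<lambda>t. Im (exp (\<i> * of_real \<phi>) * exp (- (\<i> * of_real (tan \<theta>) * of_real t))))
      (Im (exp (\<i> * of_real \<phi>) * exp (- (of_real s * Ln (1 + \<i> * of_real (tan \<theta>))))))"
    by (rule has_bochner_integral_Im)
  moreover have "Im (exp (\<i> * of_real \<phi>) * exp (- (\<i> * of_real (tan \<theta>) * of_real t))) = sin (\<phi> - t * tan \<theta>)" for t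
    unfolding exp_add[symmetric] by (simp add: Im_exp mult.commute)
  moreover have "Im (exp (\<i> * of_real \<phi>) * exp (- (of_real s * Ln (1 + \<i> * of_real (tan \<theta>))))) = cos \<theta> powr s * sin (\<phi> - \<theta> * s)"
    unfolding exp_add[symmetric] Ln using cos by (simp add: Im_exp powr_def mult.commute)
  ultimately show ?thesis by simp
qed

text \<open>The factor \<open>t powr u\<close> shifts the shape of the gamma law to
  \<open>\<beta> + u\<close>. The phase \<open>\<beta> * \<theta>\<close> is tuned so that
  \<open>\<beta>\<close> drops out of the resulting sine;
  \<open>\<bar>\<epsilon>\<bar> \<le> 1\<close> keeps the density nonnegative.\<close>

lemma nn_integral_perturbed_gamma:
  assumes \<beta>: "\<beta> > 0" and u: "\<beta> + u > 0" and \<theta>: "\<bar>\<theta>\<bar> < pi / 2" and \<epsilon>: "\<bar>\<epsilon>\<bar> \<le> 1"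
  shows "(\<integral>\<^sup>+t. ennreal (t powr u) \<partial>density (gamma_distribution \<beta>) (\<lambda>t. ennreal (1 + \<epsilon> * sin (\<beta> * \<theta> - t * tan \<theta>)))) =
    ennreal (Gamma (\<beta> + u) / Gamma \<beta> * (1 - \<epsilon> * (cos \<theta> powr (\<beta> + u) * sin (\<theta> * u))))"
proof -
  let ?h = "\<lambda>t. 1 + \<epsilon> * sin (\<beta> * \<theta> - t * tan \<theta>)"
  interpret prob_space "gamma_distribution (\<beta> + u)" by (rule prob_space_gamma_distribution[OF u])
  have h: "0 \<le> ?h t" for t
  proof -
    have "\<bar>\<epsilon> * sin (\<beta> * \<theta> - t * tan \<theta>)\<bar> \<le> 1 * 1"
      unfolding abs_mult by (intro mult_mono \<epsilon>) auto
    then show ?thesis by linarith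
  qed
  have G: "Gamma \<beta> > 0" "Gamma (\<beta> + u) > 0" using \<beta> u by auto
  have w: "indicator {0..} t * t powr (\<beta> - 1) * exp (- t) / Gamma \<beta> * (?h t * t powr u) =
      Gamma (\<beta> + u) / Gamma \<beta> * (indicator {0..} t * t powr (\<beta> + u - 1) * exp (- t) / Gamma (\<beta> + u) * ?h t)" for t
  proof -
    have "t powr (\<beta> + u - 1) = t powr (\<beta> - 1) * t powr u" by (simp add: powr_add[symmetric] algebra_simps)
    then show ?thesis using G by (simp only:) simp
  qed
  have "(\<integral>\<^sup>+t. ennreal (t powr u) \<partial>density (gamma_distribution \<beta>) (\<lambda>t. ennreal (?h t))) =
     (\<integral>\<^sup>+t. ennreal (indicator {0..} t * t powr (\<beta> - 1) * exp (- t) / Gamma \<beta>) * (ennreal (?h t) * ennreal (t powr u)) \<partial>lborel)"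
    unfolding gamma_distribution_def by (subst nn_integral_density, simp, simp, subst nn_integral_density, simp_all)
  also have "\<dots> = (\<integral>\<^sup>+t. ennreal (Gamma (\<beta> + u) / Gamma \<beta>) *
      (ennreal (indicator {0..} t * t powr (\<beta> + u - 1) * exp (- t) / Gamma (\<beta> + u)) * ennreal (?h t)) \<partial>lborel)"
  proof (rule nn_integral_cong)
    fix t :: real
    have "indicator {0..} t * t powr (\<beta> - 1) * exp (- t) / Gamma \<beta> \<ge> 0"
        "indicator {0..} t * t powr (\<beta> + u - 1) * exp (- t) / Gamma (\<beta> + u) \<ge> 0" using G by auto
    then show "ennreal (indicator {0..} t * t powr (\<beta> - 1) * exp (- t) / Gamma \<beta>) * (ennreal (?h t) * ennreal (t powr u)) =
       ennreal (Gamma (\<beta> + u) / Gamma \<beta>) *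
      (ennreal (indicator {0..} t * t powr (\<beta> + u - 1) * exp (- t) / Gamma (\<beta> + u)) * ennreal (?h t))"
      using h[of t] G w[of t] by (simp only: ennreal_mult'[symmetric] ennreal_mult[symmetric] mult_nonneg_nonneg divide_nonneg_nonneg less_imp_le powr_ge_zero)
  qed
  also have "\<dots> = ennreal (Gamma (\<beta> + u) / Gamma \<beta>) * (\<integral>\<^sup>+t. ennreal (?h t) \<partial>gamma_distribution (\<beta> + u))"
    unfolding gamma_distribution_def by (subst nn_integral_cmult, simp, subst nn_integral_density, simp_all)
  also have "(\<integral>\<^sup>+t. ennreal (?h t) \<partial>gamma_distribution (\<beta> + u)) = ennreal (1 + \<epsilon> * (cos \<theta> powr (\<beta> + u) * sin (\<beta> * \<theta> - \<theta> * (\<beta> + u))))"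
  proof -
    have "has_bochner_integral (gamma_distribution (\<beta> + u)) (\<lambda>t. sin (\<beta> * \<theta> - t * tan \<theta>)) (cos \<theta> powr (\<beta> + u) * sin (\<beta> * \<theta> - \<theta> * (\<beta> + u)))"
      by (rule gamma_distribution_oscillating[OF u \<theta>])
    then have "integrable (gamma_distribution (\<beta> + u)) ?h"
      "(\<integral>t. ?h t \<partial>gamma_distribution (\<beta> + u)) = 1 + \<epsilon> * (cos \<theta> powr (\<beta> + u) * sin (\<beta> * \<theta> - \<theta> * (\<beta> + u)))"
      by (auto simp: has_bochner_integral_iff prob_space)
    then show ?thesis using h by (subst nn_integral_eq_integral) auto
  qed
  also have "sin (\<beta> * \<theta> - \<theta> * (\<beta> + u)) = - sin (\<theta> * u)"
    by (simp add: algebra_simps)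
  also have "ennreal (Gamma (\<beta> + u) / Gamma \<beta>) * ennreal (1 + \<epsilon> * (cos \<theta> powr (\<beta> + u) * - sin (\<theta> * u))) =
     ennreal (Gamma (\<beta> + u) / Gamma \<beta> * (1 - \<epsilon> * (cos \<theta> powr (\<beta> + u) * sin (\<theta> * u))))"
    using G by (subst ennreal_mult'[symmetric]) auto
  finally show ?thesis .
qed

text \<open>The moments are those of \<open>T powr \<alpha> * exp X\<close> with \<open>T\<close> gamma distributed and \<open>X\<close> an independent variable
  with the quotient above as moment generating function. Perturbing the gamma density by
  \<open>1 + \<epsilon> sin (\<beta> \<theta> - t tan \<theta>)\<close> multiplies the moment of order \<open>r\<close> by
  \<open>1 - \<epsilon> cos \<theta> powr (\<beta> + \<alpha> r) sin (\<pi> r)\<close>, which is 1 for integers \<open>r\<close> but not for \<open>r = 1/2\<close>.\<close>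

lemma not_S_determinate_Gamma_powr:
  assumes a: "a > 0" and b: "b > 0" and c: "c > 0" and ac: "a * c > 2"
  shows "\<not> S_determinate (\<lambda>n. gamma_moment a b n powr c)"
proof
  assume det: "S_determinate (\<lambda>n. gamma_moment a b n powr c)"
  \<comment> \<open>\<open>\<theta> * (\<alpha> * r)\<close> becomes \<open>pi * r\<close>, and
    \<open>\<alpha> > 2\<close> yields \<open>\<theta> < pi / 2\<close>. For this
    \<open>\<alpha>\<close>, \<open>\<beta>\<close> is the least value that the lemma on quotients
    admits.\<close>
  define \<alpha> \<beta> \<theta> where "\<alpha> = a * c" and "\<beta> = b * c + 1" and "\<theta> = pi / \<alpha>"
  have \<alpha>: "\<alpha> > 2" and \<beta>: "\<beta> > 0" using a b c ac by (auto simp: \<alpha>_def \<beta>_def add_nonneg_pos)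
  have "pi / \<alpha> < pi / 2" using \<alpha> pi_gt_zero by (intro divide_strict_left_mono) auto
  then have \<theta>: "\<bar>\<theta>\<bar> < pi / 2" "\<theta> > 0" using \<alpha> by (auto simp: \<theta>_def)
  define \<Psi> where "\<Psi> r = (Gamma (a * r + b) / Gamma b) powr c / (Gamma (\<alpha> * r + \<beta>) / Gamma \<beta>)" for r
  have "is_mgf (b / a) \<Psi>"
    unfolding \<Psi>_def by (rule is_mgf_Gamma_quotient) (use a b c \<alpha> in \<open>auto simp: \<alpha>_def \<beta>_def field_simps\<close>)
  then obtain \<sigma> where \<sigma>: "has_mgf \<sigma> (b / a) \<Psi>" by (auto simp: is_mgf_def)
  interpret \<sigma>: real_distribution \<sigma> using \<sigma> by (rule has_mgfD)
  define G where "G \<epsilon> = density (gamma_distribution \<beta>) (\<lambda>t. ennreal (1 + \<epsilon> * sin (\<beta> * \<theta> - t * tan \<theta>)))" for \<epsilon>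
  define \<nu> where "\<nu> \<epsilon> = distr (G \<epsilon> \<Otimes>\<^sub>M \<sigma>) (restrict_space borel {0..}) (\<lambda>(t, x). t powr \<alpha> * exp x)" for \<epsilon>
  have setsG [measurable_cong]: "sets (G \<epsilon>) = sets borel" for \<epsilon> by (simp add: G_def)
  have "(\<lambda>(t, x). t powr \<alpha> * exp x) \<in> borel_measurable (G \<epsilon> \<Otimes>\<^sub>M \<sigma>)" for \<epsilon>
    by measurable
  then have map: "(\<lambda>(t, x). t powr \<alpha> * exp x) \<in> G \<epsilon> \<Otimes>\<^sub>M \<sigma> \<rightarrow>\<^sub>M restrict_space borel {0..}" for \<epsilon>
    by (intro measurable_restrict_space2) auto
  have nn: "(\<integral>\<^sup>+y. ennreal (f y) \<partial>\<nu> \<epsilon>) = ennreal (Gamma (\<beta> + \<alpha> * r) / Gamma \<beta> * (1 - \<epsilon> * (cos \<theta> powr (\<beta> + \<alpha> * r) * sin (\<theta> * (\<alpha> * r)))) * \<Psi> r)"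
    if f: "f \<in> borel_measurable borel" "\<And>t x. t \<noteq> 0 \<Longrightarrow> f (t powr \<alpha> * exp x) = t powr (\<alpha> * r) * exp (r * x)"
      and r: "r \<ge> 0" and \<epsilon>: "\<bar>\<epsilon>\<bar> \<le> 1" for f :: "real \<Rightarrow> real" and r \<epsilon>
  proof -
    have r': "r > - (b / a)" "\<beta> + \<alpha> * r > 0" using a b r \<alpha> \<beta> by (auto intro: less_le_trans[of _ 0] add_pos_nonneg)
    have [measurable]: "f \<in> borel_measurable borel" by fact
    \<comment> \<open>At \<open>t = 0\<close> the moment of order 0 would be misread, since
      \<open>0 ^ 0 = 1\<close> but \<open>0 powr 0 = 0\<close>. The density vanishes at 0 because
      \<open>0 powr (\<beta> - 1) = 0\<close>.\<close>
    have ae: "AE t in G \<epsilon>. t \<noteq> 0"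
      unfolding G_def gamma_distribution_def
      by (subst AE_density, simp, subst AE_density, simp, intro AE_I2) (auto simp: indicator_def)
    have "(\<integral>\<^sup>+y. ennreal (f y) \<partial>\<nu> \<epsilon>) = (\<integral>\<^sup>+p. ennreal (f (fst p powr \<alpha> * exp (snd p))) \<partial>(G \<epsilon> \<Otimes>\<^sub>M \<sigma>))"
      unfolding \<nu>_def by (subst nn_integral_distr[OF map]) (auto intro!: measurable_restrict_space1 simp: case_prod_unfold)
    also have "\<dots> = (\<integral>\<^sup>+t. \<integral>\<^sup>+x. ennreal (f (t powr \<alpha> * exp x)) \<partial>\<sigma> \<partial>G \<epsilon>)"
    proof -
      have "(\<lambda>p. fst p powr \<alpha> * exp (snd p)) \<in> borel_measurable (G \<epsilon> \<Otimes>\<^sub>M \<sigma>)" by measurable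
      moreover have "(\<lambda>y. ennreal (f y)) \<in> borel_measurable borel" by measurable
      ultimately have "(\<lambda>p. ennreal (f (fst p powr \<alpha> * exp (snd p)))) \<in> borel_measurable (G \<epsilon> \<Otimes>\<^sub>M \<sigma>)"
        by (rule measurable_compose)
      then show ?thesis
        by (subst \<sigma>.nn_integral_fst[symmetric]) simp_all
    qed
    also have "\<dots> = (\<integral>\<^sup>+t. ennreal (t powr (\<alpha> * r)) * ennreal (\<Psi> r) \<partial>G \<epsilon>)"
    proof (rule nn_integral_cong_AE, use ae in eventually_elim)
      case (elim t)
      have "(\<integral>\<^sup>+x. ennreal (f (t powr \<alpha> * exp x)) \<partial>\<sigma>) = (\<integral>\<^sup>+x. ennreal (t powr (\<alpha> * r)) * ennreal (exp (r * x)) \<partial>\<sigma>)"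
        using f(2)[OF elim] by (simp add: ennreal_mult')
      also have "\<dots> = ennreal (t powr (\<alpha> * r)) * ennreal (\<Psi> r)"
        using has_mgfD(5)[OF \<sigma> r'(1)] by (subst nn_integral_cmult) auto
      finally show ?case .
    qed
    also have "\<dots> = ennreal (Gamma (\<beta> + \<alpha> * r) / Gamma \<beta> * (1 - \<epsilon> * (cos \<theta> powr (\<beta> + \<alpha> * r) * sin (\<theta> * (\<alpha> * r))))) * ennreal (\<Psi> r)"
      unfolding nn_integral_perturbed_gamma[OF \<beta> r'(2) \<theta>(1) \<epsilon>, folded G_def, symmetric]
      by (rule nn_integral_multc) measurable
    also have "\<dots> = ennreal (Gamma (\<beta> + \<alpha> * r) / Gamma \<beta> * (1 - \<epsilon> * (cos \<theta> powr (\<beta> + \<alpha> * r) * sin (\<theta> * (\<alpha> * r)))) * \<Psi> r)"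
      by (rule ennreal_mult''[symmetric]) (use has_mgfD(4)[OF \<sigma> r'(1)] in simp)
    finally show ?thesis .
  qed
  have moments: "has_moments (\<nu> \<epsilon>) (\<lambda>n. gamma_moment a b n powr c)" if \<epsilon>: "\<bar>\<epsilon>\<bar> \<le> 1" for \<epsilon>
    unfolding has_moments_def
  proof
    fix n :: nat
    have G: "Gamma (\<alpha> * real n + \<beta>) > 0" "Gamma \<beta> > 0"
      using \<alpha> \<beta> by (auto intro!: Gamma_real_pos add_nonneg_pos)
    have sin: "sin (\<theta> * (\<alpha> * real n)) = 0"
      using \<alpha> sin_npi2[of n] by (simp add: \<theta>_def)
    have "(\<integral>\<^sup>+y. ennreal (y ^ n) \<partial>\<nu> \<epsilon>) = ennreal (Gamma (\<beta> + \<alpha> * real n) / Gamma \<beta> * (1 - \<epsilon> * (cos \<theta> powr (\<beta> + \<alpha> * real n) * sin (\<theta> * (\<alpha> * real n)))) * \<Psi> (real n))"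
    proof (rule nn[OF _ _ _ \<epsilon>])
      fix t x :: real assume "t \<noteq> 0"
      then show "(t powr \<alpha> * exp x) ^ n = t powr (\<alpha> * real n) * exp (real n * x)"
        by (simp add: power_mult_distrib powr_powr[symmetric] powr_realpow exp_of_nat_mult)
    qed auto
    also have "Gamma (\<beta> + \<alpha> * real n) / Gamma \<beta> * (1 - \<epsilon> * (cos \<theta> powr (\<beta> + \<alpha> * real n) * sin (\<theta> * (\<alpha> * real n)))) * \<Psi> (real n) = gamma_moment a b n powr c"
      using G unfolding sin \<Psi>_def gamma_moment_def by (simp add: add.commute)
    finally have e: "(\<integral>\<^sup>+y. ennreal (y ^ n) \<partial>\<nu> \<epsilon>) = ennreal (gamma_moment a b n powr c)" .
    show "has_bochner_integral (\<nu> \<epsilon>) (\<lambda>t. t ^ n) (gamma_moment a b n powr c)"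
    proof (rule has_bochner_integral_nn_integral[OF _ _ _ e])
      have "sets (\<nu> \<epsilon>) = sets (restrict_space borel {0..})" by (simp add: \<nu>_def)
      then show "(\<lambda>t. t ^ n) \<in> borel_measurable (\<nu> \<epsilon>)"
        by (subst measurable_cong_sets[OF _ refl]) (auto intro: measurable_restrict_space1)
      show "AE t in \<nu> \<epsilon>. 0 \<le> t ^ n"
        by (rule AE_I2) (auto simp: \<nu>_def space_restrict_space)
    qed simp
  qed
  have "borel_measure_on {0..} (\<nu> \<epsilon>)" for \<epsilon> by (simp add: borel_measure_on_def \<nu>_def)
  then have eq: "\<nu> 1 = \<nu> (-1)"
    using det moments[of 1] moments[of "-1"] unfolding S_determinate_def by auto
  have half: "(\<integral>\<^sup>+y. ennreal (y powr (1/2)) \<partial>\<nu> \<epsilon>) = ennreal (Gamma (\<beta> + \<alpha> * (1/2)) / Gamma \<beta> * (1 - \<epsilon> * cos \<theta> powr (\<beta> + \<alpha> * (1/2))) * \<Psi> (1/2))" if "\<bar>\<epsilon>\<bar> \<le> 1" for \<epsilon>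
  proof -
    have "\<theta> * (\<alpha> * (1/2)) = pi / 2" using \<alpha> by (simp add: \<theta>_def)
    then have sin: "sin (\<theta> * (\<alpha> * (1/2))) = 1" by (simp only: sin_pi_half)
    have "(\<integral>\<^sup>+y. ennreal (y powr (1/2)) \<partial>\<nu> \<epsilon>) = ennreal (Gamma (\<beta> + \<alpha> * (1/2)) / Gamma \<beta> * (1 - \<epsilon> * (cos \<theta> powr (\<beta> + \<alpha> * (1/2)) * sin (\<theta> * (\<alpha> * (1/2))))) * \<Psi> (1/2))"
    proof (rule nn[OF _ _ _ that])
      fix t x :: real
      show "(t powr \<alpha> * exp x) powr (1/2) = t powr (\<alpha> * (1/2)) * exp (1/2 * x)"
        by (simp only: powr_mult powr_powr exp_powr_real mult.commute)
    qed auto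
    then show ?thesis unfolding sin by simp
  qed
  have cos: "cos \<theta> > 0" using \<theta> by (intro cos_gt_zero_pi) auto
  have cos1: "cos \<theta> powr (\<beta> + \<alpha> * (1/2)) \<le> 1" using cos \<alpha> \<beta> by (intro powr_le1) auto
  have pos: "Gamma (\<beta> + \<alpha> * (1/2)) / Gamma \<beta> > 0" "\<Psi> (1/2) > 0"
  proof -
    have "\<beta> + \<alpha> * (1/2) > 0" using \<alpha> \<beta> by (simp add: add_pos_pos)
    then show "Gamma (\<beta> + \<alpha> * (1/2)) / Gamma \<beta> > 0" by (intro divide_pos_pos Gamma_real_pos \<beta>)
    have "b / a > 0" using a b by simp
    then have "1/2 > - (b / a)" by linarith
    then show "\<Psi> (1/2) > 0" by (rule has_mgfD(4)[OF \<sigma>])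
  qed
  let ?p = "Gamma (\<beta> + \<alpha> * (1/2)) / Gamma \<beta>" and ?q = "cos \<theta> powr (\<beta> + \<alpha> * (1/2))"
  have "ennreal (?p * (1 - 1 * ?q) * \<Psi> (1/2)) = (\<integral>\<^sup>+y. ennreal (y powr (1/2)) \<partial>\<nu> 1)"
    using half[of 1] by (simp only: abs_one order_refl simp_thms)
  also have "\<dots> = (\<integral>\<^sup>+y. ennreal (y powr (1/2)) \<partial>\<nu> (-1))"
    by (simp only: eq)
  also have "\<dots> = ennreal (?p * (1 - (-1) * ?q) * \<Psi> (1/2))"
    using half[of "-1"] by (simp only: abs_minus_cancel abs_one order_refl simp_thms)
  finally have "ennreal (?p * (1 - 1 * ?q) * \<Psi> (1/2)) = ennreal (?p * (1 - (-1) * ?q) * \<Psi> (1/2))" .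
  \<comment> \<open>\<open>ennreal\<close> identifies all nonpositive reals, so the signs have to be
    settled, through \<open>?q \<le> 1\<close>, before the values can be compared.\<close>
  moreover have "0 \<le> ?p * (1 - 1 * ?q) * \<Psi> (1/2)" "0 \<le> ?p * (1 - (-1) * ?q) * \<Psi> (1/2)"
  proof -
    have m: "0 \<le> 1 - 1 * ?q" "0 \<le> 1 - (-1) * ?q" using cos1 powr_ge_zero[of "cos \<theta>" "\<beta> + \<alpha> * (1/2)"] by linarith+
    show "0 \<le> ?p * (1 - 1 * ?q) * \<Psi> (1/2)"
      by (intro mult_nonneg_nonneg less_imp_le[OF pos(1)] less_imp_le[OF pos(2)] m(1))
    show "0 \<le> ?p * (1 - (-1) * ?q) * \<Psi> (1/2)"
      by (intro mult_nonneg_nonneg less_imp_le[OF pos(1)] less_imp_le[OF pos(2)] m(2))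
  qed
  ultimately have "?p * (1 - 1 * ?q) * \<Psi> (1/2) = ?p * (1 - (-1) * ?q) * \<Psi> (1/2)"
    using ennreal_inj by blast
  then have "?p * (1 - 1 * ?q) = ?p * (1 - (-1) * ?q)"
    using pos(2) by (metis less_irrefl mult_cancel_right)
  then have "1 - 1 * ?q = 1 - (-1) * ?q"
    using pos(1) by (metis less_irrefl mult_cancel_left)
  then have "?q = 0" by linarith
  then show False using cos by simp
qed

section \<open>Growth and decay of the Gamma function\<close>

text \<open>A crude form of Stirling's bound: compactness on \<open>[1, 2]\<close> and the recursion
  with \<open>(x - 1) powr (x - 1) \<le> x powr (x - 1)\<close>. Geometric factors are harmless for
  determinacy.\<close>

lemma Gamma_le_powr_self: "\<exists>C>0. \<forall>x\<ge>1. Gamma x \<le> C * x powr (x :: real)"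
proof -
  have "{1..2} \<inter> \<int>\<^sub>\<le>\<^sub>0 = ({} :: real set)"
    using nonpos_Ints_nonpos by fastforce
  then have "compact (Gamma ` {1..2 :: real})"
    by (intro compact_continuous_image continuous_on_Gamma compact_Icc)
  then have "bounded (Gamma ` {1..2 :: real})" by (rule compact_imp_bounded)
  then obtain B where B': "\<forall>y\<in>Gamma ` {1..2 :: real}. norm y \<le> B"
    unfolding bounded_iff ..
  have B: "norm (Gamma x) \<le> B" if "x \<in> {1..2}" for x :: real
    by (rule bspec[OF B' imageI[OF that]])
  define C where "C = max B 1"
  have C: "C \<ge> 1" "B \<le> C" by (auto simp: C_def)
  have base: "Gamma x \<le> C * x powr x" if x: "1 \<le> x" "x \<le> 2" for x
  proof -
    have "norm (Gamma x) \<le> B" by (rule B) (use x in simp)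
    then have "Gamma x \<le> C * 1" using abs_ge_self[of "Gamma x"] C unfolding real_norm_def by linarith
    also have "\<dots> \<le> C * x powr x"
      by (rule mult_left_mono[OF ge_one_powr_ge_zero]) (use C x in auto)
    finally show ?thesis .
  qed
  \<comment> \<open>As \<open>x\<close> is real, the induction runs over an integer bound; the
    recursion lowers \<open>x\<close> by 1 until it lies in \<open>[1, 2]\<close>.\<close>
  have step: "Gamma x \<le> C * x powr x" if "1 \<le> x" "x \<le> real n + 2" for x :: real and n
    using that
  proof (induction n arbitrary: x)
    case 0
    then show ?case by (intro base) auto
  next
    case (Suc n)
    show ?case
    proof (cases "x \<le> 2")
      case True
      with Suc.prems show ?thesis by (intro base)
    next
      case False
      then have x: "x - 1 \<ge> 1" "x - 1 \<le> real n + 2" using Suc.prems by auto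
      have "x - 1 \<notin> \<int>\<^sub>\<le>\<^sub>0" using nonpos_Ints_nonpos[of "x - 1"] x by linarith
      then have "Gamma x = (x - 1) * Gamma (x - 1)"
        using Gamma_plus1[of "x - 1"] by simp
      also have "\<dots> \<le> (x - 1) * (C * (x - 1) powr (x - 1))"
        by (rule mult_left_mono[OF Suc.IH]) (use x in auto)
      also have "\<dots> = C * ((x - 1) * (x - 1) powr (x - 1))" by simp
      also have "\<dots> \<le> C * (x * x powr (x - 1))"
      proof (rule mult_left_mono[OF mult_mono])
        show "(x - 1) powr (x - 1) \<le> x powr (x - 1)" by (rule powr_mono2) (use x in auto)
      qed (use x C in auto)
      also have "x * x powr (x - 1) = x powr x"
        using x by (simp add: powr_diff)
      finally show ?thesis .
    qed
  qed
  have "Gamma x \<le> C * x powr x" if "x \<ge> 1" for x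
  proof -
    obtain n :: nat where "x \<le> real n" using real_arch_simple by blast
    then show ?thesis using step[of x n] that by simp
  qed
  then show ?thesis using C by (intro exI[of _ C]) auto
qed

text \<open>Since \<open>a * c \<le> 2\<close>, the exponent \<open>(a * n + b) * c\<close> is at
  most \<open>2 * n + c * b\<close>, and \<open>n ^ (2 * n)\<close> is at most
  \<open>fact (2 * n) * exp (2 * n)\<close>.\<close>

lemma Gamma_moment_powr_bound:
  fixes a b c :: real
  assumes a: "a > 0" and b: "b > 0" and c: "c > 0" and ac: "a * c \<le> 2"
  shows "\<exists>A B. A > 0 \<and> B > 0 \<and> (\<forall>\<^sub>F n in sequentially. gamma_moment a b n powr c \<le> A * B ^ n * fact (2 * n))"
proof -
  obtain C where "C > 0 \<and> (\<forall>x\<ge>1. Gamma x \<le> C * x powr (x :: real))"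
    using Gamma_le_powr_self ..
  then have C: "C > 0" "\<And>x. x \<ge> 1 \<Longrightarrow> Gamma x \<le> C * x powr x"
    by auto
  define L where "L = a + b + 1"
  define A where "A = (C / Gamma b) powr c"
  \<comment> \<open>\<open>L\<close> is chosen for \<open>a * n + b \<le> L * n\<close>. The three
    factors stem from the power \<open>2 * n\<close> of \<open>L\<close>, from comparing with the
    factorial, and from the remaining power \<open>c * b\<close>.\<close>
  define B where "B = L\<^sup>2 * exp 2 * exp (c * b * L)"
  have L: "L \<ge> 1" using a b by (simp add: L_def)
  have G: "Gamma b > 0" using b by simp
  have "\<forall>\<^sub>F n in sequentially. a * real n + b \<ge> 1"
    using a by real_asymp
  then have "\<forall>\<^sub>F n in sequentially. gamma_moment a b n powr c \<le> A * B ^ n * fact (2 * n)"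
    using eventually_ge_at_top[of 1]
  proof eventually_elim
    case (elim n)
    define x where "x = a * real n + b"
    have x: "x \<ge> 1" using elim by (simp add: x_def)
    have "b \<le> b * real n" using elim b by simp
    then have xL: "x \<le> L * real n" using elim by (simp add: x_def L_def algebra_simps)
    have Ln: "L * real n \<ge> 1" using x xL by linarith
    have "Gamma x \<le> C * (L * real n) powr x"
      using C(2)[OF x] C(1) x xL by (elim order_trans) (auto intro!: mult_left_mono powr_mono2)
    then have "gamma_moment a b n \<le> C / Gamma b * (L * real n) powr x"
      unfolding gamma_moment_def x_def[symmetric] using G by (simp add: divide_right_mono)
    moreover have "gamma_moment a b n \<ge> 0"
      unfolding gamma_moment_def x_def[symmetric] using G x Gamma_real_pos[of x] by (intro divide_nonneg_nonneg) auto
    ultimately have "gamma_moment a b n powr c \<le> (C / Gamma b * (L * real n) powr x) powr c"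
      using c by (intro powr_mono2) auto
    also have "\<dots> = A * (L * real n) powr (x * c)"
      by (simp only: powr_mult powr_powr A_def)
    also have "\<dots> \<le> A * (L * real n) powr (2 * real n + c * b)"
    proof (intro mult_left_mono powr_mono Ln)
      have "x * c = (a * c) * real n + c * b" by (simp add: x_def algebra_simps)
      also have "\<dots> \<le> 2 * real n + c * b" using ac by (intro add_right_mono mult_right_mono) auto
      finally show "x * c \<le> 2 * real n + c * b" .
    qed (simp add: A_def)
    also have "\<dots> \<le> A * ((L\<^sup>2) ^ n * (fact (2 * n) * exp 2 ^ n) * exp (c * b * L) ^ n)"
    proof (rule mult_left_mono)
      have "(L * real n) powr (2 * real n) = (L * real n) ^ (2 * n)"
        using powr_realpow[of "L * real n" "2 * n"] Ln by simp
      also have "\<dots> = (L\<^sup>2) ^ n * real n ^ (2 * n)"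
        by (simp add: power_mult_distrib power_mult)
      also have "\<dots> \<le> (L\<^sup>2) ^ n * (fact (2 * n) * exp (2 * real n))"
      proof (intro mult_left_mono)
        have "real n ^ (2 * n) \<le> (2 * real n) ^ (2 * n)" by (intro power_mono) auto
        also have "\<dots> \<le> fact (2 * n) * exp (2 * real n)" by (rule power_le_fact_exp) simp
        finally show "real n ^ (2 * n) \<le> fact (2 * n) * exp (2 * real n)" .
      qed simp
      also have "exp (2 * real n) = exp 2 ^ n" by (simp add: exp_of_nat2_mult)
      finally have 1: "(L * real n) powr (2 * real n) \<le> (L\<^sup>2) ^ n * (fact (2 * n) * exp 2 ^ n)" .
      have "ln (L * real n) \<le> L * real n" using ln_le_minus_one[of "L * real n"] Ln by linarith
      then have "c * b * ln (L * real n) \<le> c * b * (L * real n)" using b c by (intro mult_left_mono) auto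
      then have "(L * real n) powr (c * b) \<le> exp (c * b * (L * real n))" using Ln by (simp add: powr_def)
      also have "\<dots> = exp (c * b * L) ^ n" by (simp add: exp_of_nat2_mult[symmetric] mult.assoc)
      finally have 2: "(L * real n) powr (c * b) \<le> exp (c * b * L) ^ n" .
      show "(L * real n) powr (2 * real n + c * b) \<le> (L\<^sup>2) ^ n * (fact (2 * n) * exp 2 ^ n) * exp (c * b * L) ^ n"
        unfolding powr_add by (intro mult_mono 1 2) auto
    qed (simp add: A_def)
    also have "\<dots> = A * B ^ n * fact (2 * n)"
      by (simp only: B_def power_mult_distrib mult_ac)
    finally show ?case .
  qed
  moreover have "A > 0" "B > 0" using C(1) G L by (auto simp: A_def B_def)
  ultimately show ?thesis by blast
qed

lemma Gamma_moment_powr_summable: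
  fixes a b c :: real
  assumes "a > 0" "b > 0" "c > 0" "a * c \<le> 2"
  shows "\<exists>\<delta>>0. summable (\<lambda>n. \<delta> ^ (2 * n) * (gamma_moment a b n powr c) / fact (2 * n))"
proof -
  obtain A B where AB: "A > 0" "B > 0" "\<forall>\<^sub>F n in sequentially. gamma_moment a b n powr c \<le> A * B ^ n * fact (2 * n)"
    using Gamma_moment_powr_bound[OF assms] by blast
  \<comment> \<open>With \<open>\<delta>\<^sup>2 * B = 1 / 2\<close> the series is dominated by a
    geometric one.\<close>
  define \<delta> where "\<delta> = sqrt (1 / (2 * B))"
  have \<delta>: "\<delta> > 0" "\<delta>\<^sup>2 = 1 / (2 * B)" using AB by (auto simp: \<delta>_def)
  have "summable (\<lambda>n. \<delta> ^ (2 * n) * (gamma_moment a b n powr c) / fact (2 * n))"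
  proof (rule summable_comparison_test_ev)
    show "summable (\<lambda>n. A * (1 / 2) ^ n)" by (intro summable_mult summable_geometric) auto
    show "\<forall>\<^sub>F n in sequentially. norm (\<delta> ^ (2 * n) * (gamma_moment a b n powr c) / fact (2 * n)) \<le> A * (1 / 2) ^ n"
      using AB(3)
    proof eventually_elim
      case (elim n)
      have "norm (\<delta> ^ (2 * n) * (gamma_moment a b n powr c) / fact (2 * n)) = \<delta> ^ (2 * n) * (gamma_moment a b n powr c) / fact (2 * n)"
        using \<delta> by simp
      also have "\<dots> \<le> \<delta> ^ (2 * n) * (A * B ^ n * fact (2 * n)) / fact (2 * n)"
        using elim \<delta> by (intro divide_right_mono mult_left_mono) auto
      also have "\<dots> = A * (\<delta>\<^sup>2 * B) ^ n" by (simp add: power_mult power_mult_distrib)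
      also have "\<delta>\<^sup>2 * B = 1 / 2" using AB by (simp add: \<delta>)
      finally show ?case .
    qed
  qed
  then show ?thesis using \<delta> by blast
qed

section \<open>Complex Gamma powers as characteristic functions\<close>

lemma has_mgf_char:
  assumes "has_bochner_integral M (\<lambda>y. exp (\<i> * of_real x * of_real y)) w"
  shows "char M x = w"
  using assms by (simp add: char_def has_bochner_integral_iff mult.assoc)

lemma Gamma_ratio_power_holomorphic:
  fixes a b c :: real
  assumes a: "a > 0" and b: "b > 0"
  shows "(\<lambda>z. Gamma_ratio_power (of_real a * z + of_real b) b c) holomorphic_on {z. Re z > - (b / a)}"
proof -
  have "of_real a * z + of_real b \<notin> (\<real>\<^sub>\<le>\<^sub>0 :: complex set)" if "Re z > - (b / a)" for z
    using that a by (auto simp: complex_nonpos_Reals_iff field_simps)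
  then have "(ln_Gamma \<circ> (\<lambda>z. of_real a * z + of_real b)) holomorphic_on {z. Re z > - (b / a)}"
    by (intro holomorphic_on_compose_gen[where t = "- \<real>\<^sub>\<le>\<^sub>0"] ln_Gamma_branch(1) holomorphic_intros) auto
  then show ?thesis
    unfolding Gamma_ratio_power_def Gamma_power_def o_def by (intro holomorphic_intros) auto
qed

lemma Gamma_power_of_real:
  assumes "x > 0"
  shows "Gamma_power (of_real x) c = of_real (Gamma x powr c)"
  using assms Gamma_real_nonzero[OF assms]
  by (simp add: Gamma_power_def ln_Gamma_complex_of_real ln_Gamma_real_pos powr_def exp_of_real[symmetric] del: exp_of_real)

text \<open>The modulus sees only the real part of the logarithm, which is the same for every
  branch.\<close>

lemma norm_Gamma_power:
  assumes "z \<notin> \<real>\<^sub>\<le>\<^sub>0"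
  shows "norm (Gamma_power z c) = norm (Gamma z) powr c"
proof -
  have "norm (Gamma z) = exp (Re (ln_Gamma z))"
    using ln_Gamma_branch(2)[OF assms] by (metis norm_exp_eq_Re)
  then show ?thesis by (simp add: Gamma_power_def powr_def)
qed

lemma has_mgf_Gamma_complex:
  fixes a b c :: real
  assumes a: "a > 0" and b: "b > 0"
    and M: "has_mgf M (b / a) (\<lambda>r. (Gamma (a * r + b) / Gamma b) powr c)" and z: "Re z > - (b / a)"
  shows "has_bochner_integral M (\<lambda>x. exp (z * of_real x)) (Gamma_ratio_power (of_real a * z + of_real b) b c)"
proof (rule has_mgf_complex[OF _ M Gamma_ratio_power_holomorphic[OF a b] _ z])
  fix r assume "r > - (b / a)"
  then have r: "a * r + b > 0" using a by (simp add: field_simps)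
  have "complex_of_real a * of_real r + of_real b = of_real (a * r + b)" by simp
  then show "Gamma_ratio_power (of_real a * of_real r + of_real b) b c = complex_of_real ((Gamma (a * r + b) / Gamma b) powr c)"
    using Gamma_power_of_real[OF r, of c] Gamma_power_of_real[OF b, of c]
    by (simp only: Gamma_ratio_power_def powr_divide of_real_divide)
qed (use a b in simp)

lemma char_Gamma:
  fixes a b c :: real
  assumes a: "a > 0" and b: "b > 0"
    and M: "has_mgf M (b / a) (\<lambda>r. (Gamma (a * r + b) / Gamma b) powr c)"
  shows "char M x = Gamma_ratio_power (of_real b + \<i> * of_real a * of_real x) b c"
proof (rule has_mgf_char)
  have "Re (\<i> * complex_of_real x) > - (b / a)" using a b by simp
  from has_mgf_Gamma_complex[OF a b M this]
  show "has_bochner_integral M (\<lambda>y. exp (\<i> * of_real x * of_real y)) (Gamma_ratio_power (of_real b + \<i> * of_real a * of_real x) b c)"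
    by (simp add: algebra_simps)
qed

lemma norm_char_Gamma:
  fixes a b c :: real
  assumes a: "a > 0" and b: "b > 0"
    and M: "has_mgf M (b / a) (\<lambda>r. (Gamma (a * r + b) / Gamma b) powr c)"
  shows "norm (char M x) = (norm (Gamma (of_real b + \<i> * of_real (a * x))) / Gamma b) powr c"
proof -
  have "of_real b + \<i> * complex_of_real a * of_real x \<notin> \<real>\<^sub>\<le>\<^sub>0"
    using b by (auto simp: complex_nonpos_Reals_iff)
  from norm_Gamma_power[OF this, of c] show ?thesis
    unfolding char_Gamma[OF a b M] Gamma_ratio_power_def
    using Gamma_power_of_real[OF b, of c] Gamma_real_pos[OF b]
    by (simp add: norm_divide powr_divide mult.assoc abs_of_nonneg)
qed

text \<open>For \<open>a = c = 1\<close> the Gamma quotient on the imaginary axis is a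
  characteristic function and hence bounded by 1.\<close>

lemma norm_Gamma_le:
  fixes b y :: real
  assumes b: "b > 0"
  shows "norm (Gamma (of_real b + \<i> * of_real y)) \<le> Gamma b"
proof -
  obtain M where M: "has_mgf M (b / 1) (\<lambda>r. (Gamma (1 * r + b) / Gamma b) powr 1)"
    using is_mgf_Gamma_ratio_powr[of 1 b 1] b unfolding is_mgf_def by auto
  have "norm (char M y) \<le> 1"
    by (rule real_distribution.cmod_char_le_1[OF has_mgfD(1)[OF M]])
  then have "(norm (Gamma (of_real b + \<i> * of_real (1 * y))) / Gamma b) powr 1 \<le> 1"
    unfolding norm_char_Gamma[OF zero_less_one b M] .
  then show ?thesis using Gamma_real_pos[OF b] by (simp add: divide_le_eq)
qed

text \<open>\<open>N\<close> applications of the functional equation: each factor of the Pochhammer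
  product has modulus at least \<open>\<bar>y\<bar>\<close>, and the shifted Gamma value is bounded
  on its vertical line.\<close>

lemma norm_Gamma_decay:
  fixes b y :: real
  assumes b: "b > 0"
  shows "norm (Gamma (of_real b + \<i> * of_real y)) * \<bar>y\<bar> ^ N \<le> Gamma (b + real N)"
proof -
  let ?z = "of_real b + \<i> * complex_of_real y"
  have "?z \<notin> \<int>\<^sub>\<le>\<^sub>0" using b nonpos_Ints_subset_nonpos_Reals by (force simp: complex_nonpos_Reals_iff)
  then have "Gamma (?z + of_nat N) = pochhammer ?z N * Gamma ?z"
    by (simp add: pochhammer_Gamma Gamma_eq_zero_iff)
  then have "norm (Gamma (?z + of_nat N)) = norm (pochhammer ?z N) * norm (Gamma ?z)"
    by (simp only: norm_mult)
  moreover have "\<bar>y\<bar> ^ N \<le> norm (pochhammer ?z N)"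
  proof -
    have "\<bar>y\<bar> ^ N = (\<Prod>i<N. \<bar>y\<bar>)" by simp
    also have "\<dots> \<le> (\<Prod>i<N. norm (?z + of_nat i))"
    proof (intro prod_mono conjI)
      fix i
      show "\<bar>y\<bar> \<le> norm (?z + of_nat i)" using abs_Im_le_cmod[of "?z + of_nat i"] by simp
    qed simp
    finally show ?thesis by (simp add: pochhammer_prod prod_norm atLeast0LessThan)
  qed
  then have "norm (Gamma ?z) * \<bar>y\<bar> ^ N \<le> norm (pochhammer ?z N) * norm (Gamma ?z)"
    by (subst mult.commute) (rule mult_right_mono, simp_all)
  moreover have "norm (Gamma (?z + of_nat N)) \<le> Gamma (b + real N)"
    using norm_Gamma_le[of "b + real N" y] b by (simp add: add_ac add_pos_nonneg)
  ultimately show ?thesis by simp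
qed

text \<open>Decay of order \<open>N * c\<close> is available for every \<open>N\<close>;
  \<open>N * c \<ge> k + 2\<close> leaves \<open>1 / x\<^sup>2\<close> after multiplication by the
  \<open>k\<close>-th power.\<close>

lemma all_moments_char_Gamma:
  fixes a b c :: real
  assumes a: "a > 0" and b: "b > 0" and c: "c > 0"
    and M: "has_mgf M (b / a) (\<lambda>r. (Gamma (a * r + b) / Gamma b) powr c)"
  shows "all_moments (\<lambda>x. char M (- x))"
  unfolding all_moments_def
proof (intro conjI allI)
  interpret real_distribution M using M by (rule has_mgfD)
  show meas: "(\<lambda>x. char M (- x)) \<in> borel_measurable borel" by measurable
  fix k
  obtain N :: nat where N: "(real k + 2) / c \<le> real N" using real_arch_simple by blast
  then have cN: "real k + 2 \<le> real N * c" using c by (simp add: field_simps)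
  define C where "C = (Gamma (b + real N) / (Gamma b * a ^ N)) powr c"
  have C: "C \<ge> 0" by (simp add: C_def)
  have G: "Gamma b > 0" using b by simp
  have large: "\<bar>x\<bar> ^ k * norm (char M (- x)) \<le> C / x\<^sup>2" if x: "\<bar>x\<bar> \<ge> 1" for x
  proof -
    have x0: "\<bar>x\<bar> > 0" using x by linarith
    have "norm (Gamma (of_real b + \<i> * of_real (a * (- x)))) * \<bar>a * (- x)\<bar> ^ N \<le> Gamma (b + real N)"
      by (rule norm_Gamma_decay[OF b])
    then have "norm (Gamma (of_real b + \<i> * of_real (a * (- x)))) \<le> Gamma (b + real N) / (a ^ N * \<bar>x\<bar> ^ N)"
      using a x0 by (simp add: pos_le_divide_eq power_mult_distrib abs_mult)
    then have "norm (Gamma (of_real b + \<i> * of_real (a * (- x)))) / Gamma b \<le> Gamma (b + real N) / (a ^ N * \<bar>x\<bar> ^ N) / Gamma b"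
      using G by (intro divide_right_mono) auto
    also have "\<dots> = Gamma (b + real N) / (Gamma b * a ^ N) / \<bar>x\<bar> ^ N" by (simp add: field_simps)
    finally have "norm (char M (- x)) \<le> (Gamma (b + real N) / (Gamma b * a ^ N) / \<bar>x\<bar> ^ N) powr c"
      unfolding norm_char_Gamma[OF a b M] using G c by (intro powr_mono2) auto
    also have "\<dots> = C / \<bar>x\<bar> powr (real N * c)"
      using x0 by (simp only: C_def powr_divide powr_realpow[symmetric] powr_powr)
    also have "\<dots> \<le> C / \<bar>x\<bar> powr (real k + 2)"
      using C x x0 cN by (intro divide_left_mono powr_mono mult_pos_pos) auto
    also have "\<bar>x\<bar> powr (real k + 2) = \<bar>x\<bar> ^ k * x\<^sup>2"
      using x0 powr_realpow[of "\<bar>x\<bar>" 2] by (simp add: powr_add powr_realpow)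
    finally have "\<bar>x\<bar> ^ k * norm (char M (- x)) \<le> \<bar>x\<bar> ^ k * (C / (\<bar>x\<bar> ^ k * x\<^sup>2))"
      by (rule mult_left_mono) simp
    then show ?thesis using x0 by simp
  qed
  \<comment> \<open>One integrable majorant for both ranges: the constant \<open>2 * (C + 1)\<close>
    covers the trivial bound 1 for \<open>\<bar>x\<bar> < 1\<close> and \<open>C / x\<^sup>2\<close>
    elsewhere.\<close>
  have bound: "\<bar>x\<bar> ^ k * norm (char M (- x)) \<le> 2 * (C + 1) * inverse (1 + x\<^sup>2)" for x
  proof (cases "\<bar>x\<bar> \<ge> 1")
    case True
    then have x2: "x\<^sup>2 \<ge> 1" using abs_le_square_iff[of 1 x] by simp
    have "C / x\<^sup>2 \<le> 2 * (C + 1) / (1 + x\<^sup>2)"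
    proof -
      have "C * (1 + x\<^sup>2) \<le> 2 * (C + 1) * x\<^sup>2"
        using C x2 mult_left_mono[OF x2 C] by (simp add: algebra_simps)
      moreover have "x\<^sup>2 > 0" "1 + x\<^sup>2 > 0" using x2 by linarith+
      ultimately show ?thesis by (simp only: divide_le_eq pos_divide_le_eq pos_le_divide_eq if_True times_divide_eq_left)
    qed
    then show ?thesis using large[OF True] by (simp add: divide_inverse)
  next
    case False
    have "\<bar>x\<bar> ^ k * norm (char M (- x)) \<le> 1 * 1"
      using False cmod_char_le_1[of "-x"] by (intro mult_mono power_le_one) auto
    also have "\<dots> \<le> 2 * (C + 1) * inverse (1 + x\<^sup>2)"
    proof -
      have "x\<^sup>2 \<le> 1" using False abs_square_le_1[of x] by simp
      then have "inverse (1 + x\<^sup>2) \<ge> inverse 2" by (intro le_imp_inverse_le) (auto simp: add_pos_nonneg)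
      then have "2 * (C + 1) * inverse (1 + x\<^sup>2) \<ge> 2 * (C + 1) * inverse 2" using C by (intro mult_left_mono) auto
      moreover have "2 * (C + 1) * inverse 2 = C + 1" by simp
      ultimately show ?thesis using C by linarith
    qed
    finally show ?thesis .
  qed
  have "integrable lborel (\<lambda>x::real. inverse (1 + x\<^sup>2))"
    using integrable_inverse_1_plus_square by (simp add: set_integrable_def einterval_eq_UNIV)
  then have "integrable lborel (\<lambda>x::real. 2 * (C + 1) * inverse (1 + x\<^sup>2))" by (rule integrable_mult_right)
  then show "integrable lborel (\<lambda>x. \<bar>x\<bar> ^ k * norm (char M (- x)))"
  proof (rule Bochner_Integration.integrable_bound)
    show "AE x in lborel. norm (\<bar>x\<bar> ^ k * norm (char M (- x))) \<le> norm (2 * (C + 1) * inverse (1 + x\<^sup>2))"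
      using bound C by (intro AE_I2) (simp add: abs_mult abs_of_nonneg add_nonneg_nonneg)
  qed (use meas in measurable)
qed

section \<open>The convolution semigroup\<close>

text \<open>The real transform fixes its holomorphic extension and thereby the characteristic
  function.\<close>

lemma has_mgf_unique:
  assumes \<rho>: "\<rho> > 0" and M: "has_mgf M \<rho> \<Phi>" and N: "has_mgf N \<rho> \<Phi>"
  shows "M = N"
proof (rule Levy_uniqueness)
  have eq: "(\<integral>x. exp (complex_of_real r * of_real x) \<partial>N) = of_real (\<Phi> r)" if "r > -\<rho>" for r
  proof -
    have "(\<integral>x. exp (complex_of_real r * of_real x) \<partial>N) = (\<integral>x. complex_of_real (exp (r * x)) \<partial>N)"
      by (simp add: exp_of_real[symmetric] del: exp_of_real)
    also have "\<dots> = of_real (\<Phi> r)"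
      using has_mgfD(3)[OF N that] by (simp del: of_real_exp)
    finally show ?thesis .
  qed
  show "char M = char N"
  proof
    fix x
    have "has_bochner_integral M (\<lambda>y. exp (\<i> * of_real x * of_real y)) (\<integral>y. exp (\<i> * of_real x * of_real y) \<partial>N)"
      by (rule has_mgf_complex[OF \<rho> M has_mgf_complex_holomorphic[OF \<rho> N] eq]) (use \<rho> in auto)
    then have "char M x = (\<integral>y. exp (\<i> * of_real x * of_real y) \<partial>N)"
      by (rule has_mgf_char)
    then show "char M x = char N x" by (simp add: char_def mult.assoc)
  qed
qed (use has_mgfD(1)[OF M] has_mgfD(1)[OF N] in auto)

section \<open>Images under the exponential function\<close>

definition exp_law :: "real measure \<Rightarrow> real measure" where
  "exp_law M = distr M (restrict_space borel {0<..}) exp"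

lemma borel_measure_on_exp_law: "borel_measure_on {0<..} (exp_law M)"
  by (simp add: borel_measure_on_def exp_law_def)

lemma measurable_exp_law:
  fixes M :: "real measure"
  assumes "sets M = sets borel"
  shows "exp \<in> M \<rightarrow>\<^sub>M restrict_space borel {0<..}"
  unfolding measurable_cong_sets[OF assms refl] by (rule measurable_restrict_space2) auto

lemma (in real_distribution) prob_space_exp_law: "prob_space (exp_law M)"
  unfolding exp_law_def by (rule prob_space_distr[OF measurable_exp_law]) simp

lemma (in real_distribution) integral_exp_law:
  fixes f :: "real \<Rightarrow> 'a :: {banach, second_countable_topology}"
  assumes "f \<in> borel_measurable (restrict_space borel {0<..})"
  shows "(\<integral>t. f t \<partial>exp_law M) = (\<integral>x. f (exp x) \<partial>M)"
  unfolding exp_law_def by (rule integral_distr[OF measurable_exp_law assms]) simp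

lemma (in real_distribution) has_bochner_integral_exp_law:
  fixes f :: "real \<Rightarrow> 'a :: {banach, second_countable_topology}"
  assumes "f \<in> borel_measurable (restrict_space borel {0<..})" "has_bochner_integral M (\<lambda>x. f (exp x)) w"
  shows "has_bochner_integral (exp_law M) f w"
  using assms(2) unfolding has_bochner_integral_iff integral_exp_law[OF assms(1)]
  unfolding exp_law_def by (subst integrable_distr_eq[OF measurable_exp_law assms(1)]) auto

lemma exp_law_distr_ln:
  assumes "borel_measure_on {0<..} T" "prob_space T"
  shows "real_distribution (distr T borel ln)" and "exp_law (distr T borel ln) = T"
proof -
  have sets: "sets T = sets (restrict_space borel {0<..})"
    using assms(1) by (simp add: borel_measure_on_def)
  have space: "space T = {0<..}"
    using sets_eq_imp_space_eq[OF sets] by (simp add: space_restrict_space)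
  have ln: "ln \<in> borel_measurable T"
    unfolding measurable_cong_sets[OF sets refl] by (rule measurable_restrict_space1) measurable
  show "real_distribution (distr T borel ln)"
    by (rule prob_space.real_distribution_distr[OF assms(2) ln])
  have "exp_law (distr T borel ln) = distr T (restrict_space borel {0<..}) (exp \<circ> ln)"
    unfolding exp_law_def by (rule distr_distr[OF measurable_exp_law ln]) simp
  also have "\<dots> = distr T T (\<lambda>t. t)"
    by (rule distr_cong) (auto simp: sets space)
  also have "\<dots> = T" by (rule distr_id)
  finally show "exp_law (distr T borel ln) = T" .
qed

lemma Cc_pos_measurable: "Cc_pos f \<Longrightarrow> f \<in> borel_measurable (restrict_space borel {0<..})"
  by (rule borel_measurable_continuous_on_restrict) (simp add: Cc_pos_def)

lemma Cc_pos_exp_continuous: "Cc_pos f \<Longrightarrow> continuous_on UNIV (\<lambda>x. f (exp x))"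
  by (rule continuous_on_compose2[of "{0<..}" f]) (auto simp: Cc_pos_def intro!: continuous_intros)

lemma Cc_pos_exp_bounded:
  assumes "Cc_pos f"
  shows "\<exists>B. \<forall>x. \<bar>f (exp x)\<bar> \<le> B"
proof -
  obtain K where K: "compact K" "K \<subseteq> {0<..}" "\<And>t. t \<in> {0<..} - K \<Longrightarrow> f t = 0"
    using assms by (auto simp: Cc_pos_def)
  have "continuous_on {0<..} f"
    using assms by (simp add: Cc_pos_def)
  then have "continuous_on K f"
    using K(2) by (rule continuous_on_subset)
  then have "compact (f ` K)"
    using K(1) by (rule compact_continuous_image)
  then have "bounded (f ` K)" by (rule compact_imp_bounded)
  then obtain B where B': "\<forall>y\<in>f ` K. norm y \<le> B"
    unfolding bounded_iff ..
  have B: "norm (f t) \<le> B" if "t \<in> K" for t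
    by (rule bspec[OF B' imageI[OF that]])
  have "\<bar>f (exp x)\<bar> \<le> max B 0" for x
    using B[of "exp x"] K(3)[of "exp x"] by (cases "exp x \<in> K") auto
  then show ?thesis by blast
qed

text \<open>\<open>exp\<close> turns sums into products, and test functions composed with it are
  bounded and measurable, so Fubini applies.\<close>

lemma is_product_convolution_exp_law:
  assumes "real_distribution M" "real_distribution N"
  shows "is_product_convolution (exp_law M) (exp_law N) (exp_law (M \<star> N))"
  unfolding is_product_convolution_def
proof (intro allI impI)
  interpret M: real_distribution M by fact
  interpret N: real_distribution N by fact
  interpret pair_prob_space M N ..
  fix f assume f: "Cc_pos f"
  define g where "g x = f (exp x)" for x
  obtain B where B': "\<forall>x. \<bar>f (exp x)\<bar> \<le> B" using Cc_pos_exp_bounded[OF f] ..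
  then have B: "\<bar>g x\<bar> \<le> B" for x unfolding g_def by (rule spec)
  have [measurable]: "g \<in> borel_measurable borel"
    unfolding g_def[abs_def] by (rule borel_measurable_continuous_onI[OF Cc_pos_exp_continuous[OF f]])
  define h where "h y = (\<integral>x. g (x + y) \<partial>M)" for y
  have [measurable]: "h \<in> borel_measurable borel" unfolding h_def by measurable
  have sum: "(\<lambda>(x, y). x + y) \<in> borel_measurable (M \<Otimes>\<^sub>M N)" by measurable
  have "real_distribution (M \<star> N)"
    unfolding convolution_def by (rule P.real_distribution_distr[OF sum])
  then have "(\<integral>t. f t \<partial>exp_law (M \<star> N)) = (\<integral>x. g x \<partial>(M \<star> N))"
    unfolding g_def by (intro real_distribution.integral_exp_law Cc_pos_measurable f)
  also have "\<dots> = (\<integral>(x, y). g (x + y) \<partial>(M \<Otimes>\<^sub>M N))"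
    unfolding convolution_def by (subst integral_distr[OF sum]) (auto simp: case_prod_unfold)
  also have "\<dots> = (\<integral>y. h y \<partial>N)"
  proof -
    have "integrable (M \<Otimes>\<^sub>M N) (\<lambda>(x, y). g (x + y))"
      by (rule P.integrable_const_bound[of _ B]) (use B in auto)
    from integral_snd[OF this] show ?thesis by (simp add: h_def)
  qed
  also have "\<dots> = (\<integral>s. (\<integral>t. f (t * s) \<partial>exp_law M) \<partial>exp_law N)"
  proof -
    have inner: "(\<integral>t. f (t * s) \<partial>exp_law M) = h (ln s)" if s: "s > 0" for s
    proof -
      have "(\<integral>t. f (t * s) \<partial>exp_law M) = (\<integral>x. f (exp x * s) \<partial>M)"
      proof (rule M.integral_exp_law)
        have "continuous_on {0<..} (\<lambda>t. f (t * s))"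
          by (rule continuous_on_compose2[of "{0<..}" f]) (use f s in \<open>auto simp: Cc_pos_def intro!: continuous_intros\<close>)
        then show "(\<lambda>t. f (t * s)) \<in> borel_measurable (restrict_space borel {0<..})"
          by (rule borel_measurable_continuous_on_restrict)
      qed
      then show ?thesis using s by (simp add: h_def g_def exp_add)
    qed
    \<comment> \<open>Measurability of the inner integral in \<open>s\<close> is read off from its
      form \<open>h (ln s)\<close>.\<close>
    have "(\<lambda>s. \<integral>t. f (t * s) \<partial>exp_law M) \<in> borel_measurable (restrict_space borel {0<..}) \<longleftrightarrow>
        (\<lambda>s. h (ln s)) \<in> borel_measurable (restrict_space borel {0<..})"
      by (rule measurable_cong) (simp add: space_restrict_space inner)
    moreover have "(\<lambda>s. h (ln s)) \<in> borel_measurable (restrict_space borel {0<..})"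
      by (rule measurable_restrict_space1) measurable
    ultimately have "(\<lambda>s. \<integral>t. f (t * s) \<partial>exp_law M) \<in> borel_measurable (restrict_space borel {0<..})"
      by blast
    from N.integral_exp_law[OF this] show ?thesis by (simp add: inner)
  qed
  finally show "(\<integral>t. f t \<partial>exp_law (M \<star> N)) = (\<integral>s. (\<integral>t. f (t * s) \<partial>exp_law M) \<partial>exp_law N)" .
qed

text \<open>Levy continuity, applied along sequences tending to 0 from the right, yields the point
  mass at 0, whose image is the point mass at 1.\<close>

lemma vaguely_tends_to_exp_law:
  assumes M: "\<And>c. c > 0 \<Longrightarrow> real_distribution (M c)"
    and char: "\<And>x. ((\<lambda>c. char (M c) x) \<longlongrightarrow> 1) (at_right 0)"
  shows "vaguely_tends_to (\<lambda>c. exp_law (M c)) (return (restrict_space borel {0<..}) 1) (at_right (0::real))"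
  unfolding vaguely_tends_to_def
proof (intro allI impI)
  fix f assume f: "Cc_pos f"
  define g where "g x = f (exp x)" for x
  obtain B where B': "\<forall>x. \<bar>f (exp x)\<bar> \<le> B" using Cc_pos_exp_bounded[OF f] ..
  then have B: "\<bar>g x\<bar> \<le> B" for x unfolding g_def by (rule spec)
  have g: "continuous_on UNIV g"
    unfolding g_def[abs_def] by (rule Cc_pos_exp_continuous[OF f])
  interpret R: prob_space "return borel (0::real)" by (rule prob_space_return) simp
  have R: "real_distribution (return borel 0)" by unfold_locales auto
  show "((\<lambda>c. \<integral>t. f t \<partial>exp_law (M c)) \<longlongrightarrow> (\<integral>t. f t \<partial>return (restrict_space borel {0<..}) 1)) (at_right 0)"
    unfolding tendsto_at_iff_sequentially
  proof (intro allI impI)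
    fix X :: "nat \<Rightarrow> real" assume X: "\<forall>i. X i \<in> {0<..} - {0}" "X \<longlonglongrightarrow> 0"
    then have dist: "real_distribution (M (X n))" for n by (intro M) auto
    have "weak_conv_m (\<lambda>n. M (X n)) (return borel 0)"
    proof (rule levy_continuity[OF dist R])
      fix x
      have "(\<lambda>n. char (M (X n)) x) \<longlonglongrightarrow> 1"
        using char[of x] X unfolding tendsto_at_iff_sequentially o_def by blast
      then show "(\<lambda>n. char (M (X n)) x) \<longlonglongrightarrow> char (return borel 0) x"
        by (simp add: char_def integral_return)
    qed
    from weak_conv_imp_integral_bdd_continuous_conv[OF dist R this, of g B]
    have "(\<lambda>n. \<integral>x. g x \<partial>M (X n)) \<longlonglongrightarrow> (\<integral>x. g x \<partial>return borel 0)"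
      using g B by (auto simp: continuous_on_eq_continuous_at)
    moreover have "(\<integral>x. g x \<partial>return borel 0) = (\<integral>t. f t \<partial>return (restrict_space borel {0<..}) 1)"
    proof -
      have "(\<integral>x. g x \<partial>return borel 0) = g 0"
        by (rule integral_return) (use borel_measurable_continuous_onI[OF g] in auto)
      moreover have "(\<integral>t. f t \<partial>return (restrict_space borel {0<..}) 1) = f 1"
        by (rule integral_return[OF _ Cc_pos_measurable[OF f]]) (simp add: space_restrict_space)
      ultimately show ?thesis by (simp add: g_def)
    qed
    moreover have "(\<integral>t. f t \<partial>exp_law (M (X n))) = (\<integral>x. g x \<partial>M (X n))" for n
      unfolding g_def by (rule real_distribution.integral_exp_law[OF dist Cc_pos_measurable[OF f]])
    ultimately show "((\<lambda>c. \<integral>t. f t \<partial>exp_law (M c)) \<circ> X) \<longlonglongrightarrow> (\<integral>t. f t \<partial>return (restrict_space borel {0<..}) 1)"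
      by (simp add: o_def)
  qed
qed

section \<open>Mellin transform, moments and density of the image law\<close>

lemma measurable_powr_complex:
  "(\<lambda>t. complex_of_real t powr z) \<in> borel_measurable (restrict_space borel {0<..})"
proof (rule borel_measurable_continuous_on_restrict)
  show "continuous_on {0<..} (\<lambda>t. complex_of_real t powr z)"
    by (intro continuous_intros) (auto simp: complex_nonpos_Reals_iff)
qed

lemma of_real_powr_complex: "t > 0 \<Longrightarrow> complex_of_real t powr z = exp (z * of_real (ln t))"
  by (simp add: powr_def Ln_of_real)

context
  fixes a b c :: real and M :: "real measure"
  assumes a: "a > 0" and b: "b > 0" and c: "c > 0"
    and M: "has_mgf M (b / a) (\<lambda>r. (Gamma (a * r + b) / Gamma b) powr c)"
begin

interpretation real_distribution M using M by (rule has_mgfD)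

lemma Mellin_exp_law:
  assumes "Re z > - b / a"
  shows "has_bochner_integral (exp_law M) (\<lambda>t. complex_of_real t powr z)
          (Gamma_ratio_power (of_real a * z + of_real b) b c)"
proof (rule has_bochner_integral_exp_law[OF measurable_powr_complex])
  show "has_bochner_integral M (\<lambda>x. complex_of_real (exp x) powr z) (Gamma_ratio_power (of_real a * z + of_real b) b c)"
    using has_mgf_Gamma_complex[OF a b M, of z] assms by (simp add: of_real_powr_complex del: of_real_exp)
qed

lemma moment_has_mgf_Gamma:
  "has_bochner_integral M (\<lambda>x. exp x ^ n) (gamma_moment a b n powr c)"
proof -
  have "b / a > 0" using a b by simp
  then have "real n > - (b / a)" by linarith
  then show ?thesis
    using M unfolding has_mgf_def gamma_moment_def by (auto simp: exp_of_nat_mult)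
qed

lemma has_moments_exp_law: "has_moments (exp_law M) (\<lambda>n. gamma_moment a b n powr c)"
  unfolding has_moments_def
  by (intro allI has_bochner_integral_exp_law moment_has_mgf_Gamma measurable_restrict_space1) measurable

text \<open>Solutions of the moment problem live on the closed half-line, and a measure carries its
  space, so the image is formed once more with that target.\<close>

lemma Stieltjes_exp:
  defines "\<mu> \<equiv> distr M (restrict_space borel {0..}) exp"
  shows "borel_measure_on {0..} \<mu>" "has_moments \<mu> (\<lambda>n. gamma_moment a b n powr c)"
proof -
  show "borel_measure_on {0..} \<mu>" by (simp add: borel_measure_on_def \<mu>_def)
  have exp: "exp \<in> M \<rightarrow>\<^sub>M restrict_space borel {0..}"
    unfolding measurable_cong_sets[OF events_eq_borel refl] by (rule measurable_restrict_space2) auto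
  have "has_bochner_integral \<mu> (\<lambda>t. t ^ n) (gamma_moment a b n powr c)" for n
  proof -
    have m: "(\<lambda>t::real. t ^ n) \<in> borel_measurable (restrict_space borel {0..})"
      by (rule measurable_restrict_space1) measurable
    show ?thesis
      using moment_has_mgf_Gamma[of n] unfolding has_bochner_integral_iff \<mu>_def
        integral_distr[OF exp m] integrable_distr_eq[OF exp m] .
  qed
  then show "has_moments \<mu> (\<lambda>n. gamma_moment a b n powr c)" by (simp add: has_moments_def)
qed

lemma S_determinate_Gamma_powr:
  assumes "a * c \<le> 2"
  shows "S_determinate (\<lambda>n. gamma_moment a b n powr c)"
proof -
  obtain \<delta> where \<delta>: "\<delta> > 0" "summable (\<lambda>n. \<delta> ^ (2 * n) * (gamma_moment a b n powr c) / fact (2 * n))"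
    using Gamma_moment_powr_summable[OF a b c assms] by blast
  have s0: "gamma_moment a b 0 powr c = 1"
    using Gamma_real_nonzero[OF b] by (simp add: gamma_moment_def)
  have "Stieltjes_exponential \<mu> (\<lambda>n. gamma_moment a b n powr c) \<delta>"
    if "borel_measure_on {0..} \<mu>" "has_moments \<mu> (\<lambda>n. gamma_moment a b n powr c)" for \<mu>
    using that s0 \<delta> by unfold_locales auto
  then show ?thesis
    unfolding S_determinate_def using Stieltjes_exp Stieltjes_moments_unique by blast
qed

text \<open>The sign in \<open>b - \<i> * a * x\<close> makes the Gamma factor the value of the
  characteristic function at \<open>-x\<close>.\<close>

lemma e_integrand_eq:
  assumes "t > 0"
  shows "e_integrand a b c t = (\<lambda>x. char M (- x) * exp ((\<i> * of_real x - of_real 1) * of_real (ln t)))"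
  using assms by (auto simp: e_integrand_def of_real_powr_complex char_Gamma[OF a b M] mult.commute)

lemma e_density_eq:
  assumes "t > 0"
  shows "e_density a b c t = 1 / (2 * pi) * power_integral (\<lambda>x. char M (- x)) 1 t"
  by (simp add: e_density_def e_integrand_eq[OF assms] power_integral_def)

lemma integrable_e_integrand:
  assumes t: "t > 0"
  shows "integrable lborel (e_integrand a b c t)"
  unfolding e_integrand_eq[OF t]
proof (rule Bochner_Integration.integrable_bound)
  have "integrable lborel (\<lambda>x. \<bar>x\<bar> ^ 0 * norm (char M (- x)))"
    using all_moments_char_Gamma[OF a b c M] unfolding all_moments_def by blast
  then show "integrable lborel (\<lambda>x. exp (- ln t) * norm (char M (- x)))" by simp
  show "AE x in lborel. norm (char M (- x) * exp ((\<i> * of_real x - of_real 1) * of_real (ln t))) \<le> norm (exp (- ln t) * norm (char M (- x)))"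
    by (simp add: norm_mult mult.commute)
qed measurable

lemma e_density_facts:
  shows "exp_law M = density (restrict_space lborel {0<..}) (\<lambda>t. ennreal (Re (e_density a b c t)))"
    and "probability_density_pos (e_density a b c)"
    and "C_infinity_on {0<..} (e_density a b c)"
proof -
  let ?E = "\<lambda>t. 1 / (2 * pi) * power_integral (\<lambda>x. char M (- x)) 1 t"
  note mom = all_moments_char_Gamma[OF a b c M]
  note E = exp_density[OF mom]
  have [measurable]: "(\<lambda>x. char M (- x)) \<in> borel_measurable borel" by measurable
  have E_meas: "?E \<in> borel_measurable borel"
    unfolding power_integral_eq by measurable
  have space: "space (restrict_space lborel {0<..}) = {0<..}" by (simp add: space_restrict_space)
  have eq: "e_density a b c t = ?E t" if "t \<in> space (restrict_space lborel {0<..})" for t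
    using that e_density_eq[of t] by (simp add: space)
  have meas: "(\<lambda>t. ennreal (Re (?E t))) \<in> borel_measurable (restrict_space lborel {0<..})"
  proof (rule measurable_restrict_space1)
    have "(\<lambda>t. ennreal (Re (?E t))) \<in> borel_measurable borel"
      by (rule measurable_compose[OF E_meas]) measurable
    then show "(\<lambda>t. ennreal (Re (?E t))) \<in> borel_measurable lborel" by simp
  qed
  have meas': "(\<lambda>t. ennreal (Re (e_density a b c t))) \<in> borel_measurable (restrict_space lborel {0<..})"
    using meas by (subst measurable_cong[OF arg_cong[where f = "\<lambda>w. ennreal (Re w)", OF eq]])
  have "density (restrict_space lborel {0<..}) (\<lambda>t. ennreal (Re (?E t))) = density (restrict_space lborel {0<..}) (\<lambda>t. ennreal (Re (e_density a b c t)))"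
    by (rule density_cong[OF meas meas']) (use eq in auto)
  then show "exp_law M = density (restrict_space lborel {0<..}) (\<lambda>t. ennreal (Re (e_density a b c t)))"
    using E(2) by (simp only: exp_law_def)
  have "has_bochner_integral (restrict_space lborel {0<..}) (e_density a b c) 1"
    using E(3) by (subst has_bochner_integral_cong[OF refl eq refl])
  moreover have "e_density a b c t \<in> \<real>\<^sub>\<ge>\<^sub>0" if "t > 0" for t
    using E(1)[OF that] e_density_eq[OF that] by (simp only:)
  ultimately show "probability_density_pos (e_density a b c)"
    by (simp add: probability_density_pos_def)
  \<comment> \<open>The constant moves into the weight, so that the density itself is a power
    integral.\<close>
  have mom': "all_moments (\<lambda>x. 1 / (2 * pi) * char M (- x))"
    using mom unfolding all_moments_def
    by (auto simp: norm_mult norm_divide mult.left_commute[of _ "1 / (2 * pi)"] simp del: times_divide_eq_left times_divide_eq_right)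
  show "C_infinity_on {0<..} (e_density a b c)"
  proof (rule C_infinity_on_cong[OF _ _ C_infinity_on_power_integral[OF mom', of 1]])
    fix t :: real assume "t \<in> {0<..}"
    then show "e_density a b c t = power_integral (\<lambda>x. 1 / (2 * pi) * char M (- x)) 1 t"
      using e_density_eq[of t] by (simp only: power_integral_def mult.assoc integral_mult_right_zero greaterThan_iff)
  qed simp
qed

text \<open>For imaginary \<open>z\<close> the Mellin formula gives the characteristic function of
  the image of \<open>T\<close> under \<open>ln\<close>, and Levy's theorem identifies that image
  with \<open>M\<close>.\<close>

lemma exp_law_unique:
  assumes T: "borel_measure_on {0<..} T" "prob_space T"
    and Mellin: "\<And>z. Re z > - b / a \<Longrightarrow> has_bochner_integral T (\<lambda>t. complex_of_real t powr z)
          (Gamma_ratio_power (of_real a * z + of_real b) b c)"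
  shows "T = exp_law M"
proof -
  have sets: "sets T = sets (restrict_space borel {0<..})"
    using T(1) by (simp add: borel_measure_on_def)
  have space: "space T = {0<..}"
    using sets_eq_imp_space_eq[OF sets] by (simp add: space_restrict_space)
  have ln: "ln \<in> borel_measurable T"
    unfolding measurable_cong_sets[OF sets refl] by (rule measurable_restrict_space1) measurable
  have "char (distr T borel ln) x = char M x" for x
  proof -
    have "char (distr T borel ln) x = (\<integral>t. iexp (x * ln t) \<partial>T)"
      unfolding char_def by (rule integral_distr[OF ln]) measurable
    also have "\<dots> = (\<integral>t. complex_of_real t powr (\<i> * of_real x) \<partial>T)"
      by (rule Bochner_Integration.integral_cong) (auto simp: space of_real_powr_complex mult.assoc)
    also have "\<dots> = char M x"
      using Mellin[of "\<i> * of_real x"] a b by (simp add: has_bochner_integral_iff char_Gamma[OF a b M] algebra_simps)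
    finally show ?thesis .
  qed
  then have "distr T borel ln = M"
    by (intro Levy_uniqueness exp_law_distr_ln[OF T] real_distribution_axioms ext)
  then show ?thesis using exp_law_distr_ln(2)[OF T] by simp
qed

end

theorem theorem1p1:
  fixes a b :: real
  assumes "a > 0" and "b > 0"
  shows "infinitely_divisible_Stieltjes (gamma_moment a b) \<and>
    (\<exists>\<tau>. convolution_semigroup \<tau> \<and> Mellin_formula a b \<tau> \<and>
       (\<forall>\<tau>'. convolution_semigroup \<tau>' \<and> Mellin_formula a b \<tau>' \<longrightarrow> (\<forall>c>0. \<tau>' c = \<tau> c)) \<and>
       (\<forall>c>0. has_moments (\<tau> c) (\<lambda>n. gamma_moment a b n powr c)) \<and>
       (\<forall>c>0.
          (\<forall>t>0. integrable lborel (e_integrand a b c t)) \<and>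
          \<tau> c = density (restrict_space lborel {0<..}) (\<lambda>t. ennreal (Re (e_density a b c t))) \<and>
          probability_density_pos (e_density a b c) \<and>
          C_infinity_on {0<..} (e_density a b c))) \<and>
    (\<forall>c>0. S_determinate (\<lambda>n. gamma_moment a b n powr c) \<longleftrightarrow> a * c \<le> 2)"
proof -
  have a: "a > 0" and b: "b > 0" by fact+
  then have ba: "b / a > 0" by simp
  let ?\<Phi> = "\<lambda>c r. (Gamma (a * r + b) / Gamma b) powr c"
  have "\<forall>c. \<exists>M. c > 0 \<longrightarrow> has_mgf M (b / a) (?\<Phi> c)"
    using is_mgf_Gamma_ratio_powr[OF a b] unfolding is_mgf_def by blast
  then obtain M where M: "\<And>c. c > 0 \<Longrightarrow> has_mgf (M c) (b / a) (?\<Phi> c)"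
    by metis
  define \<tau> where "\<tau> c = exp_law (M c)" for c
  have dist: "real_distribution (M c)" if "c > 0" for c
    using M[OF that] by (rule has_mgfD)
  have "convolution_semigroup \<tau>"
    unfolding convolution_semigroup_def
  proof (intro conjI allI impI)
    fix c :: real assume c: "c > 0"
    show "borel_measure_on {0<..} (\<tau> c)" unfolding \<tau>_def by (rule borel_measure_on_exp_law)
    show "prob_space (\<tau> c)" unfolding \<tau>_def by (rule real_distribution.prob_space_exp_law[OF dist[OF c]])
    fix d :: real assume d: "d > 0"
    have "has_mgf (M c \<star> M d) (b / a) (\<lambda>r. ?\<Phi> c r * ?\<Phi> d r)"
      by (rule has_mgf_convolution[OF ba M[OF c] M[OF d]])
    then have "has_mgf (M c \<star> M d) (b / a) (?\<Phi> (c + d))"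
      by (simp only: powr_add)
    then have "M (c + d) = (M c \<star> M d)"
      using c d by (intro has_mgf_unique[OF ba M]) auto
    then show "is_product_convolution (\<tau> c) (\<tau> d) (\<tau> (c + d))"
      unfolding \<tau>_def using is_product_convolution_exp_law[OF dist[OF c] dist[OF d]] by simp
  next
    show "vaguely_tends_to \<tau> (return (restrict_space borel {0<..}) 1) (at_right 0)"
      unfolding \<tau>_def[abs_def]
    proof (rule vaguely_tends_to_exp_law[OF dist])
      fix x
      let ?w = "of_real b + \<i> * of_real a * complex_of_real x"
      \<comment> \<open>For fixed argument the power is an exponential in \<open>c\<close>, so it
        tends to 1.\<close>
      have "((\<lambda>c. Gamma_ratio_power ?w b c) \<longlongrightarrow> exp (of_real 0 * ln_Gamma ?w) / exp (of_real 0 * ln_Gamma (complex_of_real b))) (at_right 0)"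
        unfolding Gamma_ratio_power_def Gamma_power_def by (intro tendsto_intros) simp
      then have "((\<lambda>c. Gamma_ratio_power ?w b c) \<longlongrightarrow> 1) (at_right 0)" by simp
      moreover have "\<forall>\<^sub>F c in at_right 0. Gamma_ratio_power ?w b c = char (M c) x"
        using eventually_at_right_less[of "0::real"]
        by eventually_elim (simp add: char_Gamma[OF a b M])
      ultimately show "((\<lambda>c. char (M c) x) \<longlongrightarrow> 1) (at_right 0)"
        by (rule Lim_transform_eventually)
    qed
  qed
  moreover have "Mellin_formula a b \<tau>"
    unfolding Mellin_formula_def \<tau>_def using Mellin_exp_law[OF a b _ M] by blast
  moreover have "\<tau>' c = \<tau> c" if "convolution_semigroup \<tau>'" "Mellin_formula a b \<tau>'" "c > 0" for \<tau>' c
    unfolding \<tau>_def using that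
    by (intro exp_law_unique[OF a b _ M]) (auto simp: convolution_semigroup_def Mellin_formula_def)
  moreover have "has_moments (\<tau> c) (\<lambda>n. gamma_moment a b n powr c)" if "c > 0" for c
    unfolding \<tau>_def by (rule has_moments_exp_law[OF a b that M[OF that]])
  moreover have "infinitely_divisible_Stieltjes (gamma_moment a b)"
    unfolding infinitely_divisible_Stieltjes_def
  proof (intro conjI allI impI)
    show powr: "Stieltjes_moment_sequence (\<lambda>n. gamma_moment a b n powr c)" if "c > 0" for c
      unfolding Stieltjes_moment_sequence_def using Stieltjes_exp[OF a b that M[OF that]] by blast
    \<comment> \<open>The sequence itself is the case \<open>c = 1\<close>;
      \<open>x powr 1 = x\<close> needs the moments to be nonnegative.\<close>
    have "gamma_moment a b n powr 1 = gamma_moment a b n" for n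
    proof -
      have "Gamma (a * real n + b) > 0" "Gamma b > 0"
        using a b by (auto intro!: Gamma_real_pos add_nonneg_pos)
      then show ?thesis by (simp add: gamma_moment_def)
    qed
    then show "Stieltjes_moment_sequence (gamma_moment a b)"
      using powr[of 1] by simp
  qed
  moreover have "S_determinate (\<lambda>n. gamma_moment a b n powr c) \<longleftrightarrow> a * c \<le> 2" if "c > 0" for c
    using S_determinate_Gamma_powr[OF a b that M[OF that]] not_S_determinate_Gamma_powr[OF a b that]
    by (meson not_le)
  moreover have "integrable lborel (e_integrand a b c t)" if "c > 0" "t > 0" for c t
    by (rule integrable_e_integrand[OF a b that(1) M[OF that(1)] that(2)])
  moreover have "\<tau> c = density (restrict_space lborel {0<..}) (\<lambda>t. ennreal (Re (e_density a b c t)))"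
    "probability_density_pos (e_density a b c)" "C_infinity_on {0<..} (e_density a b c)" if "c > 0" for c
    unfolding \<tau>_def by (rule e_density_facts[OF a b that M[OF that]])+
  ultimately show ?thesis by blast
qed

end
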